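(* Let $n\ge1$, let $\alpha=(\alpha_1,\dots,\alpha_n)$ with $0<\alpha_i<1$ for $i=1,\dots,n$, and let $\beta=(1/2,\dots,1/2)+\alpha$. There exist positive constants $A,B$ (depending only on $n$ and $\alpha$) such that for all $f\in\mathcal S(\mathbf R^n)$ and all $x\in\mathbf R^n$, $$A\,D_\alpha(f)(x)\le h_\beta\big((H\otimes\cdots\otimes H)(f)\big)(x)\le B\,D_\alpha(f)(x).$$
   Context: $\mathcal S(\mathbf R^n)$ is the Schwartz space and $\hat f(\xi)=\int_{\mathbf R^n} f(x)e^{-2\pi i x\cdot\xi}\,dx$. The $n$-fold tensor product of the Hilbert transform, $H\otimes\cdots\otimes H$, is given by $\big((H\otimes\cdots\otimes H)f\big)^{\wedge}(\xi)=\prod_{j=1}^n(-i\,\mathrm{sgn}(\xi_j))\,\hat f(\xi)$. For $\beta=(\beta_1,\dots,\beta_n)$, $\beta_i>0$, and $R=(R_1,\dots,R_n)$, $R_i>0$, put $$\tau_R^\beta(g)(x)=\int_{-R_1}^{R_1}\cdots\int_{-R_n}^{R_n}\prod_{i=1}^n\left[\beta_i\frac{|\xi_i|}{R_i}\left(1-\frac{|\xi_i|}{R_i}\right)^{\beta_i-1}\right]\hat g(\xi)e^{2\pi i x\cdot\xi}\,d\xi,$$ $$h_\beta(g)(x)=\left(\int_0^\infty\cdots\int_0^\infty|\tau_R^\beta(g)(x)|^2\,\frac{dR_1}{R_1}\cdots\frac{dR_n}{R_n}\right)^{1/2}.$$ For $0<\alpha_i<1$ let $I_\alpha=I_{\alpha_1}\otimes\cdots\otimes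 I_{\alpha_n}$ be the multiparameter Riesz potential, $I_\alpha(f)(x)=\int_{\mathbf R^n}\prod_{i=1}^n|\xi_i|^{-\alpha_i}\hat f(\xi)e^{2\pi i x\cdot\xi}\,d\xi$. For a function $g$ on $\mathbf R$ and $s>0$ put $\delta_s(g)(x)=g(x-s)-g(x+s)$; $\delta_{t_1}\otimes\cdots\otimes\delta_{t_n}$ denotes applying $\delta_{t_i}$ in the $i$-th variable for each $i$. Then $$D_\alpha(f)(x)=\left(\int_0^\infty\cdots\int_0^\infty|(\delta_{t_1}\otimes\cdots\otimes\delta_{t_n})(I_\alpha(f))(x)|^2\,t_1^{-2\alpha_1}\cdots t_n^{-2\alpha_n}\,\frac{dt_1}{t_1}\cdots\frac{dt_n}{t_n}\right)^{1/2}.$$ *)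

theory Defs
  imports "HOL-Analysis.Analysis"
begin

section \<open>Schwartz functions\<close>

definition partial_deriv :: "'n \<Rightarrow> (real ^ 'n \<Rightarrow> complex) \<Rightarrow> real ^ 'n \<Rightarrow> complex" where
  "partial_deriv i f = (\<lambda>x. frechet_derivative f (at x) (axis i 1))"

definition iter_partial_deriv :: "'n list \<Rightarrow> (real ^ 'n \<Rightarrow> complex) \<Rightarrow> real ^ 'n \<Rightarrow> complex" where
  "iter_partial_deriv is f = foldr partial_deriv is f"

text \<open>
  Requiring every iterated partial derivative to be (Frechet) differentiable everywhere is the same
  as requiring \<open>f\<close> to be infinitely differentiable.
\<close>

definition schwartz :: "(real ^ 'n \<Rightarrow> complex) \<Rightarrow> bool" where
  "schwartz f \<longleftrightarrow>
     (\<forall>is. iter_partial_deriv is f differentiable_on UNIV \<and>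
       (\<forall>k::nat. bounded (range (\<lambda>x. norm x ^ k *\<^sub>R iter_partial_deriv is f x))))"


section \<open>Fourier transform\<close>

definition fourier :: "(real ^ 'n \<Rightarrow> complex) \<Rightarrow> real ^ 'n \<Rightarrow> complex" where
  "fourier f \<xi> = (LINT x|lborel. f x * cis (- 2 * pi * (x \<bullet> \<xi>)))"

text \<open>
  For Schwartz \<open>f\<close>, the function \<open>(H \<otimes> \<dots> \<otimes> H) f\<close> need not be Lebesgue integrable, so the integral
  above is not available for its Fourier transform (the Bochner integral of a non-integrable
  function is \<open>0\<close>). The Fourier transform of such a function is therefore understood in the sense of
  tempered distributions: \<open>G\<close> represents the Fourier transform of \<open>g\<close> if
  \<open>\<integral> g \<phi>^ = \<integral> G \<phi>\<close> for all Schwartz \<open>\<phi>\<close>. On integrable and on square integrable functions this is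
  the usual Fourier transform. It determines \<open>G\<close> up to a null set only; \<open>fourier_dist\<close> picks some
  representative, and is used only under an integral sign.
\<close>

definition is_fourier_transform ::
    "(real ^ 'n \<Rightarrow> complex) \<Rightarrow> (real ^ 'n \<Rightarrow> complex) \<Rightarrow> bool" where
  "is_fourier_transform g G \<longleftrightarrow>
     (\<forall>\<phi>. schwartz \<phi> \<longrightarrow>
        integrable lborel (\<lambda>x. g x * fourier \<phi> x) \<and>
        integrable lborel (\<lambda>\<xi>. G \<xi> * \<phi> \<xi>) \<and>
        (LINT x|lborel. g x * fourier \<phi> x) = (LINT \<xi>|lborel. G \<xi> * \<phi> \<xi>))"

definition fourier_dist :: "(real ^ 'n \<Rightarrow> complex) \<Rightarrow> real ^ 'n \<Rightarrow> complex" where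
  "fourier_dist g = (SOME G. is_fourier_transform g G)"


section \<open>Tensor product of Hilbert transforms\<close>

text \<open>
  For Schwartz \<open>f\<close> the function \<open>\<Prod>j. -i sgn \<xi>\<^sub>j\<close> times the Fourier transform of \<open>f\<close> is integrable, and
  \<open>(H \<otimes> \<dots> \<otimes> H) f\<close>, the function having it as its Fourier transform, is its inverse Fourier integral.
\<close>

definition tensor_hilbert :: "(real ^ 'n \<Rightarrow> complex) \<Rightarrow> real ^ 'n \<Rightarrow> complex" where
  "tensor_hilbert f x =
     (LINT \<xi>|lborel. (\<Prod>j\<in>UNIV. - \<i> * complex_of_real (sgn (\<xi> $ j))) * fourier f \<xi>
        * cis (2 * pi * (x \<bullet> \<xi>)))"


section \<open>Square functions\<close>

text \<open>The square functions take values in \<open>[0, \<infinity>]\<close>, so nothing is claimed about their finiteness.\<close>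

definition ennsqrt :: "ennreal \<Rightarrow> ennreal" where
  "ennsqrt x = (if x = \<infinity> then \<infinity> else ennreal (sqrt (enn2real x)))"

definition tau :: "real ^ 'n \<Rightarrow> real ^ 'n \<Rightarrow> (real ^ 'n \<Rightarrow> complex) \<Rightarrow> real ^ 'n \<Rightarrow> complex" where
  "tau \<beta> R g x =
     (LINT \<xi>:{\<xi>. \<forall>i. - R $ i \<le> \<xi> $ i \<and> \<xi> $ i \<le> R $ i}|lborel.
        complex_of_real (\<Prod>i\<in>UNIV. \<beta> $ i * (\<bar>\<xi> $ i\<bar> / R $ i) * (1 - \<bar>\<xi> $ i\<bar> / R $ i) powr (\<beta> $ i - 1))
        * fourier_dist g \<xi> * cis (2 * pi * (x \<bullet> \<xi>)))"

definition h_square :: "real ^ 'n \<Rightarrow> (real ^ 'n \<Rightarrow> complex) \<Rightarrow> real ^ 'n \<Rightarrow> ennreal" where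
  "h_square \<beta> g x =
     ennsqrt (\<integral>\<^sup>+ R\<in>{R. \<forall>i. 0 < R $ i}.
       ennreal ((cmod (tau \<beta> R g x))\<^sup>2 * (\<Prod>i\<in>UNIV. 1 / R $ i)) \<partial>lborel)"

definition riesz_potential :: "real ^ 'n \<Rightarrow> (real ^ 'n \<Rightarrow> complex) \<Rightarrow> real ^ 'n \<Rightarrow> complex" where
  "riesz_potential \<alpha> f x =
     (LINT \<xi>|lborel. complex_of_real (\<Prod>i\<in>UNIV. \<bar>\<xi> $ i\<bar> powr (- \<alpha> $ i)) * fourier f \<xi>
        * cis (2 * pi * (x \<bullet> \<xi>)))"

definition delta_coord :: "'n \<Rightarrow> real \<Rightarrow> (real ^ 'n \<Rightarrow> complex) \<Rightarrow> real ^ 'n \<Rightarrow> complex" where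
  "delta_coord i s F x = F (x - s *\<^sub>R axis i 1) - F (x + s *\<^sub>R axis i 1)"

text \<open>The one-variable differences commute, so the order in which \<open>fold\<close> applies them is irrelevant.\<close>

lemma delta_coord_commute:
  "delta_coord i s (delta_coord j t F) = delta_coord j t (delta_coord i s F)"
  by (rule ext) (simp add: delta_coord_def algebra_simps)

lemma comp_fun_commute_delta_coord:
  fixes t :: "real ^ 'n"
  shows "comp_fun_commute (\<lambda>i. delta_coord i (t $ i))"
  by unfold_locales (simp add: fun_eq_iff comp_def delta_coord_commute)

definition tensor_delta :: "real ^ 'n \<Rightarrow> (real ^ 'n \<Rightarrow> complex) \<Rightarrow> real ^ 'n \<Rightarrow> complex" where
  "tensor_delta t F = Finite_Set.fold (\<lambda>i. delta_coord i (t $ i)) F UNIV"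

definition D_square :: "real ^ 'n \<Rightarrow> (real ^ 'n \<Rightarrow> complex) \<Rightarrow> real ^ 'n \<Rightarrow> ennreal" where
  "D_square \<alpha> f x =
     ennsqrt (\<integral>\<^sup>+ t\<in>{t. \<forall>i. 0 < t $ i}.
       ennreal ((cmod (tensor_delta t (riesz_potential \<alpha> f) x))\<^sup>2
         * (\<Prod>i\<in>UNIV. (t $ i) powr (- 2 * \<alpha> $ i)) * (\<Prod>i\<in>UNIV. 1 / t $ i)) \<partial>lborel)"

end

theory Submission
  imports Defs
    "HOL-Probability.Characteristic_Functions"
    "HOL-Probability.Sinc_Integral"
    "HOL-Library.Landau_Symbols"
begin

text \<open>
  Both square functions arise from one operation. In the coordinates \<open>t = e^y\<close> and \<open>R = e^{-y}\<close>, the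
  function integrated in \<open>D_\<alpha>\<close>, respectively in \<open>h_\<beta>\<close>, is up to a constant the modulus of
  \<open>\<integral> \<Prod>\<^sub>i sgn \<xi>\<^sub>i K\<^sub>i(y\<^sub>i + ln |\<xi>\<^sub>i|) \<Phi>(\<xi>) d\<xi>\<close> with \<open>\<Phi>(\<xi>) = f^(\<xi>) e^{2\<pi>ix\<xi>}\<close>, where
  \<open>K\<^sub>i(y) = sin(2\<pi>e^y) e^{-\<alpha>\<^sub>iy}\<close>, respectively
  \<open>K\<^sub>i(y) = \<beta>\<^sub>ie^y(1 - e^y)^{\<beta>\<^sub>i-1}\<close> for \<open>y < 0\<close>; the Hilbert transforms supply
  the signs. As a function of \<open>y\<close> this has Fourier transform \<open>\<Prod>\<^sub>i K\<^sub>i^(\<lambda>\<^sub>i) Q(\<lambda>)\<close> with \<open>Q\<close> independent of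
  the kernels, so by Plancherel the claim reduces to two-sided bounds between the two
  one-dimensional transforms, that is, the Mellin transforms of the original kernels on the imaginary
  axis. These are quotients of Gamma functions, of order \<open>|\<lambda>|^{-\<alpha>-1/2}\<close> and \<open>|\<lambda>|^{-\<beta>}\<close>.
\<close>

text \<open>Each integrand depends on its dilation parameter only through products such as
  \<open>t_i |\<xi>_i|\<close>, and logarithms turn dilations into translations; hence the
  factorisation over the kernels. The sine kernel is integrable in \<open>y\<close> because it is
  O(exp(-\<alpha>y)) at +\<infinity> and, by |sin u| \<le> |u|, O(exp((1-\<alpha>)y)) at
  -\<infinity>. With \<Phi> continuous and dominated by an integrable product weight, the functions
  of \<open>y\<close> are integrable, bounded and continuous, so Plancherel is required for that
  class only and follows from Gaussian summation. The delicate point is that the quotient of the two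
  transforms must be bounded above and below for every real frequency, small ones included, so an
  asymptotic expansion alone would not do; Gamma values never vanish and convexity in the real part
  gives bounds without exceptions. The 1/2 in \<beta> = 1/2 + \<alpha> is produced by the sine
  transform: its Gamma quotient has real parts (1-\<alpha>)/2 and (\<alpha>+2)/2, which differ by
  \<alpha> + 1/2. The Fourier transform inside \<open>tau\<close> is an arbitrary representative, so
  a uniqueness theorem is needed to replace it by the explicit multiplier.\<close>

lemma bij_axis_Basis: "bij_betw (\<lambda>i. axis i (1::real)) UNIV (Basis :: (real ^ 'n) set)"
  by (auto simp: bij_betw_def inj_on_def axis_eq_axis Basis_vec_def)

text \<open>Tonelli for \<open>lborel\<close>, whose product structure is indexed by the vectors of
  \<open>Basis\<close>; \<open>g\<close> transports the coordinate index along the inverse of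
  \<open>axis\<close>. The Bochner version follows the same pattern through the product measure over
  \<open>Basis\<close>.\<close>

lemma nn_integral_prod_vec:
  fixes f :: "'n::finite \<Rightarrow> real \<Rightarrow> ennreal"
  assumes [measurable]: "\<And>i. f i \<in> borel_measurable borel"
  shows "(\<integral>\<^sup>+x. (\<Prod>i\<in>UNIV. f i (x $ i)) \<partial>(lborel :: (real ^ 'n) measure)) = (\<Prod>i\<in>UNIV. \<integral>\<^sup>+x. f i x \<partial>lborel)"
proof -
  define g where "g b = f (inv (\<lambda>i. axis i (1::real)) b)" for b :: "real ^ 'n"
  have inj: "inj (\<lambda>i::'n. axis i (1::real))"
    using bij_axis_Basis by (auto simp: bij_betw_def)
  have g: "g (axis i 1) = f i" for i
    by (simp add: g_def inv_f_f[OF inj])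
  have r: "(\<Prod>b\<in>Basis. h b) = (\<Prod>i\<in>UNIV. h (axis i 1))" for h :: "real ^ 'n \<Rightarrow> ennreal"
    using prod.reindex_bij_betw[OF bij_axis_Basis] by metis
  have "(\<integral>\<^sup>+x. (\<Prod>b\<in>Basis. g b (x \<bullet> b)) \<partial>(lborel :: (real ^ 'n) measure)) = (\<Prod>b\<in>Basis. (\<integral>\<^sup>+x. g b x \<partial>lborel))"
    by (rule nn_integral_lborel_prod) (auto simp: g_def)
  then show ?thesis
    unfolding r g by (simp add: cart_eq_inner_axis)
qed

lemma
  fixes f :: "'n::finite \<Rightarrow> real \<Rightarrow> 'a :: {real_normed_field,banach,second_countable_topology}"
  assumes f: "\<And>i. integrable lborel (f i)"
  shows integrable_prod_vec: "integrable (lborel :: (real ^ 'n) measure) (\<lambda>x. \<Prod>i\<in>UNIV. f i (x $ i))" (is ?I)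
    and integral_prod_vec: "(LINT x|(lborel :: (real ^ 'n) measure). (\<Prod>i\<in>UNIV. f i (x $ i))) = (\<Prod>i\<in>UNIV. (LINT x|lborel. f i x))" (is ?E)
proof -
  interpret product_sigma_finite "\<lambda>_::real ^ 'n. lborel :: real measure" ..
  define g where "g b = f (inv (\<lambda>i. axis i (1::real)) b)" for b :: "real ^ 'n"
  have inj: "inj (\<lambda>i::'n. axis i (1::real))"
    using bij_axis_Basis by (auto simp: bij_betw_def)
  have g: "g (axis i 1) = f i" for i
    by (simp add: g_def inv_f_f[OF inj])
  have r: "(\<Prod>b\<in>Basis. h b) = (\<Prod>i\<in>UNIV. h (axis i 1))" for h :: "real ^ 'n \<Rightarrow> 'a"
    using prod.reindex_bij_betw[OF bij_axis_Basis] by metis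
  have gi: "integrable lborel (g b)" for b unfolding g_def by (rule f)
  have gm [measurable]: "g b \<in> borel_measurable borel" for b
    using borel_measurable_integrable[OF gi] by simp
  have m: "(\<lambda>x::real^'n. \<Prod>b\<in>Basis. g b (x \<bullet> b)) \<in> borel_measurable borel"
    by measurable
  have 1: "integrable (Pi\<^sub>M Basis (\<lambda>_::real ^ 'n. lborel)) (\<lambda>x. \<Prod>b\<in>Basis. g b (x b))"
    by (rule product_integrable_prod) (auto simp: gi)
  have 2: "integral\<^sup>L (Pi\<^sub>M Basis (\<lambda>_::real ^ 'n. lborel)) (\<lambda>x. \<Prod>b\<in>Basis. g b (x b)) = (\<Prod>b\<in>Basis. integral\<^sup>L lborel (g b))"
    by (rule product_integral_prod) (auto simp: gi)
  have mf: "(\<lambda>f. \<Sum>b\<in>Basis. f b *\<^sub>R b) \<in> measurable (Pi\<^sub>M Basis (\<lambda>_::real ^ 'n. lborel)) borel"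
    by measurable
  have s: "(\<Prod>b\<in>Basis. g b ((\<Sum>b\<in>Basis. x b *\<^sub>R b) \<bullet> b)) = (\<Prod>b\<in>Basis. g b (x b))" for x
    by (intro prod.cong) auto
  have lb: "(lborel :: (real ^ 'n) measure) = distr (Pi\<^sub>M Basis (\<lambda>_. lborel)) borel (\<lambda>f. \<Sum>b\<in>Basis. f b *\<^sub>R b)"
    by (rule lborel_eq)
  have I: "integrable (lborel :: (real ^ 'n) measure) (\<lambda>x. \<Prod>b\<in>Basis. g b (x \<bullet> b))"
    unfolding lb using 1 by (subst integrable_distr_eq[OF mf m]) (simp add: s)
  have E: "integral\<^sup>L (lborel :: (real ^ 'n) measure) (\<lambda>x. \<Prod>b\<in>Basis. g b (x \<bullet> b)) = (\<Prod>b\<in>Basis. integral\<^sup>L lborel (g b))"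
    unfolding lb using 2 by (subst integral_distr[OF mf m]) (simp add: s)
  show ?I using I unfolding r g by (simp add: cart_eq_inner_axis)
  show ?E using E unfolding r g by (simp add: cart_eq_inner_axis)
qed

lemma integral_translate_lborel:
  fixes f :: "'a::euclidean_space \<Rightarrow> 'b::{banach,second_countable_topology}"
  assumes [measurable]: "f \<in> borel_measurable borel"
  shows "(LINT x|lborel. f (c + x)) = (LINT x|lborel. f x)"
  using integral_distr[of "(+) c" lborel borel f] by (simp add: lborel_distr_plus)

lemma integrable_translate_lborel:
  fixes f :: "'a::euclidean_space \<Rightarrow> 'b::{banach,second_countable_topology}"
  assumes "integrable lborel f"
  shows "integrable lborel (\<lambda>x. f (c + x))"
proof -
  have [measurable]: "f \<in> borel_measurable borel" using assms by auto
  show ?thesis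
    using integrable_distr_eq[of "(+) c" lborel borel f] assms by (simp add: lborel_distr_plus)
qed

lemma integral_scale_lborel:
  fixes f :: "'a::euclidean_space \<Rightarrow> 'b::{banach,second_countable_topology}"
  assumes [measurable]: "f \<in> borel_measurable borel" and c: "c \<noteq> (0::real)"
  shows "(LINT x|lborel. f (c *\<^sub>R x)) = (1 / \<bar>c\<bar> ^ DIM('a)) *\<^sub>R (LINT x|lborel. f x)"
proof -
  have "(LINT x|lborel. f x) = \<bar>c\<bar> ^ DIM('a) *\<^sub>R (LINT x|lborel. f (c *\<^sub>R x))"
    by (subst lborel_affine[OF c, of 0]) (simp add: integral_density integral_distr)
  then show ?thesis using c by simp
qed

lemma nn_integral_uminus_lborel:
  fixes f :: "'a::euclidean_space \<Rightarrow> ennreal"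
  assumes [measurable]: "f \<in> borel_measurable borel"
  shows "(\<integral>\<^sup>+x. f (- x) \<partial>lborel) = (\<integral>\<^sup>+x. f x \<partial>lborel)"
  by (subst (2) lborel_affine[of "- 1" 0]) (simp_all add: nn_integral_density nn_integral_distr)

lemma borel_measurable_vec_lambda [measurable]:
  fixes f :: "'n::finite \<Rightarrow> 'a \<Rightarrow> real"
  assumes "\<And>i. f i \<in> borel_measurable M"
  shows "(\<lambda>x. \<chi> i. f i x) \<in> borel_measurable M"
  by (subst borel_measurable_euclidean_space) (auto simp: Basis_vec_def inner_axis assms)

section \<open>The substitution r = e^y in one and several variables\<close>

definition log_weight :: "real \<Rightarrow> real" where
  "log_weight r = indicator {0<..} r / r"

lemma log_weight_nonneg: "0 \<le> log_weight r"
  by (auto simp: log_weight_def indicator_def)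

lemma borel_measurable_log_weight [measurable]: "log_weight \<in> borel_measurable borel"
  unfolding log_weight_def[abs_def] by measurable

lemma nn_integral_log_weight:
  assumes "a \<le> b"
  shows "(\<integral>\<^sup>+r. ennreal (log_weight r) * indicator {exp a<..<exp b} r \<partial>lborel) = ennreal (b - a)"
proof -
  have "(\<integral>\<^sup>+r. ennreal (log_weight r) * indicator {exp a<..<exp b} r \<partial>lborel) = (\<integral>\<^sup>+r. ennreal (1 / r) * indicator {exp a .. exp b} r \<partial>lborel)"
  proof (rule nn_integral_cong_AE)
    have "AE r in lborel. r \<noteq> exp a" "AE r in lborel. r \<noteq> exp b"
      by (auto intro: AE_lborel_singleton)
    then show "AE r in lborel. ennreal (log_weight r) * indicator {exp a<..<exp b} r = ennreal (1 / r) * indicator {exp a .. exp b} r"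
    proof eventually_elim
      case (elim r)
      then show ?case using less_le_trans[OF exp_gt_zero, of a r] by (cases "0 < r") (auto simp: log_weight_def indicator_def)
    qed
  qed
  also have "\<dots> = ennreal (ln (exp b) - ln (exp a))"
  proof (rule nn_integral_FTC_Icc)
    fix x assume x: "x \<in> {exp a .. exp b}"
    then have "0 < x" using less_le_trans[OF exp_gt_zero, of a x] by auto
    then show "(ln has_real_derivative 1 / x) (at x)"
      by (auto intro!: derivative_eq_intros)
    show "0 \<le> 1 / x" using \<open>0 < x\<close> by simp
  qed (use assms in auto)
  finally show ?thesis by simp
qed

text \<open>\<open>log_weight\<close> is the density of the multiplicative Haar measure dr/r,
  extended by zero. A measure that gives boxes their volume is Lebesgue measure, and
  \<open>ln\<close> pulls the interval (l, u) back to (e^l, e^u), of Haar measure u - l. The value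
  of \<open>ln\<close> at r \<le> 0 is harmless because the density vanishes there.\<close>

lemma lborel_eq_distr_ln: "lborel = distr (density lborel (\<lambda>r. ennreal (log_weight r))) borel ln"
proof (rule lborel_eqI)
  fix l u :: real assume le: "\<And>b. b \<in> Basis \<Longrightarrow> l \<bullet> b \<le> u \<bullet> b"
  have le': "l \<le> u" using le by simp
  have "emeasure (distr (density lborel (\<lambda>r. ennreal (log_weight r))) borel ln) (box l u) = emeasure (density lborel (\<lambda>r. ennreal (log_weight r))) (ln -` box l u)"
    by (subst emeasure_distr) auto
  also have "\<dots> = (\<integral>\<^sup>+r. ennreal (log_weight r) * indicator (ln -` box l u) r \<partial>lborel)"
    by (rule emeasure_density) (use measurable_sets[of ln borel borel "box l u"] in auto)
  also have "\<dots> = (\<integral>\<^sup>+r. ennreal (log_weight r) * indicator {exp l<..<exp u} r \<partial>lborel)"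
  proof (rule nn_integral_cong)
    fix r :: real
    show "ennreal (log_weight r) * indicator (ln -` box l u) r = ennreal (log_weight r) * indicator {exp l<..<exp u} r"
    proof (cases "0 < r")
      case True
      have "a < ln r \<longleftrightarrow> exp a < r" "ln r < a \<longleftrightarrow> r < exp a" for a
        using True by (metis exp_ln exp_less_cancel_iff)+
      then show ?thesis by (simp add: indicator_def)
    qed (simp add: log_weight_def)
  qed
  also have "\<dots> = ennreal (u - l)" by (rule nn_integral_log_weight[OF le'])
  finally show "emeasure (distr (density lborel (\<lambda>r. ennreal (log_weight r))) borel ln) (box l u) = (\<Prod>b\<in>Basis. (u - l) \<bullet> b)"
    by simp
qed auto

lemma
  fixes f :: "real \<Rightarrow> 'b::{banach,second_countable_topology}"
  assumes [measurable]: "f \<in> borel_measurable borel"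
  shows integrable_exp_subst: "integrable lborel (\<lambda>y. exp y *\<^sub>R f (exp y)) \<longleftrightarrow> set_integrable lborel {0<..} f" (is ?I)
    and integral_exp_subst: "(LINT y|lborel. exp y *\<^sub>R f (exp y)) = (LINT r:{0<..}|lborel. f r)" (is ?E)
proof -
  have e: "(log_weight r * exp (ln r)) *\<^sub>R f (exp (ln r)) = indicator {0<..} r *\<^sub>R f r" for r
    by (auto simp: log_weight_def indicator_def)
  show ?I
    unfolding set_integrable_def
    by (subst lborel_eq_distr_ln, subst integrable_distr_eq, simp, simp, subst integrable_density)
       (simp_all add: e log_weight_nonneg)
  show ?E
    unfolding set_lebesgue_integral_def
    by (subst lborel_eq_distr_ln, subst integral_distr, simp, simp, subst integral_density)
       (simp_all add: e log_weight_nonneg)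
qed

text \<open>Turns the measure of both square functions, a product of factors dR_i/R_i on the
  positive orthant, into Lebesgue measure. The push-forward under the coordinatewise logarithm is
  again recognised on boxes. The integrals are extended nonnegative ones, so infinite values of the
  square functions are covered.\<close>

lemma nn_integral_exp_subst:
  fixes \<phi> :: "real ^ 'n \<Rightarrow> ennreal"
  assumes [measurable]: "\<phi> \<in> borel_measurable borel"
  shows "(\<integral>\<^sup>+ R\<in>{R. \<forall>i. 0 < R $ i}. \<phi> R * ennreal (\<Prod>i\<in>UNIV. 1 / R $ i) \<partial>lborel) = (\<integral>\<^sup>+ y. \<phi> (\<chi> i. exp (y $ i)) \<partial>lborel)"
proof -
  let ?P = "{R :: real ^ 'n. \<forall>i. 0 < R $ i}"
  define w :: "real \<Rightarrow> ennreal" where "w r = ennreal (log_weight r)" for r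
  have wm [measurable]: "w \<in> borel_measurable borel" unfolding w_def by measurable
  have wprod: "indicator ?P R * ennreal (\<Prod>i\<in>UNIV. 1 / R $ i) = (\<Prod>i\<in>UNIV. w (R $ i))" for R :: "real ^ 'n"
  proof (cases "R \<in> ?P")
    case True
    then show ?thesis by (auto simp: w_def log_weight_def prod_ennreal less_imp_le)
  next
    case False
    then obtain i where "\<not> 0 < R $ i" by auto
    then have "w (R $ i) = 0" by (simp add: w_def log_weight_def)
    then show ?thesis using False by (auto simp: prod_zero_iff)
  qed
  define L :: "real ^ 'n \<Rightarrow> real ^ 'n" where "L R = (\<chi> i. ln (R $ i))" for R
  have [measurable]: "L \<in> borel_measurable borel"
    unfolding L_def by measurable
  let ?D = "density lborel (\<lambda>R::real^'n. \<Prod>i\<in>UNIV. w (R $ i))"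
  have lb: "lborel = distr ?D borel L"
  proof (rule lborel_eqI)
    fix l u :: "real ^ 'n" assume le: "\<And>b. b \<in> Basis \<Longrightarrow> l \<bullet> b \<le> u \<bullet> b"
    have le': "l $ i \<le> u $ i" for i
      using le[of "axis i 1"] by (simp add: cart_eq_inner_axis)
    have ind: "(\<Prod>i\<in>UNIV. w (R $ i)) * indicator (L -` box l u) R = (\<Prod>i\<in>UNIV. w (R $ i) * indicator {exp (l $ i)<..<exp (u $ i)} (R $ i))" for R
    proof (cases "\<forall>i. 0 < R $ i")
      case True
      have ln: "a < ln (R $ i) \<longleftrightarrow> exp a < R $ i" "ln (R $ i) < a \<longleftrightarrow> R $ i < exp a" for a i
        using True by (metis exp_ln exp_less_cancel_iff)+
      have "indicator (L -` box l u) R = (\<Prod>i\<in>UNIV. indicator {exp (l $ i)<..<exp (u $ i)} (R $ i) :: ennreal)"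
        by (auto simp: indicator_def mem_box_cart L_def ln prod_zero_iff)
      then show ?thesis by (simp add: prod.distrib)
    next
      case False
      then obtain i where "\<not> 0 < R $ i" by auto
      then have "w (R $ i) = 0" by (simp add: w_def log_weight_def)
      then have "(\<Prod>i\<in>UNIV. w (R $ i)) = 0" "(\<Prod>i\<in>UNIV. w (R $ i) * indicator {exp (l $ i)<..<exp (u $ i)} (R $ i)) = 0"
        by (auto simp: prod_zero_iff)
      then show ?thesis by (simp only: mult_zero_left)
    qed
    have "emeasure (distr ?D borel L) (box l u) = emeasure ?D (L -` box l u)"
      by (subst emeasure_distr) auto
    also have "\<dots> = (\<integral>\<^sup>+R. (\<Prod>i\<in>UNIV. w (R $ i)) * indicator (L -` box l u) R \<partial>lborel)"
    proof (rule emeasure_density)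
      show "L -` box l u \<in> sets lborel"
        using measurable_sets[of L borel borel "box l u"] by simp
    qed measurable
    also have "\<dots> = (\<Prod>i\<in>UNIV. ennreal (u $ i - l $ i))"
      unfolding ind by (subst nn_integral_prod_vec) (auto simp: w_def nn_integral_log_weight le')
    also have "\<dots> = ennreal (\<Prod>i\<in>UNIV. (u $ i - l $ i))"
      by (rule prod_ennreal) (use le' in auto)
    also have "(\<Prod>i\<in>UNIV. (u $ i - l $ i)) = (\<Prod>b\<in>Basis. (u - l) \<bullet> b)"
      using prod.reindex_bij_betw[OF bij_axis_Basis, of "\<lambda>b. (u - l) \<bullet> b"] by (simp add: cart_eq_inner_axis inner_diff_left)
    finally show "emeasure (distr ?D borel L) (box l u) = (\<Prod>b\<in>Basis. (u - l) \<bullet> b)" .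
  qed auto
  have [measurable]: "(\<lambda>y::real^'n. \<chi> i. exp (y $ i)) \<in> borel_measurable borel"
    by measurable
  have "(\<integral>\<^sup>+ y. \<phi> (\<chi> i. exp (y $ i)) \<partial>lborel) = (\<integral>\<^sup>+ R. (\<Prod>i\<in>UNIV. w (R $ i)) * \<phi> (\<chi> i. exp (L R $ i)) \<partial>lborel)"
    by (subst lb, subst nn_integral_distr, simp, simp, subst nn_integral_density) auto
  also have "\<dots> = (\<integral>\<^sup>+ R. \<phi> R * ennreal (\<Prod>i\<in>UNIV. 1 / R $ i) * indicator ?P R \<partial>lborel)"
  proof (rule nn_integral_cong)
    fix R :: "real ^ 'n"
    show "(\<Prod>i\<in>UNIV. w (R $ i)) * \<phi> (\<chi> i. exp (L R $ i)) = \<phi> R * ennreal (\<Prod>i\<in>UNIV. 1 / R $ i) * indicator ?P R"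
    proof (cases "R \<in> ?P")
      case True
      then have "(\<chi> i. exp (L R $ i)) = R" by (auto simp: vec_eq_iff L_def)
      then show ?thesis using True wprod[of R] by (simp add: mult_ac)
    next
      case False
      then show ?thesis using wprod[of R] by auto
    qed
  qed
  finally show ?thesis by simp
qed

lemma measurable_cis [measurable (raw)]:
  "f \<in> borel_measurable M \<Longrightarrow> (\<lambda>x. cis (f x)) \<in> borel_measurable M"
  unfolding cis_conv_exp by measurable

lemma integrable_mult_cis:
  fixes f :: "'a \<Rightarrow> complex"
  assumes "integrable M f" and [measurable]: "h \<in> borel_measurable M"
  shows "integrable M (\<lambda>x. f x * cis (h x))"
proof (rule Bochner_Integration.integrable_bound[OF assms(1)])
  have [measurable]: "f \<in> borel_measurable M" using assms(1) by auto
  show "(\<lambda>x. f x * cis (h x)) \<in> borel_measurable M" by measurable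
qed (simp add: norm_mult)

lemma integrable_pair_bound:
  fixes h :: "'a::euclidean_space \<Rightarrow> 'b::euclidean_space \<Rightarrow> 'c :: {banach,second_countable_topology}"
  assumes [measurable]: "(\<lambda>(x, y). h x y) \<in> borel_measurable (borel \<Otimes>\<^sub>M borel)"
    and f: "integrable lborel (f :: 'a \<Rightarrow> real)" and g: "integrable lborel (g :: 'b \<Rightarrow> real)"
    and le: "\<And>x y. norm (h x y) \<le> f x * g y"
  shows "integrable (lborel \<Otimes>\<^sub>M lborel) (\<lambda>(x, y). h x y)"
proof (rule Bochner_Integration.integrable_bound)
  have [measurable]: "f \<in> borel_measurable borel" "g \<in> borel_measurable borel"
    using f g by auto
  show "integrable (lborel \<Otimes>\<^sub>M lborel) (\<lambda>(x, y). f x * g y)"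
  proof (rule lborel_pair.Fubini_integrable)
    show "(\<lambda>(x, y). f x * g y) \<in> borel_measurable (lborel \<Otimes>\<^sub>M lborel)" by measurable
    have "(\<lambda>x. LINT y|lborel. norm (f x * g y)) = (\<lambda>x. norm (f x) * (LINT y|lborel. norm (g y)))"
      by (simp add: abs_mult)
    then show "integrable lborel (\<lambda>x. LINT y|lborel. norm (case (x, y) of (x, y) \<Rightarrow> f x * g y))"
      using f by simp
  qed (use g in auto)
  show "(\<lambda>(x, y). h x y) \<in> borel_measurable (lborel \<Otimes>\<^sub>M lborel)"
    by (simp cong: measurable_cong_sets)
  show "AE p in lborel \<Otimes>\<^sub>M lborel. norm (case p of (x, y) \<Rightarrow> h x y) \<le> norm (case p of (x, y) \<Rightarrow> f x * g y)"
    using le by (auto intro!: AE_I2 order_trans[OF _ abs_ge_self] simp: split_beta)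
qed

subsection \<open>Gaussians\<close>

text \<open>The standard normal density in n dimensions. Its mass 1 makes its dilates an approximate
  identity, and the product form reduces integrability and Fourier transform to dimension
  one.\<close>

definition gauss :: "real ^ 'n \<Rightarrow> real" where
  "gauss w = (\<Prod>i\<in>UNIV. std_normal_density (w $ i))"

lemma norm_vec_power2: "(norm (x :: real ^ 'n))\<^sup>2 = (\<Sum>i\<in>UNIV. (x $ i)\<^sup>2)"
  by (simp only: power2_norm_eq_inner) (simp add: inner_vec_def power2_eq_square)

lemma gauss_eq: "gauss (w :: real ^ 'n) = (1 / sqrt (2 * pi)) ^ CARD('n) * exp (- (norm w)\<^sup>2 / 2)"
  unfolding gauss_def std_normal_density_def prod.distrib prod_constant
  by (simp add: norm_vec_power2 sum_divide_distrib sum_negf flip: exp_sum)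

lemma gauss_pos: "0 < gauss w"
  by (auto simp: gauss_def intro!: prod_pos normal_density_pos)

lemma borel_measurable_gauss [measurable]: "gauss \<in> borel_measurable borel"
  unfolding gauss_def[abs_def] by measurable

lemma integrable_gauss: "integrable lborel (gauss :: real ^ 'n \<Rightarrow> real)"
  unfolding gauss_def[abs_def] by (rule integrable_prod_vec) auto

lemma integral_gauss: "(LINT w|lborel. gauss (w :: real ^ 'n)) = 1"
  unfolding gauss_def by (subst integral_prod_vec) auto

lemma fourier_std_normal:
  "(LINT w|lborel. complex_of_real (std_normal_density w) * cis (t * w)) = complex_of_real (exp (- t\<^sup>2 / 2))"
proof -
  have "complex_of_real (exp (- t\<^sup>2 / 2)) = char std_normal_distribution t"
    by (simp add: char_std_normal_distribution)
  also have "\<dots> = (LINT w|lborel. complex_of_real (std_normal_density w) * cis (t * w))"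
    unfolding char_def by (subst integral_density) (auto simp: cis_conv_exp scaleR_conv_of_real)
  finally show ?thesis ..
qed

lemma cis_sum: "finite A \<Longrightarrow> cis (\<Sum>i\<in>A. f i) = (\<Prod>i\<in>A. cis (f i))"
  by (induction A rule: finite_induct) (auto simp: cis_mult[symmetric])

lemma fourier_gauss:
  "(LINT w|lborel. complex_of_real (gauss w) * cis (t \<bullet> w)) = complex_of_real (exp (- (norm (t :: real ^ 'n))\<^sup>2 / 2))"
proof -
  have "(LINT w|lborel. complex_of_real (gauss w) * cis (t \<bullet> w)) =
      (LINT w|lborel. (\<Prod>i\<in>UNIV. complex_of_real (std_normal_density (w $ i)) * cis (t $ i * w $ i)))"
    by (simp add: gauss_def inner_vec_def cis_sum prod.distrib)
  also have "\<dots> = (\<Prod>i\<in>UNIV. (LINT w|lborel. complex_of_real (std_normal_density w) * cis (t $ i * w)))"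
    by (rule integral_prod_vec[where f = "\<lambda>i w. complex_of_real (std_normal_density w) * cis (t $ i * w)"]) (rule integrable_mult_cis, auto)
  also have "\<dots> = complex_of_real (exp (- (norm t)\<^sup>2 / 2))"
    unfolding fourier_std_normal
    by (simp add: norm_vec_power2 sum_divide_distrib sum_negf flip: exp_sum of_real_prod)
  finally show ?thesis .
qed

lemma gauss_scale_integral:
  fixes c :: real assumes "c \<noteq> 0"
  shows "integrable lborel (\<lambda>w :: real ^ 'n. gauss (c *\<^sub>R w))"
proof -
  have "integrable lborel (\<lambda>w :: real ^ 'n. \<Prod>i\<in>UNIV. std_normal_density (0 + c * w $ i))"
    by (rule integrable_prod_vec[where f = "\<lambda>i w. std_normal_density (0 + c * w)"])
       (rule lborel_integrable_real_affine, use assms in auto)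
  then show ?thesis by (simp add: gauss_def)
qed

section \<open>Fourier inversion and Plancherel by Gaussian summation\<close>

lemma borel_measurable_fourier [measurable]:
  assumes [measurable]: "f \<in> borel_measurable borel"
  shows "fourier f \<in> borel_measurable borel"
  unfolding fourier_def[abs_def]
  by (rule lborel.borel_measurable_lebesgue_integral) (simp add: split_beta' cong: measurable_cong_sets)

lemma norm_fourier_le:
  "norm (fourier f \<xi>) \<le> (LINT x|lborel. norm (f x))"
  unfolding fourier_def
  by (rule order_trans[OF integral_norm_bound]) (simp add: norm_mult)

text \<open>Fubini moves the transform from \<open>a\<close> onto the Gaussian. The scale e/(2\<pi>)
  on the right appears because \<open>fourier\<close> has 2\<pi> in its phase while
  \<open>fourier_gauss\<close> has none. As e tends to 0 the right side tends to \<open>a 0\<close>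
  and the weight on the left to 1: this is the common core of inversion and Plancherel.\<close>

lemma fourier_weighted:
  fixes a :: "real ^ 'n \<Rightarrow> complex" and e :: real
  assumes a: "integrable lborel a" and e: "0 < e"
  shows "(LINT \<xi>|lborel. fourier a \<xi> * complex_of_real (exp (- (e * norm \<xi>)\<^sup>2 / 2)))
    = (LINT w|lborel. a ((e / (2 * pi)) *\<^sub>R w) * complex_of_real (gauss w))"
proof -
  have [measurable]: "a \<in> borel_measurable borel" using a by auto
  \<comment> \<open>\<open>c\<close> undoes the normalisation of \<open>gauss\<close> in the
    convergence factor.\<close>
  define c where "c = sqrt (2 * pi) ^ CARD('n)"
  have c0: "c > 0" by (simp add: c_def)
  have W: "exp (- (e * norm \<xi>)\<^sup>2 / 2) = c * gauss (e *\<^sub>R \<xi>)" for \<xi> :: "real ^ 'n"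
    using e by (simp add: gauss_eq c_def power_one_over)
  have inner: "(LINT \<xi>|lborel. cis (- 2 * pi * (x \<bullet> \<xi>)) * complex_of_real (gauss (e *\<^sub>R \<xi>)))
     = complex_of_real (c / e ^ CARD('n) * gauss ((2 * pi / e) *\<^sub>R x))" for x :: "real ^ 'n"
  proof -
    have "(LINT \<xi>|lborel. cis (- 2 * pi * (x \<bullet> \<xi>)) * complex_of_real (gauss (e *\<^sub>R \<xi>)))
      = (LINT \<xi>|lborel. complex_of_real (gauss (e *\<^sub>R \<xi>)) * cis (((- 2 * pi / e) *\<^sub>R x) \<bullet> (e *\<^sub>R \<xi>)))"
      using e by (simp add: mult.commute)
    also have "\<dots> = (1 / \<bar>e\<bar> ^ DIM(real ^ 'n)) *\<^sub>R (LINT w|lborel. complex_of_real (gauss w) * cis (((- 2 * pi / e) *\<^sub>R x) \<bullet> w))"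
      by (rule integral_scale_lborel[where f = "\<lambda>w. complex_of_real (gauss w) * cis (((- 2 * pi / e) *\<^sub>R x) \<bullet> w)"]) (use e in auto)
    also have "\<dots> = complex_of_real (1 / e ^ CARD('n) * exp (- (norm ((- 2 * pi / e) *\<^sub>R x))\<^sup>2 / 2))"
      unfolding fourier_gauss using e by (simp add: scaleR_conv_of_real)
    also have "exp (- (norm ((- 2 * pi / e) *\<^sub>R x))\<^sup>2 / 2) = c * gauss ((2 * pi / e) *\<^sub>R x)"
      by (simp add: gauss_eq c_def power_one_over)
    finally show ?thesis by (simp add: mult_ac)
  qed
  have "(LINT \<xi>|lborel. fourier a \<xi> * complex_of_real (exp (- (e * norm \<xi>)\<^sup>2 / 2)))
     = (LINT \<xi>|lborel. (LINT x|lborel. a x * cis (- 2 * pi * (x \<bullet> \<xi>)) * complex_of_real (c * gauss (e *\<^sub>R \<xi>))))"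
    unfolding fourier_def W by simp
  also have "\<dots> = (LINT x|lborel. (LINT \<xi>|lborel. a x * cis (- 2 * pi * (x \<bullet> \<xi>)) * complex_of_real (c * gauss (e *\<^sub>R \<xi>))))"
  proof (rule lborel_pair.Fubini_integral)
    show "integrable (lborel \<Otimes>\<^sub>M lborel) (\<lambda>(x, \<xi>). a x * cis (- 2 * pi * (x \<bullet> \<xi>)) * complex_of_real (c * gauss (e *\<^sub>R \<xi>)))"
    proof (rule integrable_pair_bound)
      show "integrable lborel (\<lambda>x. norm (a x))" using a by simp
      show "integrable lborel (\<lambda>\<xi>::real^'n. c * gauss (e *\<^sub>R \<xi>))" 
        using gauss_scale_integral[where 'n='n and c=e] e by simp
    qed (use c0 in \<open>auto simp: norm_mult less_imp_le abs_mult abs_of_pos[OF gauss_pos]\<close>)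
  qed
  also have "\<dots> = (LINT x|lborel. (c * (c / e ^ CARD('n))) *\<^sub>R (a x * complex_of_real (gauss ((2 * pi / e) *\<^sub>R x))))"
  proof (intro Bochner_Integration.integral_cong refl)
    fix x :: "real ^ 'n"
    have "(LINT \<xi>|lborel. a x * cis (- 2 * pi * (x \<bullet> \<xi>)) * complex_of_real (c * gauss (e *\<^sub>R \<xi>)))
      = (LINT \<xi>|lborel. (a x * complex_of_real c) * (cis (- 2 * pi * (x \<bullet> \<xi>)) * complex_of_real (gauss (e *\<^sub>R \<xi>))))"
      by (intro Bochner_Integration.integral_cong refl) simp
    also have "\<dots> = (a x * complex_of_real c) * complex_of_real (c / e ^ CARD('n) * gauss ((2 * pi / e) *\<^sub>R x))"
      using inner[of x] by simp
    finally show "(LINT \<xi>|lborel. a x * cis (- 2 * pi * (x \<bullet> \<xi>)) * complex_of_real (c * gauss (e *\<^sub>R \<xi>)))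
      = (c * (c / e ^ CARD('n))) *\<^sub>R (a x * complex_of_real (gauss ((2 * pi / e) *\<^sub>R x)))"
      by (simp add: scaleR_conv_of_real)
  qed
  also have "\<dots> = (c * (c / e ^ CARD('n))) *\<^sub>R (LINT x|lborel. a ((e / (2 * pi)) *\<^sub>R (2 * pi / e) *\<^sub>R x) * complex_of_real (gauss ((2 * pi / e) *\<^sub>R x)))"
    using e by simp
  also have "\<dots> = (c * (c / e ^ CARD('n))) *\<^sub>R (1 / \<bar>2 * pi / e\<bar> ^ DIM(real ^ 'n)) *\<^sub>R (LINT w|lborel. a ((e / (2 * pi)) *\<^sub>R w) * complex_of_real (gauss w))"
    by (subst integral_scale_lborel[where f = "\<lambda>w. a ((e / (2 * pi)) *\<^sub>R w) * complex_of_real (gauss w)"]) (use e in auto)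
  also have "\<dots> = (LINT w|lborel. a ((e / (2 * pi)) *\<^sub>R w) * complex_of_real (gauss w))"
  proof -
    \<comment> \<open>One \<open>c\<close> comes from the weight and one from its transform;
      together with the powers of \<open>e\<close> they are exactly the Jacobian of the last
      rescaling.\<close>
    have "c * c = (2 * pi) ^ CARD('n)"
      unfolding c_def power_mult_distrib[symmetric] by simp
    then have "c * (c / e ^ CARD('n)) = (2 * pi / e) ^ CARD('n)" by (simp add: power_divide)
    then show ?thesis using e by simp
  qed
  finally show ?thesis .
qed

lemma gauss_approximation:
  fixes a :: "real ^ 'n \<Rightarrow> complex"
  assumes [measurable]: "a \<in> borel_measurable borel" and M: "\<And>x. norm (a x) \<le> M" and c: "isCont a 0"
  shows "(\<lambda>m. LINT w|lborel. a ((inverse (real (Suc m)) / (2 * pi)) *\<^sub>R w) * complex_of_real (gauss w)) \<longlonglongrightarrow> a 0"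
proof -
  have "(\<lambda>m. LINT w|lborel. a ((inverse (real (Suc m)) / (2 * pi)) *\<^sub>R w) * complex_of_real (gauss w))
     \<longlonglongrightarrow> (LINT w|lborel. a 0 * complex_of_real (gauss (w :: real ^ 'n)))"
  proof (rule integral_dominated_convergence)
    show "integrable lborel (\<lambda>w::real ^ 'n. M * gauss w)" using integrable_gauss[where 'n='n] by (intro integrable_mult_right)
    show "AE w in lborel. (\<lambda>m. a ((inverse (real (Suc m)) / (2 * pi)) *\<^sub>R w) * complex_of_real (gauss w)) \<longlonglongrightarrow> a 0 * complex_of_real (gauss w)"
    proof (intro AE_I2 tendsto_intros)
      fix w :: "real ^ 'n"
      have "(\<lambda>m. (inverse (real (Suc m)) / (2 * pi)) *\<^sub>R w) \<longlonglongrightarrow> (0 / (2 * pi)) *\<^sub>R w"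
        by (intro tendsto_intros LIMSEQ_inverse_real_of_nat) auto
      then show "(\<lambda>m. a ((inverse (real (Suc m)) / (2 * pi)) *\<^sub>R w)) \<longlonglongrightarrow> a 0"
        by (intro isCont_tendsto_compose[OF c]) simp
    qed
    show "AE w in lborel. norm (a ((inverse (real (Suc m)) / (2 * pi)) *\<^sub>R w) * complex_of_real (gauss w)) \<le> M * gauss w" for m
      by (intro AE_I2) (auto simp: norm_mult abs_of_pos[OF gauss_pos] intro!: mult_right_mono M less_imp_le[OF gauss_pos])
  qed auto
  also have "(LINT w|lborel. a 0 * complex_of_real (gauss (w :: real ^ 'n))) = a 0"
    using integral_gauss[where 'n='n] by simp
  finally show ?thesis .
qed

text \<open>Translating by \<open>x\<close> multiplies the transform by a character, so it suffices
  to recover the value at the origin. Gaussian factors are inserted and removed by dominated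
  convergence on the frequency side; on the other side they become a shrinking average.\<close>

lemma fourier_inversion:
  fixes f :: "real ^ 'n \<Rightarrow> complex"
  assumes f: "integrable lborel f" and M: "\<And>x. norm (f x) \<le> M" and c: "continuous_on UNIV f"
    and ff: "integrable lborel (fourier f)"
  shows "(LINT \<xi>|lborel. fourier f \<xi> * cis (2 * pi * (x \<bullet> \<xi>))) = f x"
proof -
  have [measurable]: "f \<in> borel_measurable borel" using f by auto
  define a where "a y = f (x + y)" for y
  have a: "integrable lborel a" unfolding a_def[abs_def] by (rule integrable_translate_lborel[OF f])
  have [measurable]: "a \<in> borel_measurable borel" using a by auto
  have fa: "fourier a \<xi> = fourier f \<xi> * cis (2 * pi * (x \<bullet> \<xi>))" for \<xi>
  proof -
    have "fourier a \<xi> = (LINT y|lborel. f (x + y) * cis (- 2 * pi * ((x + y) \<bullet> \<xi>)) * cis (2 * pi * (x \<bullet> \<xi>)))"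
      unfolding fourier_def a_def
      by (intro Bochner_Integration.integral_cong refl) (simp add: mult.assoc cis_mult inner_add_left ring_distribs)
    also have "\<dots> = (LINT y|lborel. f (x + y) * cis (- 2 * pi * ((x + y) \<bullet> \<xi>))) * cis (2 * pi * (x \<bullet> \<xi>))"
      by simp
    also have "(LINT y|lborel. f (x + y) * cis (- 2 * pi * ((x + y) \<bullet> \<xi>))) = fourier f \<xi>"
      unfolding fourier_def by (rule integral_translate_lborel[where f = "\<lambda>y. f y * cis (- 2 * pi * (y \<bullet> \<xi>))"]) auto
    finally show ?thesis .
  qed
  have ia: "integrable lborel (fourier a)"
    unfolding fa[abs_def] by (rule integrable_mult_cis[OF ff]) auto
  have "(\<lambda>m. LINT \<xi>|lborel. fourier a \<xi> * complex_of_real (exp (- (inverse (real (Suc m)) * norm \<xi>)\<^sup>2 / 2))) \<longlonglongrightarrow> (LINT \<xi>|lborel. fourier a \<xi>)"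
  proof (rule integral_dominated_convergence)
    show "integrable lborel (\<lambda>\<xi>. norm (fourier a \<xi>))" using ia by simp
    show "AE \<xi> in lborel. (\<lambda>m. fourier a \<xi> * complex_of_real (exp (- (inverse (real (Suc m)) * norm \<xi>)\<^sup>2 / 2))) \<longlonglongrightarrow> fourier a \<xi>"
    proof (rule AE_I2)
      fix \<xi> :: "real ^ 'n"
      have "(\<lambda>m. fourier a \<xi> * complex_of_real (exp (- (inverse (real (Suc m)) * norm \<xi>)\<^sup>2 / 2))) \<longlonglongrightarrow> fourier a \<xi> * complex_of_real (exp (- (0 * norm \<xi>)\<^sup>2 / 2))"
        by (intro tendsto_intros LIMSEQ_inverse_real_of_nat) auto
      then show "(\<lambda>m. fourier a \<xi> * complex_of_real (exp (- (inverse (real (Suc m)) * norm \<xi>)\<^sup>2 / 2))) \<longlonglongrightarrow> fourier a \<xi>" by simp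
    qed
  qed (auto simp: norm_mult intro!: mult_left_le)
  moreover have "(LINT \<xi>|lborel. fourier a \<xi> * complex_of_real (exp (- (inverse (real (Suc m)) * norm \<xi>)\<^sup>2 / 2)))
      = (LINT w|lborel. a ((inverse (real (Suc m)) / (2 * pi)) *\<^sub>R w) * complex_of_real (gauss w))" for m
    by (rule fourier_weighted[OF a]) simp
  moreover have "(\<lambda>m. LINT w|lborel. a ((inverse (real (Suc m)) / (2 * pi)) *\<^sub>R w) * complex_of_real (gauss w)) \<longlonglongrightarrow> a 0"
  proof (rule gauss_approximation[where M = M])
    have "isCont f x" using c continuous_on_eq_continuous_at[OF open_UNIV] by blast
    then show "isCont a 0" unfolding a_def isCont_def
      by (simp add: LIM_offset_zero)
  qed (auto simp: a_def M)
  ultimately have "(LINT \<xi>|lborel. fourier a \<xi>) = a 0"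
    by (simp only: LIMSEQ_unique)
  then show ?thesis by (simp add: fa a_def)
qed

lemma borel_measurable_cnj [measurable (raw)]:
  "f \<in> borel_measurable M \<Longrightarrow> (\<lambda>x. cnj (f x)) \<in> borel_measurable M"
  by (rule borel_measurable_continuous_on[where f = cnj]) (auto intro: continuous_intros)

lemma integrable_exp_norm:
  fixes e :: real
  assumes "0 < e"
  shows "integrable lborel (\<lambda>\<xi>::real^'n. exp (- (e * norm \<xi>)\<^sup>2 / 2))"
proof -
  have "exp (- (e * norm \<xi>)\<^sup>2 / 2) = sqrt (2 * pi) ^ CARD('n) * gauss (e *\<^sub>R \<xi>)" for \<xi> :: "real ^ 'n"
    using assms by (simp add: gauss_eq power_one_over)
  then show ?thesis using gauss_scale_integral[where 'n='n and c=e] assms by simp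
qed

text \<open>The autocorrelation \<open>a\<close> of \<open>g\<close> has transform |g^|^2 and value
  at 0 equal to the squared L2 norm of \<open>g\<close>. Thus Plancherel is inversion for
  \<open>a\<close> at the origin. As integrability of |g^|^2 is not known beforehand, the Gaussian
  weights are removed by monotone instead of dominated convergence; they increase to 1.\<close>

lemma plancherel:
  fixes g :: "real ^ 'n \<Rightarrow> complex"
  assumes g: "integrable lborel g" and M: "\<And>x. norm (g x) \<le> M" and c: "continuous_on UNIV g"
  shows "(\<integral>\<^sup>+x. ennreal ((cmod (g x))\<^sup>2) \<partial>lborel) = (\<integral>\<^sup>+\<xi>. ennreal ((cmod (fourier g \<xi>))\<^sup>2) \<partial>lborel)"
proof -
  have [measurable]: "g \<in> borel_measurable borel" using g by auto
  have M0: "0 \<le> M" by (rule order_trans[OF norm_ge_zero M])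
  define a where "a u = (LINT x|lborel. g (u + x) * cnj (g x))" for u
  have am [measurable]: "a \<in> borel_measurable borel"
    unfolding a_def[abs_def]
    by (rule lborel.borel_measurable_lebesgue_integral) (simp add: split_beta' cong: measurable_cong_sets)
  have pair: "integrable (lborel \<Otimes>\<^sub>M lborel) (\<lambda>(x, u). g (u + x) * cnj (g x) * cis (h u))" 
    if [measurable]: "h \<in> borel_measurable borel" for h :: "real ^ 'n \<Rightarrow> real"
  proof (rule lborel_pair.Fubini_integrable)
    show "(\<lambda>(x, u). g (u + x) * cnj (g x) * cis (h u)) \<in> borel_measurable (lborel \<Otimes>\<^sub>M lborel)"
      by (simp add: split_beta' cong: measurable_cong_sets)
    have "(LINT u|lborel. norm (g (u + x) * cnj (g x) * cis (h u))) = norm (g x) * (LINT u|lborel. norm (g u))" for x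
      using integral_translate_lborel[of "\<lambda>u. norm (g u)" x] by (simp add: norm_mult add.commute)
    then show "integrable lborel (\<lambda>x. LINT u|lborel. norm (case (x, u) of (x, u) \<Rightarrow> g (u + x) * cnj (g x) * cis (h u)))"
      using g by simp
    have "integrable lborel (\<lambda>u. g (u + x) * cnj (g x) * cis (h u))" for x
      using integrable_translate_lborel[OF g, of x] by (intro integrable_mult_cis integrable_mult_left) (auto simp: add.commute)
    then show "AE x in lborel. integrable lborel (\<lambda>u. case (x, u) of (x, u) \<Rightarrow> g (u + x) * cnj (g x) * cis (h u))"
      by simp
  qed
  have a: "integrable lborel a"
    using lborel_pair.integrable_snd[OF pair[of "\<lambda>_. 0"]] by (simp add: a_def[abs_def])
  have fa: "fourier a \<xi> = complex_of_real ((cmod (fourier g \<xi>))\<^sup>2)" for \<xi>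
  proof -
    have "fourier a \<xi> = (LINT u|lborel. (LINT x|lborel. g (u + x) * cnj (g x) * cis (- 2 * pi * (u \<bullet> \<xi>))))"
      unfolding fourier_def a_def by simp
    also have "\<dots> = (LINT x|lborel. (LINT u|lborel. g (u + x) * cnj (g x) * cis (- 2 * pi * (u \<bullet> \<xi>))))"
      by (rule lborel_pair.Fubini_integral[OF pair]) auto
    also have "\<dots> = (LINT x|lborel. cnj (g x * cis (- 2 * pi * (x \<bullet> \<xi>))) * fourier g \<xi>)"
    proof (intro Bochner_Integration.integral_cong refl)
      fix x
      have "(LINT u|lborel. g (u + x) * cnj (g x) * cis (- 2 * pi * (u \<bullet> \<xi>)))
        = (LINT u|lborel. cnj (g x * cis (- 2 * pi * (x \<bullet> \<xi>))) * (g (x + u) * cis (- 2 * pi * ((x + u) \<bullet> \<xi>))))"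
      proof (intro Bochner_Integration.integral_cong refl)
        fix u
        have "cis (- 2 * pi * (u \<bullet> \<xi>)) = cnj (cis (- 2 * pi * (x \<bullet> \<xi>))) * cis (- 2 * pi * ((x + u) \<bullet> \<xi>))"
          by (simp add: cis_cnj cis_mult inner_add_left ring_distribs)
        then show "g (u + x) * cnj (g x) * cis (- 2 * pi * (u \<bullet> \<xi>)) = cnj (g x * cis (- 2 * pi * (x \<bullet> \<xi>))) * (g (x + u) * cis (- 2 * pi * ((x + u) \<bullet> \<xi>)))"
          by (simp only: complex_cnj_mult) (simp add: add.commute)
      qed
      also have "\<dots> = cnj (g x * cis (- 2 * pi * (x \<bullet> \<xi>))) * (LINT u|lborel. (g (x + u) * cis (- 2 * pi * ((x + u) \<bullet> \<xi>))))"
        by (rule integral_mult_right_zero)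
      also have "(LINT u|lborel. (g (x + u) * cis (- 2 * pi * ((x + u) \<bullet> \<xi>)))) = fourier g \<xi>"
        unfolding fourier_def by (rule integral_translate_lborel[where f = "\<lambda>u. g u * cis (- 2 * pi * (u \<bullet> \<xi>))"]) auto
      finally show "(LINT u|lborel. g (u + x) * cnj (g x) * cis (- 2 * pi * (u \<bullet> \<xi>))) = cnj (g x * cis (- 2 * pi * (x \<bullet> \<xi>))) * fourier g \<xi>" .
    qed
    also have "\<dots> = cnj (fourier g \<xi>) * fourier g \<xi>"
      unfolding fourier_def integral_mult_left_zero by (subst Bochner_Integration.integral_cnj) (rule refl)
    finally show ?thesis by (simp only: complex_norm_square mult.commute)
  qed
  have ab: "norm (a u) \<le> M * (LINT x|lborel. norm (g x))" for u
  proof -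
    have "norm (a u) \<le> (LINT x|lborel. norm (g (u + x) * cnj (g x)))"
      unfolding a_def by (rule integral_norm_bound)
    also have "\<dots> \<le> (LINT x|lborel. M * norm (g x))"
    proof (rule integral_mono)
      show "integrable lborel (\<lambda>x. norm (g (u + x) * cnj (g x)))"
        by (rule Bochner_Integration.integrable_bound[of _ "\<lambda>x. M * norm (g x)"])
           (use g M M0 in \<open>auto simp: norm_mult intro!: AE_I2 mult_right_mono\<close>)
    qed (use g M in \<open>auto simp: norm_mult intro!: mult_right_mono\<close>)
    finally show ?thesis by simp
  qed
  \<comment> \<open>Only the factor \<open>g (u + x)\<close> moves with \<open>u\<close>; it is
    bounded by \<open>M\<close>, and the other factor supplies the integrable majorant.\<close>
  have ac: "isCont a 0"
    unfolding continuous_at_sequentially comp_def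
  proof (intro allI impI)
    fix X :: "nat \<Rightarrow> real ^ 'n" assume X: "X \<longlonglongrightarrow> 0"
    show "(\<lambda>n. a (X n)) \<longlonglongrightarrow> a 0"
      unfolding a_def
    proof (rule integral_dominated_convergence)
      show "integrable lborel (\<lambda>x. M * norm (g x))" using g by simp
      show "AE x in lborel. norm (g (X i + x) * cnj (g x)) \<le> M * norm (g x)" for i
        by (intro AE_I2) (auto simp: norm_mult intro!: mult_right_mono M)
      show "AE x in lborel. (\<lambda>i. g (X i + x) * cnj (g x)) \<longlonglongrightarrow> g (0 + x) * cnj (g x)"
      proof (intro AE_I2 tendsto_intros)
        fix x
        have "isCont g (0 + x)" using c continuous_on_eq_continuous_at[OF open_UNIV] by blast
        then show "(\<lambda>i. g (X i + x)) \<longlonglongrightarrow> g (0 + x)"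
          by (rule isCont_tendsto_compose) (intro tendsto_intros X)
      qed
    qed auto
  qed
  define I where "I m = (\<integral>\<^sup>+\<xi>. ennreal ((cmod (fourier g \<xi>))\<^sup>2 * exp (- (inverse (real (Suc m)) * norm \<xi>)\<^sup>2 / 2)) \<partial>lborel)" for m
  have I: "I m = ennreal (Re (LINT w|lborel. a ((inverse (real (Suc m)) / (2 * pi)) *\<^sub>R w) * complex_of_real (gauss w)))" for m
  proof -
    let ?e = "inverse (real (Suc m))"
    let ?h = "\<lambda>\<xi>. (cmod (fourier g \<xi>))\<^sup>2 * exp (- (?e * norm \<xi>)\<^sup>2 / 2)"
    have "I m = ennreal (LINT \<xi>|lborel. ?h \<xi>)"
      unfolding I_def
    proof (rule nn_integral_eq_integral)
      show "integrable lborel ?h"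
      proof (rule Bochner_Integration.integrable_bound)
        show "integrable lborel (\<lambda>\<xi>::real^'n. (LINT x|lborel. norm (g x))\<^sup>2 * exp (- (?e * norm \<xi>)\<^sup>2 / 2))"
          using integrable_exp_norm[where 'n='n and e="?e"] by simp
      qed (auto simp: abs_mult intro!: AE_I2 mult_right_mono power_mono norm_fourier_le)
    qed auto
    also have "complex_of_real (LINT \<xi>|lborel. ?h \<xi>) = (LINT \<xi>|lborel. fourier a \<xi> * complex_of_real (exp (- (?e * norm \<xi>)\<^sup>2 / 2)))"
      unfolding fa of_real_mult[symmetric] integral_complex_of_real ..
    then have "(LINT \<xi>|lborel. ?h \<xi>) = Re (LINT w|lborel. a ((?e / (2 * pi)) *\<^sub>R w) * complex_of_real (gauss w))"
      using fourier_weighted[OF a, of ?e] Re_complex_of_real[of "LINT \<xi>|lborel. ?h \<xi>"] by simp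
    finally show ?thesis .
  qed
  have "I \<longlonglongrightarrow> ennreal (Re (a 0))"
    unfolding I[abs_def] by (intro tendsto_ennrealI tendsto_Re gauss_approximation[OF am ab ac])
  moreover have "I \<longlonglongrightarrow> (\<integral>\<^sup>+\<xi>. ennreal ((cmod (fourier g \<xi>))\<^sup>2) \<partial>lborel)"
    unfolding I_def[abs_def]
  proof (rule nn_integral_LIMSEQ)
    have "inverse (real (Suc (Suc m))) \<le> inverse (real (Suc m))" for m
      by (simp add: field_simps)
    then show "incseq (\<lambda>m \<xi>. ennreal ((cmod (fourier g \<xi>))\<^sup>2 * exp (- (inverse (real (Suc m)) * norm \<xi>)\<^sup>2 / 2)))"
      by (intro incseq_SucI le_funI ennreal_leI mult_left_mono) (auto intro!: power_mono mult_right_mono simp del: of_nat_Suc)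
    fix \<xi> :: "real ^ 'n"
    have "(\<lambda>m. ennreal ((cmod (fourier g \<xi>))\<^sup>2 * exp (- (inverse (real (Suc m)) * norm \<xi>)\<^sup>2 / 2))) \<longlonglongrightarrow> ennreal ((cmod (fourier g \<xi>))\<^sup>2 * exp (- (0 * norm \<xi>)\<^sup>2 / 2))"
      by (intro tendsto_ennrealI tendsto_intros LIMSEQ_inverse_real_of_nat) auto
    then show "(\<lambda>m. ennreal ((cmod (fourier g \<xi>))\<^sup>2 * exp (- (inverse (real (Suc m)) * norm \<xi>)\<^sup>2 / 2))) \<longlonglongrightarrow> ennreal ((cmod (fourier g \<xi>))\<^sup>2)"
      by simp
  qed auto
  ultimately have "(\<integral>\<^sup>+\<xi>. ennreal ((cmod (fourier g \<xi>))\<^sup>2) \<partial>lborel) = ennreal (Re (a 0))"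
    by (rule LIMSEQ_unique[rotated])
  also have "a 0 = complex_of_real (LINT x|lborel. (cmod (g x))\<^sup>2)"
    unfolding a_def by (simp only: complex_norm_square[symmetric] add_0 integral_complex_of_real)
  also have "ennreal (Re (complex_of_real (LINT x|lborel. (cmod (g x))\<^sup>2))) = (\<integral>\<^sup>+x. ennreal ((cmod (g x))\<^sup>2) \<partial>lborel)"
  proof -
    have "integrable lborel (\<lambda>x. (cmod (g x))\<^sup>2)"
      by (rule Bochner_Integration.integrable_bound[of _ "\<lambda>x. M * norm (g x)"])
         (use g M M0 in \<open>auto simp: power2_eq_square intro!: AE_I2 mult_right_mono\<close>)
    then show ?thesis by (subst nn_integral_eq_integral) auto
  qed
  finally show ?thesis ..
qed

subsection \<open>Gaussian averages determine an integrable function\<close>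

text \<open>Closed sets are stable under intersection and generate the Borel sets, so the Dynkin
  class argument extends the vanishing to all Borel sets.\<close>

lemma AE_zero_if_closed_integrals_zero:
  fixes f :: "'a::euclidean_space \<Rightarrow> 'b::{banach,second_countable_topology}"
  assumes f: "integrable lborel f"
    and cl: "\<And>C. closed C \<Longrightarrow> set_lebesgue_integral lborel C f = 0"
  shows "AE x in lborel. f x = 0"
proof (rule sigma_finite_measure.density_zero[OF sigma_finite_lborel f])
  have si: "set_integrable lborel A f" if "A \<in> sets borel" for A
    using that f by (simp add: set_integrable_def integrable_mult_indicator)
  fix A :: "'a set" assume "A \<in> sets lborel"
  then have A: "A \<in> sigma_sets UNIV (Collect closed)"
    by (simp add: borel_eq_closed)
  have "Int_stable (Collect closed :: 'a set set)" "Collect closed \<subseteq> Pow (UNIV :: 'a set)"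
    by (auto simp: Int_stable_def)
  from this A show "set_lebesgue_integral lborel A f = 0"
  proof (induction rule: sigma_sets_induct_disjoint)
    case (basic A)
    then show ?case using cl by simp
  next
    case empty
    then show ?case by (simp add: set_lebesgue_integral_def)
  next
    case (compl A)
    then have A: "A \<in> sets borel" by (simp add: borel_eq_closed)
    have "set_lebesgue_integral lborel (UNIV - A) f + set_lebesgue_integral lborel A f = set_lebesgue_integral lborel ((UNIV - A) \<union> A) f"
      by (rule set_integral_Un[symmetric]) (use A in \<open>auto intro!: si\<close>)
    also have "(UNIV - A) \<union> A = UNIV" by auto
    finally show ?case using cl[of UNIV] compl by simp
  next
    case (union A)
    then have A: "A i \<in> sets borel" for i by (auto simp: borel_eq_closed)
    have "set_lebesgue_integral lborel (\<Union>i. A i) f = (\<Sum>i. set_lebesgue_integral lborel (A i) f)"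
      by (rule lebesgue_integral_countable_add) (use A union in \<open>auto simp: disjoint_family_on_def intro!: si\<close>)
    then show ?case using union by simp
  qed
qed

text \<open>The hypothesis says that all Gaussian convolutions of \<open>u\<close> vanish. Moving
  the convolution onto a test function and letting the Gaussian shrink shows that \<open>u\<close>
  annihilates bounded continuous integrable functions; these approximate indicators of closed
  sets.\<close>

lemma AE_zero_if_gauss_averages_zero:
  fixes u :: "real ^ 'n \<Rightarrow> complex"
  assumes u: "integrable lborel u"
    and z: "\<And>c b. 0 < c \<Longrightarrow> (LINT y|lborel. u y * complex_of_real (gauss (c *\<^sub>R (b - y)))) = 0"
  shows "AE x in lborel. u x = 0"
proof (rule AE_zero_if_closed_integrals_zero[OF u])
  have [measurable]: "u \<in> borel_measurable borel" using u by auto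
  have test: "(LINT y|lborel. u y * complex_of_real (\<psi> y)) = 0"
    if c: "continuous_on UNIV \<psi>" and i: "integrable lborel \<psi>" and M: "\<And>y. \<bar>\<psi> y\<bar> \<le> M" for \<psi> :: "real ^ 'n \<Rightarrow> real" and M :: real
  proof -
    have [measurable]: "\<psi> \<in> borel_measurable borel" using i by auto
    have M0: "0 \<le> M" by (rule order_trans[OF abs_ge_zero M])
    \<comment> \<open>\<open>F m\<close> is \<psi> averaged over a Gaussian of width proportional to
      1/(m+1). By Fubini its integral against \<open>u\<close> is a superposition of the averages
      that vanish by hypothesis.\<close>
    define F where "F m y = (LINT w|lborel. complex_of_real (\<psi> (y + (inverse (real (Suc m)) / (2 * pi)) *\<^sub>R w)) * complex_of_real (gauss w))" for m :: nat and y :: "real ^ 'n"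
    have F0: "(LINT y|lborel. u y * F m y) = 0" for m
    proof -
      define e where "e = inverse (real (Suc m)) / (2 * pi)"
      have e: "0 < e" by (simp add: e_def)
      have Fe: "F m y = (1 / e ^ CARD('n)) *\<^sub>R (LINT b|lborel. complex_of_real (\<psi> b) * complex_of_real (gauss ((1 / e) *\<^sub>R (b - y))))" for y
      proof -
        let ?k = "\<lambda>b. complex_of_real (\<psi> b) * complex_of_real (gauss ((1 / e) *\<^sub>R (b - y)))"
        have "(LINT b|lborel. ?k b) = (LINT b|lborel. ?k (y + b))"
          by (rule integral_translate_lborel[symmetric]) auto
        also have "\<dots> = (1 / \<bar>1 / e\<bar> ^ CARD('n)) *\<^sub>R (LINT w|lborel. complex_of_real (\<psi> (y + e *\<^sub>R w)) * complex_of_real (gauss w))"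
          using integral_scale_lborel[of "\<lambda>w. complex_of_real (\<psi> (y + e *\<^sub>R w)) * complex_of_real (gauss w)" "1 / e"] e by simp
        finally show ?thesis using e by (simp add: F_def e_def[symmetric] power_one_over del: of_nat_Suc)
      qed
      have "(LINT y|lborel. u y * F m y) = (1 / e ^ CARD('n)) *\<^sub>R (LINT y|lborel. (LINT b|lborel. u y * (complex_of_real (\<psi> b) * complex_of_real (gauss ((1 / e) *\<^sub>R (b - y))))))"
        unfolding Fe by simp
      also have "(LINT y|lborel. (LINT b|lborel. u y * (complex_of_real (\<psi> b) * complex_of_real (gauss ((1 / e) *\<^sub>R (b - y))))))
         = (LINT b|lborel. (LINT y|lborel. u y * (complex_of_real (\<psi> b) * complex_of_real (gauss ((1 / e) *\<^sub>R (b - y))))))"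
      proof (rule lborel_pair.Fubini_integral)
        show "integrable (lborel \<Otimes>\<^sub>M lborel) (\<lambda>(b, y). u y * (complex_of_real (\<psi> b) * complex_of_real (gauss ((1 / e) *\<^sub>R (b - y)))))"
        proof (rule integrable_pair_bound)
          show "integrable lborel (\<lambda>b. \<bar>\<psi> b\<bar>)" using i by simp
          show "integrable lborel (\<lambda>y. (1 / sqrt (2 * pi)) ^ CARD('n) * norm (u y))" using u by simp
          fix b y :: "real ^ 'n"
          have "gauss ((1 / e) *\<^sub>R (b - y)) \<le> (1 / sqrt (2 * pi)) ^ CARD('n) * 1"
            unfolding gauss_eq by (intro mult_left_mono) auto
          then have "norm (u y) * \<bar>\<psi> b\<bar> * gauss ((1 / e) *\<^sub>R (b - y)) \<le> norm (u y) * \<bar>\<psi> b\<bar> * ((1 / sqrt (2 * pi)) ^ CARD('n) * 1)"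
            by (intro mult_left_mono) auto
          then show "norm (u y * (complex_of_real (\<psi> b) * complex_of_real (gauss ((1 / e) *\<^sub>R (b - y))))) \<le> \<bar>\<psi> b\<bar> * ((1 / sqrt (2 * pi)) ^ CARD('n) * norm (u y))"
            by (simp add: norm_mult abs_of_pos[OF gauss_pos] mult_ac)
        qed measurable
      qed
      also have "\<dots> = (LINT b|lborel. complex_of_real (\<psi> b) * (LINT y|lborel. u y * complex_of_real (gauss ((1 / e) *\<^sub>R (b - y)))))"
        by (subst integral_mult_right_zero[symmetric]) (simp add: mult_ac)
      also have "\<dots> = 0" using z[of "1 / e"] e by simp
      finally show ?thesis by simp
    qed
    have "(\<lambda>m. LINT y|lborel. u y * F m y) \<longlonglongrightarrow> (LINT y|lborel. u y * complex_of_real (\<psi> y))"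
    proof (rule integral_dominated_convergence)
      show "integrable lborel (\<lambda>y. norm (u y) * M)" using u by simp
      show "AE y in lborel. (\<lambda>m. u y * F m y) \<longlonglongrightarrow> u y * complex_of_real (\<psi> y)"
      proof (intro AE_I2 tendsto_intros)
        fix y
        have "(\<lambda>m. F m y) \<longlonglongrightarrow> complex_of_real (\<psi> (y + 0))"
          unfolding F_def
        proof (rule gauss_approximation[where a = "\<lambda>w. complex_of_real (\<psi> (y + w))" and M = M])
          show "isCont (\<lambda>w. complex_of_real (\<psi> (y + w))) 0"
            using continuous_on_subset[OF c] 
            by (intro continuous_on_interior[of UNIV] continuous_intros continuous_on_compose2[OF c]) auto
        qed (auto simp: M)
        then show "(\<lambda>m. F m y) \<longlonglongrightarrow> complex_of_real (\<psi> y)" by simp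
      qed
      have "norm (F m y) \<le> M" for m y
      proof -
        have "norm (F m y) \<le> (LINT w|lborel. norm (complex_of_real (\<psi> (y + (inverse (real (Suc m)) / (2 * pi)) *\<^sub>R w)) * complex_of_real (gauss w)))"
          unfolding F_def by (rule integral_norm_bound)
        also have "\<dots> \<le> (LINT w|lborel. M * gauss (w :: real ^ 'n))"
        proof (rule Bochner_Integration.integral_mono')
          show "integrable lborel (\<lambda>w :: real ^ 'n. M * gauss w)" using integrable_gauss[where 'n='n] by (intro integrable_mult_right)
        qed (auto simp: norm_mult abs_of_pos[OF gauss_pos] less_imp_le[OF gauss_pos] M M0 intro!: mult_right_mono)
        also have "\<dots> = M" using integral_gauss[where 'n='n] by simp
        finally show ?thesis .
      qed
      then show "AE y in lborel. norm (u y * F m y) \<le> norm (u y) * M" for m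
        by (intro AE_I2) (auto simp: norm_mult intro!: mult_left_mono)
      show "(\<lambda>y. u y * F m y) \<in> borel_measurable lborel" for m
        unfolding F_def by measurable
    qed measurable
    then show ?thesis unfolding F0 using LIMSEQ_unique tendsto_const by blast
  qed
  fix C :: "(real ^ 'n) set" assume C: "closed C"
  show "set_lebesgue_integral lborel C u = 0"
  proof (cases "C = {}")
    case False
    \<comment> \<open>Distance cutoffs decreasing to the indicator of \<open>C\<close>, times
      Gaussians that make them integrable and increase to 1. The empty set is treated apart because
      \<open>infdist\<close> to it is 0 by convention, so the cutoffs would tend to 1 instead of
      0.\<close>
    define \<psi> where "\<psi> m x = max 0 (1 - real m * infdist x C) * exp (- (inverse (real (Suc m)) * norm x)\<^sup>2 / 2)" for m :: nat and x :: "real ^ 'n"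
    have c\<psi>: "continuous_on UNIV (\<psi> m)" for m
      unfolding \<psi>_def[abs_def] by (intro continuous_intros) simp
    have [measurable]: "\<psi> m \<in> borel_measurable borel" for m
      using c\<psi> by (rule borel_measurable_continuous_onI)
    have b\<psi>: "\<bar>\<psi> m x\<bar> \<le> exp (- (inverse (real (Suc m)) * norm x)\<^sup>2 / 2)" "\<bar>\<psi> m x\<bar> \<le> 1" for m x
    proof -
      have "\<bar>max 0 (1 - real m * infdist x C)\<bar> \<le> 1" using infdist_nonneg[of x C] by (auto simp: max_def)
      then show "\<bar>\<psi> m x\<bar> \<le> exp (- (inverse (real (Suc m)) * norm x)\<^sup>2 / 2)"
        unfolding \<psi>_def abs_mult by (intro mult_left_le_one_le[THEN order_trans]) auto
      also have "\<dots> \<le> 1" by simp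
      finally show "\<bar>\<psi> m x\<bar> \<le> 1" .
    qed
    have i\<psi>: "integrable lborel (\<psi> m)" for m
      by (rule Bochner_Integration.integrable_bound[OF integrable_exp_norm[of "inverse (real (Suc m))"]])
         (use b\<psi>(1)[of m] in auto)
    have lim: "(\<lambda>m. \<psi> m x) \<longlonglongrightarrow> indicator C x" for x
    proof -
      have e: "(\<lambda>m. exp (- (inverse (real (Suc m)) * norm x)\<^sup>2 / 2)) \<longlonglongrightarrow> exp (- (0 * norm x)\<^sup>2 / 2)"
        by (intro tendsto_intros LIMSEQ_inverse_real_of_nat) auto
      have "(\<lambda>m. max 0 (1 - real m * infdist x C)) \<longlonglongrightarrow> indicator C x"
      proof (cases "x \<in> C")
        case True
        then show ?thesis by simp
      next
        case F: False
        then have "0 < infdist x C"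
          using in_closed_iff_infdist_zero[OF C False] infdist_nonneg[of x C] by (simp add: less_le)
        then obtain N where N: "1 < real N * infdist x C" using ex_less_of_nat_mult by blast
        have "eventually (\<lambda>m. max 0 (1 - real m * infdist x C) = 0) sequentially"
          using eventually_ge_at_top[of N]
        proof eventually_elim
          case (elim m)
          then have "real N * infdist x C \<le> real m * infdist x C" by (intro mult_right_mono) (auto simp: infdist_nonneg)
          then show ?case using N by auto
        qed
        then show ?thesis using F by (simp add: tendsto_eventually)
      qed
      from tendsto_mult[OF this e] show ?thesis by (simp add: \<psi>_def)
    qed
    have "(\<lambda>m. LINT y|lborel. u y * complex_of_real (\<psi> m y)) \<longlonglongrightarrow> (LINT y|lborel. u y * complex_of_real (indicator C y))"
    proof (rule integral_dominated_convergence)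
      show "integrable lborel (\<lambda>y. norm (u y))" using u by simp
      show "AE y in lborel. (\<lambda>m. u y * complex_of_real (\<psi> m y)) \<longlonglongrightarrow> u y * complex_of_real (indicator C y)"
        by (intro AE_I2 tendsto_intros lim)
      show "AE y in lborel. norm (u y * complex_of_real (\<psi> m y)) \<le> norm (u y)" for m
        by (intro AE_I2) (auto simp: norm_mult b\<psi>(2) intro!: mult_left_le)
      show "(\<lambda>y. u y * complex_of_real (indicator C y)) \<in> borel_measurable lborel"
        using C by (intro borel_measurable_times borel_measurable_of_real borel_measurable_indicator) auto
    qed measurable
    moreover have "(LINT y|lborel. u y * complex_of_real (\<psi> m y)) = 0" for m :: nat
      by (rule test[OF c\<psi> i\<psi> b\<psi>(2)])
    ultimately have "(LINT y|lborel. u y * complex_of_real (indicator C y)) = 0"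
      by (simp add: LIMSEQ_const_iff)
    then show ?thesis by (simp add: set_lebesgue_integral_def scaleR_conv_of_real mult.commute)
  qed (simp add: set_lebesgue_integral_def)
qed

subsection \<open>Schwartz functions\<close>

text \<open>A weight in product form, not a power of the norm: majorants then split over the
  coordinates and can be combined with one-dimensional kernels factor by factor.\<close>

definition cauchy_weight :: "real ^ 'n \<Rightarrow> real" where
  "cauchy_weight x = (\<Prod>i\<in>UNIV. inverse (1 + (x $ i)\<^sup>2))"

lemma one_plus_square_pos [simp]: "0 < 1 + (t::real)\<^sup>2"
  by (simp add: add_pos_nonneg)

lemma cauchy_weight_pos: "0 < cauchy_weight x"
  unfolding cauchy_weight_def by (intro prod_pos) simp

lemma integrable_inverse_one_plus_square: "integrable lborel (\<lambda>t::real. inverse (1 + t\<^sup>2))"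
  using integrable_inverse_1_plus_square by (simp add: set_integrable_def einterval_def)

lemma integrable_cauchy_weight: "integrable lborel (cauchy_weight :: real ^ 'n \<Rightarrow> real)"
  unfolding cauchy_weight_def[abs_def] by (rule integrable_prod_vec) (rule integrable_inverse_one_plus_square)

lemma borel_measurable_cauchy_weight [measurable]: "cauchy_weight \<in> borel_measurable borel"
  unfolding cauchy_weight_def[abs_def] by measurable

lemma integrable_cauchy_weight_bound:
  fixes f :: "real ^ 'n \<Rightarrow> complex"
  assumes "f \<in> borel_measurable borel" and "\<And>x. cmod (f x) \<le> C * cauchy_weight x"
  shows "integrable lborel f"
proof (rule Bochner_Integration.integrable_bound)
  show "integrable lborel (\<lambda>x::real^'n. C * cauchy_weight x)"
    by (intro integrable_mult_right integrable_cauchy_weight)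
  show "AE x in lborel. norm (f x) \<le> norm (C * cauchy_weight x)"
    unfolding real_norm_def by (intro AE_I2 order_trans[OF assms(2) abs_ge_self])
qed (use assms(1) in simp)

lemma schwartz_partial_deriv: "schwartz f \<Longrightarrow> schwartz (partial_deriv i f)"
proof -
  have "iter_partial_deriv is (partial_deriv i f) = iter_partial_deriv (is @ [i]) f" for "is"
    by (simp add: iter_partial_deriv_def)
  then show "schwartz f \<Longrightarrow> schwartz (partial_deriv i f)" unfolding schwartz_def by metis
qed

lemma schwartz_has_derivative:
  assumes "schwartz f" shows "(f has_derivative frechet_derivative f (at x)) (at x)"
proof -
  have "f differentiable_on UNIV"
    using assms unfolding schwartz_def iter_partial_deriv_def by (metis foldr.simps(1) id_apply)
  then show ?thesis by (simp add: differentiable_on_def frechet_derivative_works)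
qed

lemma schwartz_continuous: "schwartz f \<Longrightarrow> continuous_on UNIV f"
  by (meson schwartz_has_derivative has_derivative_continuous continuous_at_imp_continuous_on)

lemma schwartz_measurable: "schwartz f \<Longrightarrow> f \<in> borel_measurable borel"
  using schwartz_continuous by (rule borel_measurable_continuous_onI)

lemma schwartz_bound:
  assumes "schwartz f" shows "\<exists>C. \<forall>x. norm x ^ k * cmod (f x) \<le> C"
proof -
  have "bounded (range (\<lambda>x. norm x ^ k *\<^sub>R f x))"
    using assms unfolding schwartz_def iter_partial_deriv_def by (metis foldr.simps(1) id_apply)
  then show ?thesis unfolding bounded_iff by (auto simp: )
qed

text \<open>Bounds every coordinate by the norm. Consequently the two Schwartz seminorms with powers
  0 and 2n already control a function by \<open>cauchy_weight\<close>.\<close>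

lemma cauchy_weight_inverse_le:
  "inverse (cauchy_weight (x :: real ^ 'n)) \<le> 2 ^ CARD('n) * (1 + norm x ^ (2 * CARD('n)))"
proof -
  have "inverse (cauchy_weight x) = (\<Prod>i\<in>UNIV. 1 + (x $ i)\<^sup>2)"
    by (simp add: cauchy_weight_def prod_inversef[symmetric] o_def)
  also have "\<dots> \<le> (\<Prod>i\<in>(UNIV :: 'n set). 1 + (norm x)\<^sup>2)"
    by (intro prod_mono conjI add_left_mono)
       (auto simp: abs_le_square_iff[symmetric] component_le_norm_cart)
  also have "\<dots> = (1 + (norm x)\<^sup>2) ^ CARD('n)" by simp
  also have "\<dots> \<le> (2 * max 1 ((norm x)\<^sup>2)) ^ CARD('n)"
    by (intro power_mono) (simp_all add: max_def)
  also have "\<dots> = 2 ^ CARD('n) * max 1 ((norm x)\<^sup>2) ^ CARD('n)" by (simp add: power_mult_distrib)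
  also have "\<dots> \<le> 2 ^ CARD('n) * (1 + norm x ^ (2 * CARD('n)))"
    by (intro mult_left_mono) (simp_all add: max_def power_mult del: power_Suc)
  finally show ?thesis .
qed

lemma schwartz_decay:
  fixes f :: "real ^ 'n \<Rightarrow> complex"
  assumes "schwartz f" shows "\<exists>C\<ge>0. \<forall>x. cmod (f x) \<le> C * cauchy_weight x"
proof -
  obtain C0 C1 where C0: "\<And>x. norm x ^ 0 * cmod (f x) \<le> C0"
    and C1: "\<And>x. norm x ^ (2 * CARD('n)) * cmod (f x) \<le> C1"
    using schwartz_bound[OF assms] by metis
  have "cmod (f x) \<le> 2 ^ CARD('n) * (C0 + C1) * cauchy_weight x" for x
  proof -
    have "cmod (f x) * inverse (cauchy_weight x) \<le> cmod (f x) * (2 ^ CARD('n) * (1 + norm x ^ (2 * CARD('n))))"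
      by (intro mult_left_mono cauchy_weight_inverse_le) auto
    also have "\<dots> = 2 ^ CARD('n) * (norm x ^ 0 * cmod (f x) + norm x ^ (2 * CARD('n)) * cmod (f x))"
      by (simp add: algebra_simps)
    also have "\<dots> \<le> 2 ^ CARD('n) * (C0 + C1)"
      by (intro mult_left_mono add_mono C0 C1) auto
    finally show ?thesis using cauchy_weight_pos[of x] by (simp add: field_simps)
  qed
  moreover have "0 \<le> 2 ^ CARD('n) * (C0 + C1)"
    by (intro mult_nonneg_nonneg add_nonneg_nonneg order_trans[OF _ C0[of 0]] order_trans[OF _ C1[of 0]]) auto
  ultimately show ?thesis by blast
qed

lemma schwartz_integrable:
  assumes "schwartz f" shows "integrable lborel f"
proof -
  obtain C where C: "\<And>x. cmod (f x) \<le> C * cauchy_weight x" using schwartz_decay[OF assms] by blast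
  show ?thesis by (rule integrable_cauchy_weight_bound[OF schwartz_measurable[OF assms] C])
qed

lemma schwartz_bounded:
  assumes "schwartz f" shows "\<exists>M. \<forall>x. cmod (f x) \<le> M"
  using schwartz_bound[OF assms, of 0] by simp

text \<open>Lets difference quotients with steps of size at most 1 be dominated by one fixed
  integrable function.\<close>

lemma cauchy_weight_shift:
  assumes "\<bar>s\<bar> \<le> 1"
  shows "cauchy_weight (x + s *\<^sub>R axis i 1) \<le> 3 * cauchy_weight x"
proof -
  have "cauchy_weight (x + s *\<^sub>R axis i 1) = inverse (1 + (x $ i + s)\<^sup>2) * (\<Prod>j\<in>UNIV - {i}. inverse (1 + (x $ j)\<^sup>2))"
    unfolding cauchy_weight_def by (subst prod.remove[of _ i]) (auto simp: axis_def intro!: prod.cong)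
  also have "\<dots> \<le> 3 * inverse (1 + (x $ i)\<^sup>2) * (\<Prod>j\<in>UNIV - {i}. inverse (1 + (x $ j)\<^sup>2))"
  proof (intro mult_right_mono prod_nonneg)
    \<comment> \<open>A sum-of-squares certificate for the constant 3: every term on the right is
      nonnegative once |s| \<le> 1.\<close>
    have "3 * (1 + (x $ i + s)\<^sup>2) - (1 + (x $ i)\<^sup>2) = 2 * (1 - s\<^sup>2) + (x $ i + s)\<^sup>2 + (x $ i + 2 * s)\<^sup>2"
      by (simp add: power2_eq_square algebra_simps)
    moreover have "s\<^sup>2 \<le> 1" using assms by (simp add: abs_square_le_1)
    then have "0 \<le> 2 * (1 - s\<^sup>2) + (x $ i + s)\<^sup>2 + (x $ i + 2 * s)\<^sup>2"
      by (intro add_nonneg_nonneg) auto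
    ultimately have "1 + (x $ i)\<^sup>2 \<le> 3 * (1 + (x $ i + s)\<^sup>2)" by linarith
    then show "inverse (1 + (x $ i + s)\<^sup>2) \<le> 3 * inverse (1 + (x $ i)\<^sup>2)"
      by (simp add: divide_simps add_pos_nonneg del: one_plus_square_pos)
  qed auto
  also have "\<dots> = 3 * cauchy_weight x"
    unfolding cauchy_weight_def by (subst prod.remove[of UNIV i]) auto
  finally show ?thesis .
qed

section \<open>Derivatives and decay of the Fourier transform\<close>

lemma has_vector_derivative_tendsto_quotient:
  fixes g :: "real \<Rightarrow> 'a::real_normed_vector"
  assumes "(g has_vector_derivative D) (at 0)"
  shows "((\<lambda>s. (g s - g 0) /\<^sub>R s) \<longlongrightarrow> D) (at 0)"
proof -
  have "((\<lambda>s. (g s - g 0 - s *\<^sub>R D) /\<^sub>R norm s) \<longlongrightarrow> 0) (at 0)"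
    using assms unfolding has_vector_derivative_def has_derivative_at_within by simp
  then have "((\<lambda>s. norm ((g s - g 0 - s *\<^sub>R D) /\<^sub>R norm s)) \<longlongrightarrow> 0) (at 0)"
    by (rule tendsto_norm_zero)
  moreover have "\<forall>\<^sub>F s in at 0. norm ((g s - g 0 - s *\<^sub>R D) /\<^sub>R norm s) = norm ((g s - g 0) /\<^sub>R s - D)"
    unfolding eventually_at_filter
  proof (intro always_eventually allI impI)
    fix s :: real assume "s \<noteq> 0"
    then have "(g s - g 0) /\<^sub>R s - D = (g s - g 0 - s *\<^sub>R D) /\<^sub>R s"
      by (simp add: scaleR_diff_right)
    then show "norm ((g s - g 0 - s *\<^sub>R D) /\<^sub>R norm s) = norm ((g s - g 0) /\<^sub>R s - D)"
      by simp
  qed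
  ultimately have "((\<lambda>s. norm ((g s - g 0) /\<^sub>R s - D)) \<longlongrightarrow> 0) (at 0)"
    by (rule Lim_transform_eventually)
  then show ?thesis by (rule LIM_zero_cancel[OF tendsto_norm_zero_cancel])
qed

lemma schwartz_line_derivative:
  assumes "schwartz f"
  shows "((\<lambda>t. f (x + t *\<^sub>R axis i 1)) has_vector_derivative partial_deriv i f (x + t *\<^sub>R axis i 1)) (at t within A)"
proof -
  let ?D = "frechet_derivative f (at (x + t *\<^sub>R axis i 1))"
  have D: "(f has_derivative ?D) (at (x + t *\<^sub>R axis i 1))" by (rule schwartz_has_derivative[OF assms])
  have "((\<lambda>t. x + t *\<^sub>R axis i 1) has_derivative (\<lambda>h. h *\<^sub>R axis i 1)) (at t within A)"
    by (auto intro!: derivative_eq_intros)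
  from diff_chain_within[OF this has_derivative_at_withinI[OF D]]
  have "((\<lambda>t. f (x + t *\<^sub>R axis i 1)) has_derivative (\<lambda>h. ?D (h *\<^sub>R axis i 1))) (at t within A)"
    by (simp add: o_def)
  moreover have "?D (h *\<^sub>R axis i 1) = h *\<^sub>R partial_deriv i f (x + t *\<^sub>R axis i 1)" for h
    unfolding partial_deriv_def by (rule linear_scale) (use D has_derivative_linear in blast)
  ultimately show ?thesis by (simp add: has_vector_derivative_def)
qed

text \<open>Takes the place of integration by parts: the transform of a difference quotient is
  explicit, since a translation becomes a character, and both sides converge as the step tends to
  0.\<close>

lemma fourier_partial_deriv:
  fixes f :: "real ^ 'n \<Rightarrow> complex"
  assumes f: "schwartz f"
  shows "fourier (partial_deriv i f) \<xi> = 2 * pi * \<i> * complex_of_real (\<xi> $ i) * fourier f \<xi>"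
proof -
  define h where "h m = inverse (real (Suc m))" for m
  have h: "0 < h m" "h m \<le> 1" for m unfolding h_def by (auto simp: field_simps)
  have h0: "h \<longlonglongrightarrow> 0" unfolding h_def[abs_def] by (rule LIMSEQ_inverse_real_of_nat)
  have hf: "filterlim h (at 0) sequentially"
    unfolding filterlim_at using h0 h by (auto intro!: always_eventually less_imp_neq[symmetric])
  let ?e = "axis i 1 :: real ^ 'n"
  have f': "schwartz (partial_deriv i f)" by (rule schwartz_partial_deriv[OF f])
  have [measurable]: "f \<in> borel_measurable borel" "partial_deriv i f \<in> borel_measurable borel"
    using schwartz_measurable f f' by auto
  obtain C where C: "0 \<le> C" "\<And>x. cmod (partial_deriv i f x) \<le> C * cauchy_weight x"
    using schwartz_decay[OF f'] by blast
  define q where "q m x = (f (x + h m *\<^sub>R ?e) - f x) /\<^sub>R h m" for m x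
  \<comment> \<open>Mean value inequality along the segment. The steps are at most 1, so
    \<open>cauchy_weight_shift\<close> makes the bound independent of \<open>m\<close>.\<close>
  have qb: "cmod (q m x) \<le> C * (3 * cauchy_weight x)" for m x
  proof -
    have "norm (f (x + h m *\<^sub>R ?e) - f (x + 0 *\<^sub>R ?e)) \<le> (C * (3 * cauchy_weight x)) * norm (h m - 0)"
    proof (rule differentiable_bound[where S = "{0..h m}" and f = "\<lambda>t. f (x + t *\<^sub>R ?e)" and f' = "\<lambda>t s. s *\<^sub>R partial_deriv i f (x + t *\<^sub>R ?e)"])
      fix t assume t: "t \<in> {0..h m}"
      show "((\<lambda>t. f (x + t *\<^sub>R ?e)) has_derivative (\<lambda>s. s *\<^sub>R partial_deriv i f (x + t *\<^sub>R ?e))) (at t within {0..h m})"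
        using schwartz_line_derivative[OF f] unfolding has_vector_derivative_def .
      have "cmod (partial_deriv i f (x + t *\<^sub>R ?e)) \<le> C * (3 * cauchy_weight x)"
        using t h(2)[of m] by (intro order_trans[OF C(2)] mult_left_mono cauchy_weight_shift C(1)) auto
      note that = this
      show "onorm (\<lambda>s. s *\<^sub>R partial_deriv i f (x + t *\<^sub>R ?e)) \<le> C * (3 * cauchy_weight x)"
      proof (intro onorm_le)
        fix s :: real
        show "norm (s *\<^sub>R partial_deriv i f (x + t *\<^sub>R ?e)) \<le> C * (3 * cauchy_weight x) * norm s"
          using mult_right_mono[OF that abs_ge_zero[of s]] by (simp only: norm_scaleR real_norm_def mult.commute)
      qed
    qed (use h[of m] in auto)
    then have "norm (f (x + h m *\<^sub>R ?e) - f x) / h m \<le> C * (3 * cauchy_weight x)"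
      using h(1)[of m] by (simp add: pos_divide_le_eq)
    moreover have "cmod (q m x) = norm (f (x + h m *\<^sub>R ?e) - f x) / h m"
      unfolding q_def norm_scaleR using h(1)[of m] by (simp add: divide_inverse mult.commute)
    ultimately show ?thesis by simp
  qed
  have ql: "(\<lambda>m. q m x) \<longlonglongrightarrow> partial_deriv i f x" for x
  proof -
    have "((\<lambda>s. (f (x + s *\<^sub>R ?e) - f x) /\<^sub>R s) \<longlongrightarrow> partial_deriv i f x) (at 0)"
      using has_vector_derivative_tendsto_quotient[OF schwartz_line_derivative[OF f, of x i 0 UNIV, simplified]] by simp
    then show ?thesis unfolding q_def by (rule filterlim_compose[OF _ hf])
  qed
  have A: "(\<lambda>m. LINT x|lborel. q m x * cis (- 2 * pi * (x \<bullet> \<xi>))) \<longlonglongrightarrow> fourier (partial_deriv i f) \<xi>"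
    unfolding fourier_def
  proof (rule integral_dominated_convergence)
    show "integrable lborel (\<lambda>x::real^'n. C * (3 * cauchy_weight x))"
      by (intro integrable_mult_right integrable_cauchy_weight)
    show "AE x in lborel. norm (q m x * cis (- 2 * pi * (x \<bullet> \<xi>))) \<le> C * (3 * cauchy_weight x)" for m
      by (intro AE_I2) (simp add: norm_mult qb)
    show "AE x in lborel. (\<lambda>m. q m x * cis (- 2 * pi * (x \<bullet> \<xi>))) \<longlonglongrightarrow> partial_deriv i f x * cis (- 2 * pi * (x \<bullet> \<xi>))"
      by (intro AE_I2 tendsto_intros ql)
    show "(\<lambda>x. q m x * cis (- 2 * pi * (x \<bullet> \<xi>))) \<in> borel_measurable lborel" for m
      unfolding q_def by measurable
  qed measurable
  have B: "(LINT x|lborel. q m x * cis (- 2 * pi * (x \<bullet> \<xi>))) = ((cis (2 * pi * h m * \<xi> $ i) - 1) /\<^sub>R h m) * fourier f \<xi>" for m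
  proof -
    let ?k = "\<lambda>x. f x * cis (- 2 * pi * (x \<bullet> \<xi>))"
    have ik: "integrable lborel ?k" by (rule integrable_mult_cis[OF schwartz_integrable[OF f]]) measurable
    have "(LINT x|lborel. q m x * cis (- 2 * pi * (x \<bullet> \<xi>)))
       = (LINT x|lborel. (cis (2 * pi * h m * \<xi> $ i) * ?k (h m *\<^sub>R ?e + x) - ?k x) /\<^sub>R h m)"
    proof (intro Bochner_Integration.integral_cong refl)
      fix x :: "real ^ 'n"
      have e: "cis (- 2 * pi * (x \<bullet> \<xi>)) = cis (2 * pi * h m * \<xi> $ i) * cis (- 2 * pi * ((h m *\<^sub>R ?e + x) \<bullet> \<xi>))"
        unfolding cis_mult by (rule arg_cong[where f = cis]) (simp add: inner_add_left inner_axis' distrib_left)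
      have "q m x * cis (- 2 * pi * (x \<bullet> \<xi>)) = (f (h m *\<^sub>R ?e + x) * cis (- 2 * pi * (x \<bullet> \<xi>)) - ?k x) /\<^sub>R h m"
        unfolding q_def mult_scaleR_left left_diff_distrib by (simp only: add.commute)
      also have "f (h m *\<^sub>R ?e + x) * cis (- 2 * pi * (x \<bullet> \<xi>)) = cis (2 * pi * h m * \<xi> $ i) * ?k (h m *\<^sub>R ?e + x)"
        unfolding e by (rule mult.left_commute)
      finally show "q m x * cis (- 2 * pi * (x \<bullet> \<xi>)) = (cis (2 * pi * h m * \<xi> $ i) * ?k (h m *\<^sub>R ?e + x) - ?k x) /\<^sub>R h m" .
    qed
    also have "\<dots> = (cis (2 * pi * h m * \<xi> $ i) * (LINT x|lborel. ?k (h m *\<^sub>R ?e + x)) - (LINT x|lborel. ?k x)) /\<^sub>R h m"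
    proof -
      have "integrable lborel (\<lambda>x. cis (2 * pi * h m * \<xi> $ i) * ?k (h m *\<^sub>R ?e + x))"
        by (rule integrable_mult_right) (rule integrable_translate_lborel[OF ik])
      from Bochner_Integration.integral_diff[OF this ik] show ?thesis
        unfolding integral_scaleR_right integral_mult_right_zero by (simp only:)
    qed
    also have "(LINT x|lborel. ?k (h m *\<^sub>R ?e + x)) = fourier f \<xi>"
      unfolding fourier_def by (rule integral_translate_lborel) measurable
    also have "(LINT x|lborel. ?k x) = fourier f \<xi>" by (simp add: fourier_def)
    also have "cis (2 * pi * h m * \<xi> $ i) * fourier f \<xi> - fourier f \<xi> = (cis (2 * pi * h m * \<xi> $ i) - 1) * fourier f \<xi>"
      by (simp add: left_diff_distrib)
    finally show ?thesis by simp
  qed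
  have "(\<lambda>m. ((cis (2 * pi * h m * \<xi> $ i) - 1) /\<^sub>R h m) * fourier f \<xi>) \<longlonglongrightarrow> (2 * pi * \<i> * complex_of_real (\<xi> $ i)) * fourier f \<xi>"
  proof (intro tendsto_mult tendsto_const)
    have "((\<lambda>s. (cis (2 * pi * s * \<xi> $ i) - 1) /\<^sub>R s) \<longlongrightarrow> (2 * pi * \<i> * complex_of_real (\<xi> $ i))) (at 0)"
    proof -
      have "((\<lambda>s. cis (2 * pi * s * \<xi> $ i)) has_derivative (\<lambda>t. (2 * pi * t * \<xi> $ i) *\<^sub>R (\<i> * cis (2 * pi * 0 * \<xi> $ i)))) (at 0)"
        by (rule has_derivative_cis) (auto intro!: derivative_eq_intros)
      moreover have "(\<lambda>t. (2 * pi * t * \<xi> $ i) *\<^sub>R (\<i> * cis (2 * pi * 0 * \<xi> $ i))) = (\<lambda>t. t *\<^sub>R (2 * pi * \<i> * complex_of_real (\<xi> $ i)))"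
        by (simp add: fun_eq_iff scaleR_conv_of_real)
      ultimately have "((\<lambda>s. cis (2 * pi * s * \<xi> $ i)) has_vector_derivative (2 * pi * \<i> * complex_of_real (\<xi> $ i))) (at 0)"
        by (simp only: has_vector_derivative_def)
      from has_vector_derivative_tendsto_quotient[OF this] show ?thesis
        by simp
    qed
    then show "(\<lambda>m. (cis (2 * pi * h m * \<xi> $ i) - 1) /\<^sub>R h m) \<longlonglongrightarrow> (2 * pi * \<i> * complex_of_real (\<xi> $ i))"
      by (rule filterlim_compose[OF _ hf])
  qed
  from LIMSEQ_unique[OF A[unfolded B] this] show ?thesis .
qed

text \<open>Two derivatives in direction \<open>i\<close> produce the factor (2\<pi>\<xi>_i)^2,
  which exceeds \<xi>_i^2. The induction collects one coordinate at a time, with \<open>f\<close>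
  arbitrary since the hypothesis is applied both to \<open>f\<close> and to its second
  derivative.\<close>

lemma schwartz_fourier_decay:
  fixes f :: "real ^ 'n \<Rightarrow> complex"
  assumes "schwartz f" shows "\<exists>C\<ge>0. \<forall>\<xi>. cmod (fourier f \<xi>) \<le> C * cauchy_weight \<xi>"
proof -
  have "\<exists>C. \<forall>\<xi>. cmod (fourier f \<xi>) * (\<Prod>i\<in>S. 1 + (\<xi> $ i)\<^sup>2) \<le> C" if "finite S" for S :: "'n set"
    using that assms
  proof (induction S arbitrary: f rule: finite_induct)
    case (empty f)
    then show ?case using norm_fourier_le[of f] by auto
  next
    case (insert i S f)
    have s2: "schwartz (partial_deriv i (partial_deriv i f))"
      by (intro schwartz_partial_deriv insert.prems)
    obtain C1 C2 where C1: "\<And>\<xi>. cmod (fourier f \<xi>) * (\<Prod>i\<in>S. 1 + (\<xi> $ i)\<^sup>2) \<le> C1"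
      and C2: "\<And>\<xi>. cmod (fourier (partial_deriv i (partial_deriv i f)) \<xi>) * (\<Prod>i\<in>S. 1 + (\<xi> $ i)\<^sup>2) \<le> C2"
      using insert.IH[OF insert.prems] insert.IH[OF s2] by blast
    have "cmod (fourier f \<xi>) * (\<Prod>i\<in>insert i S. 1 + (\<xi> $ i)\<^sup>2) \<le> C1 + C2" for \<xi>
    proof -
      have "cmod (fourier (partial_deriv i (partial_deriv i f)) \<xi>) = (2 * pi)\<^sup>2 * (\<xi> $ i)\<^sup>2 * cmod (fourier f \<xi>)"
        unfolding fourier_partial_deriv[OF schwartz_partial_deriv[OF insert.prems]] fourier_partial_deriv[OF insert.prems] by (simp add: norm_mult power2_eq_square)
      moreover have "1 \<le> (2 * pi)\<^sup>2" using pi_gt3 by (intro one_le_power) simp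
      then have "1 * (\<xi> $ i)\<^sup>2 * cmod (fourier f \<xi>) \<le> (2 * pi)\<^sup>2 * (\<xi> $ i)\<^sup>2 * cmod (fourier f \<xi>)"
        by (intro mult_right_mono) auto
      ultimately have "(\<xi> $ i)\<^sup>2 * cmod (fourier f \<xi>) \<le> cmod (fourier (partial_deriv i (partial_deriv i f)) \<xi>)"
        by simp
      then have "((\<xi> $ i)\<^sup>2 * cmod (fourier f \<xi>)) * (\<Prod>i\<in>S. 1 + (\<xi> $ i)\<^sup>2) \<le> cmod (fourier (partial_deriv i (partial_deriv i f)) \<xi>) * (\<Prod>i\<in>S. 1 + (\<xi> $ i)\<^sup>2)"
        by (intro mult_right_mono prod_nonneg) auto
      then show ?thesis
        using C1[of \<xi>] C2[of \<xi>] by (simp only: prod.insert[OF insert.hyps] distrib_left distrib_right mult_1 mult_1_right) (simp add: mult_ac)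
    qed
    then show ?case by blast
  qed
  from this[of UNIV] obtain C where C: "\<And>\<xi>. cmod (fourier f \<xi>) * (\<Prod>i\<in>UNIV. 1 + (\<xi> $ i)\<^sup>2) \<le> C" by auto
  have "cmod (fourier f \<xi>) \<le> C * cauchy_weight \<xi>" for \<xi>
  proof -
    have "(\<Prod>i\<in>UNIV. 1 + (\<xi> $ i)\<^sup>2) * cauchy_weight \<xi> = 1"
      unfolding cauchy_weight_def prod.distrib[symmetric] by (simp add: less_imp_neq[OF one_plus_square_pos, symmetric])
    then show ?thesis 
      using mult_right_mono[OF C less_imp_le[OF cauchy_weight_pos], of \<xi> \<xi>] by (simp add: mult.assoc)
  qed
  moreover have "0 \<le> C" by (rule order_trans[OF _ C[of 0]]) (auto intro!: mult_nonneg_nonneg prod_nonneg)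
  ultimately show ?thesis by blast
qed

lemma schwartz_fourier_integrable:
  assumes "schwartz f" shows "integrable lborel (fourier f)"
proof -
  obtain C where C: "\<And>x. cmod (fourier f x) \<le> C * cauchy_weight x" using schwartz_fourier_decay[OF assms] by blast
  show ?thesis by (rule integrable_cauchy_weight_bound[OF borel_measurable_fourier[OF schwartz_measurable[OF assms]] C])
qed

text \<open>Polynomials times one fixed Gaussian, with a linear term in the exponent. The class is
  generated so as to be closed under partial derivatives, which makes membership in the Schwartz
  space an induction; it provides the test functions for uniqueness.\<close>

inductive gaussian_poly :: "real \<Rightarrow> real ^ 'n \<Rightarrow> (real ^ 'n \<Rightarrow> complex) \<Rightarrow> bool"
  for a :: real and l :: "real ^ 'n" where
  base: "gaussian_poly a l (\<lambda>y. complex_of_real (exp (- a * (norm y)\<^sup>2 + l \<bullet> y)))"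
| scale: "gaussian_poly a l f \<Longrightarrow> gaussian_poly a l (\<lambda>y. c * f y)"
| add: "gaussian_poly a l f \<Longrightarrow> gaussian_poly a l g \<Longrightarrow> gaussian_poly a l (\<lambda>y. f y + g y)"
| coord: "gaussian_poly a l f \<Longrightarrow> gaussian_poly a l (\<lambda>y. complex_of_real (y $ i) * f y)"

lemma power_le_fact_mult_exp:
  fixes t :: real assumes "0 \<le> t" shows "t ^ k \<le> fact k * exp t"
proof -
  have "(\<Sum>n\<in>{k}. t ^ n /\<^sub>R fact n) \<le> (\<Sum>n. t ^ n /\<^sub>R fact n)"
    by (rule sum_le_suminf[OF summable_exp_generic]) (use assms in auto)
  then have "t ^ k /\<^sub>R fact k \<le> exp t" by (simp add: exp_def)
  then show ?thesis by (simp add: field_simps)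
qed

text \<open>The power \<open>k\<close> stays arbitrary in the induction because a coordinate factor
  costs one further power of the norm.\<close>

lemma gaussian_poly_bound:
  assumes "gaussian_poly a l f" "0 < a"
  shows "\<exists>C. \<forall>y. norm y ^ k * cmod (f y) \<le> C"
  using assms(1)
proof (induction arbitrary: k)
  case base
  \<comment> \<open>Chosen by completing the square, so that the exponent of the Gaussian is at most
    \<open>D - norm y\<close>; the remaining exponential then absorbs any power of the norm.\<close>
  define D where "D = (norm l + 1)\<^sup>2 / (4 * a)"
  have "norm y ^ k * cmod (complex_of_real (exp (- a * (norm y)\<^sup>2 + l \<bullet> y))) \<le> fact k * exp D" for y
  proof -
    have "0 \<le> (2 * a * norm y - (norm l + 1))\<^sup>2 / (4 * a)" using assms(2) by simp
    also have "\<dots> = a * (norm y)\<^sup>2 - (norm l + 1) * norm y + D"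
      using assms(2) by (simp add: D_def power2_eq_square field_simps)
    finally have "- a * (norm y)\<^sup>2 + norm l * norm y \<le> D - norm y" by (simp add: algebra_simps)
    moreover have "l \<bullet> y \<le> norm l * norm y" by (rule norm_cauchy_schwarz)
    ultimately have "- a * (norm y)\<^sup>2 + l \<bullet> y \<le> D - norm y" by linarith
    then have "exp (- a * (norm y)\<^sup>2 + l \<bullet> y) \<le> exp (D - norm y)" by simp
    then have "norm y ^ k * exp (- a * (norm y)\<^sup>2 + l \<bullet> y) \<le> (fact k * exp (norm y)) * exp (D - norm y)"
      by (intro mult_mono power_le_fact_mult_exp) auto
    also have "\<dots> = fact k * exp D" by (simp add: exp_diff)
    finally show ?thesis by simp
  qed
  then show ?case by blast
next
  case (scale f c)
  then obtain C where C: "\<And>y. norm y ^ k * cmod (f y) \<le> C" by blast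
  have "norm y ^ k * cmod (c * f y) \<le> cmod c * C" for y
    using mult_left_mono[OF C[of y] norm_ge_zero[of c]] by (simp add: norm_mult mult.left_commute)
  then show ?case by blast
next
  case (add f g)
  then obtain C D where C: "\<And>y. norm y ^ k * cmod (f y) \<le> C" and D: "\<And>y. norm y ^ k * cmod (g y) \<le> D" by blast
  have "norm y ^ k * cmod (f y + g y) \<le> C + D" for y
  proof -
    have "norm y ^ k * cmod (f y + g y) \<le> norm y ^ k * (cmod (f y) + cmod (g y))"
      by (intro mult_left_mono norm_triangle_ineq) simp
    also have "\<dots> \<le> C + D" unfolding distrib_left by (intro add_mono C D)
    finally show ?thesis .
  qed
  then show ?case by blast
next
  case (coord f i)
  obtain C where C: "\<And>y. norm y ^ Suc k * cmod (f y) \<le> C" using coord.IH by blast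
  have "norm y ^ k * cmod (complex_of_real (y $ i) * f y) \<le> C" for y
  proof -
    have "norm y ^ k * cmod (complex_of_real (y $ i) * f y) = norm y ^ k * (\<bar>y $ i\<bar> * cmod (f y))"
      by (simp add: norm_mult)
    also have "\<dots> \<le> norm y ^ k * (norm y * cmod (f y))"
      by (intro mult_left_mono mult_right_mono component_le_norm_cart) auto
    also have "\<dots> = norm y ^ Suc k * cmod (f y)" by simp
    finally show ?thesis using C[of y] by linarith
  qed
  then show ?case by blast
qed

text \<open>The derivative is named by a function \<open>D\<close> whose components are again in the
  class, so that the lemma can be iterated along a list of directions.\<close>

lemma gaussian_poly_derivative:
  assumes "gaussian_poly a l f"
  shows "\<exists>D. (\<forall>y. (f has_derivative D y) (at y)) \<and> (\<forall>i. gaussian_poly a l (\<lambda>y. D y (axis i 1)))"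
  using assms
proof induction
  case base
  let ?E = "\<lambda>y. complex_of_real (exp (- a * (norm y)\<^sup>2 + l \<bullet> y))"
  define D where "D y h = complex_of_real (exp (- a * (norm y)\<^sup>2 + l \<bullet> y) * (- 2 * a * (y \<bullet> h) + l \<bullet> h))" for y h
  have "(?E has_derivative D y) (at y)" for y
  proof -
    have "((\<lambda>y. - a * (norm y)\<^sup>2 + l \<bullet> y) has_derivative (\<lambda>h. - 2 * a * (y \<bullet> h) + l \<bullet> h)) (at y)"
      unfolding power2_norm_eq_inner
      by (auto intro!: derivative_eq_intros simp: inner_commute algebra_simps)
    from has_derivative_exp[OF this]
    have "((\<lambda>y. exp (- a * (norm y)\<^sup>2 + l \<bullet> y)) has_derivative (\<lambda>h. exp (- a * (norm y)\<^sup>2 + l \<bullet> y) * (- 2 * a * (y \<bullet> h) + l \<bullet> h))) (at y)"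
      by (simp add: mult.commute)
    from has_derivative_of_real[OF this] show ?thesis unfolding D_def[abs_def] by simp
  qed
  moreover have "gaussian_poly a l (\<lambda>y. D y (axis i 1))" for i
  proof -
    have "(\<lambda>y. D y (axis i 1)) = (\<lambda>y. complex_of_real (- 2 * a) * (complex_of_real (y $ i) * ?E y) + complex_of_real (l $ i) * ?E y)"
      by (simp add: fun_eq_iff D_def inner_axis algebra_simps)
    moreover have "gaussian_poly a l \<dots>"
      by (intro gaussian_poly.intros)
    ultimately show ?thesis by simp
  qed
  ultimately show ?case by blast
next
  case (scale f c)
  then obtain D where D: "\<And>y. (f has_derivative D y) (at y)" "\<And>i. gaussian_poly a l (\<lambda>y. D y (axis i 1))" by blast
  have "((\<lambda>y. c * f y) has_derivative (\<lambda>h. c * D y h)) (at y)" for y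
    by (rule has_derivative_mult_right[OF D(1)])
  moreover have "gaussian_poly a l (\<lambda>y. c * D y (axis i 1))" for i
    by (rule gaussian_poly.scale[OF D(2)])
  ultimately show ?case by (intro exI[of _ "\<lambda>y h. c * D y h"]) simp
next
  case (add f g)
  obtain D where D: "\<And>y. (f has_derivative D y) (at y)" "\<And>i. gaussian_poly a l (\<lambda>y. D y (axis i 1))" using add.IH(1) by blast
  obtain E where E: "\<And>y. (g has_derivative E y) (at y)" "\<And>i. gaussian_poly a l (\<lambda>y. E y (axis i 1))" using add.IH(2) by blast
  have "((\<lambda>y. f y + g y) has_derivative (\<lambda>h. D y h + E y h)) (at y)" for y
    by (rule has_derivative_add[OF D(1) E(1)])
  moreover have "gaussian_poly a l (\<lambda>y. D y (axis i 1) + E y (axis i 1))" for i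
    by (rule gaussian_poly.add[OF D(2) E(2)])
  ultimately show ?case by (intro exI[of _ "\<lambda>y h. D y h + E y h"]) simp
next
  case (coord f i)
  then obtain D where D: "\<And>y. (f has_derivative D y) (at y)" "\<And>i. gaussian_poly a l (\<lambda>y. D y (axis i 1))" by blast
  let ?D = "\<lambda>y h. complex_of_real (y $ i) * D y h + complex_of_real (h $ i) * f y"
  have "((\<lambda>y. complex_of_real (y $ i) * f y) has_derivative ?D y) (at y)" for y
  proof -
    have "((\<lambda>y. complex_of_real (y $ i)) has_derivative (\<lambda>h. complex_of_real (h $ i))) (at y)"
      by (intro has_derivative_of_real bounded_linear_imp_has_derivative bounded_linear_vec_nth)
    from has_derivative_mult[OF this D(1)] show ?thesis by simp
  qed
  moreover have "gaussian_poly a l (\<lambda>y. ?D y (axis j 1))" for j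
    by (intro gaussian_poly.add gaussian_poly.coord gaussian_poly.scale D(2) coord.hyps)
  ultimately show ?case by (intro exI[of _ ?D]) simp
qed

lemma schwartz_gaussian_poly:
  assumes "gaussian_poly a l f" and a: "0 < a"
  shows "schwartz f"
proof -
  have "gaussian_poly a l (iter_partial_deriv is f)" for "is"
  proof (induction "is")
    case Nil
    then show ?case using assms by (simp add: iter_partial_deriv_def)
  next
    case (Cons i js)
    then obtain D where D: "\<And>y. (iter_partial_deriv js f has_derivative D y) (at y)" "\<And>i. gaussian_poly a l (\<lambda>y. D y (axis i 1))"
      using gaussian_poly_derivative by blast
    have "iter_partial_deriv (i # js) f = (\<lambda>y. D y (axis i 1))"
      using frechet_derivative_at[OF D(1)] by (simp add: iter_partial_deriv_def partial_deriv_def fun_eq_iff)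
    then show ?case using D(2) by simp
  qed
  note G = this
  show ?thesis
    unfolding schwartz_def
  proof (intro allI conjI)
    fix "is" k
    show "iter_partial_deriv is f differentiable_on UNIV"
      using gaussian_poly_derivative[OF G[of "is"]] by (auto simp: differentiable_on_def differentiable_def)
    obtain C where "\<And>y. norm y ^ k * cmod (iter_partial_deriv is f y) \<le> C"
      using gaussian_poly_bound[OF G a] by blast
    then show "bounded (range (\<lambda>x. norm x ^ k *\<^sub>R iter_partial_deriv is f x))"
      by (auto simp: bounded_iff)
  qed
qed

text \<open>Expanding the square in the second exponent leaves a quadratic, a linear and a constant
  term in \<open>y\<close>. The first Gaussian is a fixed cutoff that will be attached to the
  function under test, the second is the averaging kernel.\<close>

lemma schwartz_gauss:
  assumes "0 < c"
  shows "schwartz (\<lambda>y :: real ^ 'n. complex_of_real (gauss y * gauss (c *\<^sub>R (b - y))))"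
proof -
  let ?k = "(1 / sqrt (2 * pi)) ^ CARD('n)"
  have "complex_of_real (gauss y * gauss (c *\<^sub>R (b - y))) = complex_of_real (?k * ?k * exp (- c\<^sup>2 * (norm b)\<^sup>2 / 2)) * complex_of_real (exp (- ((1 + c\<^sup>2) / 2) * (norm y)\<^sup>2 + (c\<^sup>2 *\<^sub>R b) \<bullet> y))" for y
  proof -
    have "- (norm y)\<^sup>2 / 2 + - (norm (c *\<^sub>R (b - y)))\<^sup>2 / 2 = - c\<^sup>2 * (norm b)\<^sup>2 / 2 + (- ((1 + c\<^sup>2) / 2) * (norm y)\<^sup>2 + (c\<^sup>2 *\<^sub>R b) \<bullet> y)"
    proof -
      have "(norm (c *\<^sub>R (b - y)))\<^sup>2 = c\<^sup>2 * ((norm b)\<^sup>2 - 2 * (b \<bullet> y) + (norm y)\<^sup>2)"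
        unfolding power2_norm_eq_inner
        by (simp add: inner_diff_left inner_diff_right inner_commute power2_eq_square algebra_simps)
      then show ?thesis by (simp add: field_simps)
    qed
    then have "exp (- (norm y)\<^sup>2 / 2) * exp (- (norm (c *\<^sub>R (b - y)))\<^sup>2 / 2) = exp (- c\<^sup>2 * (norm b)\<^sup>2 / 2) * exp (- ((1 + c\<^sup>2) / 2) * (norm y)\<^sup>2 + (c\<^sup>2 *\<^sub>R b) \<bullet> y)"
      by (simp only: exp_add[symmetric])
    then show ?thesis unfolding gauss_eq of_real_mult[symmetric] by (simp only: mult_ac)
  qed
  moreover have "gaussian_poly ((1 + c\<^sup>2) / 2) (c\<^sup>2 *\<^sub>R b) (\<lambda>y. complex_of_real (?k * ?k * exp (- c\<^sup>2 * (norm b)\<^sup>2 / 2)) * complex_of_real (exp (- ((1 + c\<^sup>2) / 2) * (norm y)\<^sup>2 + (c\<^sup>2 *\<^sub>R b) \<bullet> y)))"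
    by (intro gaussian_poly.scale gaussian_poly.base)
  ultimately show ?thesis
    by (intro schwartz_gaussian_poly[where a = "(1 + c\<^sup>2) / 2"]) auto
qed

subsection \<open>The Fourier transform of the tensor Hilbert transform\<close>

definition hilbert_multiplier :: "(real ^ 'n \<Rightarrow> complex) \<Rightarrow> real ^ 'n \<Rightarrow> complex" where
  "hilbert_multiplier f \<xi> = (\<Prod>j\<in>UNIV. - \<i> * complex_of_real (sgn (\<xi> $ j))) * fourier f \<xi>"

lemma cmod_prod_sgn_le: "cmod (\<Prod>j\<in>(UNIV :: 'n::finite set). - \<i> * complex_of_real (sgn ((\<xi> :: real ^ 'n) $ j))) \<le> 1"
  unfolding prod_norm[symmetric] by (rule prod_le_1) (auto simp: norm_mult abs_sgn_eq)

lemma borel_measurable_hilbert_multiplier: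
  assumes f: "schwartz f"
  shows "hilbert_multiplier f \<in> borel_measurable borel"
proof -
  have [measurable]: "f \<in> borel_measurable borel" by (rule schwartz_measurable[OF f])
  show ?thesis unfolding hilbert_multiplier_def[abs_def] by measurable
qed

lemma cmod_hilbert_multiplier_le: "cmod (hilbert_multiplier f \<xi>) \<le> cmod (fourier f \<xi>)"
  unfolding hilbert_multiplier_def norm_mult
  using mult_right_mono[OF cmod_prod_sgn_le norm_ge_zero] by (metis mult_1)

lemma integrable_hilbert_multiplier:
  assumes f: "schwartz f"
  shows "integrable lborel (hilbert_multiplier f)"
  by (rule Bochner_Integration.integrable_bound[OF schwartz_fourier_integrable[OF f]])
     (use borel_measurable_hilbert_multiplier[OF f] cmod_hilbert_multiplier_le in auto)

text \<open>The multiplication formula: after Fubini the inner integral is the inverse transform of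
  \<open>fourier \<phi>\<close>, hence \<phi> by inversion.\<close>

lemma is_fourier_transform_tensor_hilbert:
  fixes f :: "real ^ 'n \<Rightarrow> complex"
  assumes f: "schwartz f"
  shows "is_fourier_transform (tensor_hilbert f) (hilbert_multiplier f)"
  unfolding is_fourier_transform_def
proof (intro allI impI)
  fix \<phi> :: "real ^ 'n \<Rightarrow> complex" assume \<phi>: "schwartz \<phi>"
  let ?m = "hilbert_multiplier f"
  have [measurable]: "?m \<in> borel_measurable borel" "\<phi> \<in> borel_measurable borel"
    using borel_measurable_hilbert_multiplier[OF f] schwartz_measurable[OF \<phi>] by auto
  have im: "integrable lborel ?m" by (rule integrable_hilbert_multiplier[OF f])
  have i\<phi>: "integrable lborel (fourier \<phi>)" by (rule schwartz_fourier_integrable[OF \<phi>])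
  have T: "tensor_hilbert f x = (LINT \<xi>|lborel. ?m \<xi> * cis (2 * pi * (x \<bullet> \<xi>)))" for x
    unfolding tensor_hilbert_def hilbert_multiplier_def ..
  have pair: "integrable (lborel \<Otimes>\<^sub>M lborel) (\<lambda>(\<xi>, x). ?m \<xi> * cis (2 * pi * (x \<bullet> \<xi>)) * fourier \<phi> x)"
    by (rule integrable_pair_bound[where f = "\<lambda>\<xi>. cmod (?m \<xi>)" and g = "\<lambda>x. cmod (fourier \<phi> x)"])
       (use im i\<phi> in \<open>auto simp: norm_mult\<close>)
  have "integrable lborel (\<lambda>x. LINT \<xi>|lborel. ?m \<xi> * cis (2 * pi * (x \<bullet> \<xi>)) * fourier \<phi> x)"
    using lborel_pair.integrable_snd[OF pair] by simp
  then have 1: "integrable lborel (\<lambda>x. tensor_hilbert f x * fourier \<phi> x)"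
    by (simp add: T)
  obtain M where M: "\<And>x. cmod (\<phi> x) \<le> M" using schwartz_bounded[OF \<phi>] by blast
  have 2: "integrable lborel (\<lambda>\<xi>. ?m \<xi> * \<phi> \<xi>)"
  proof (rule Bochner_Integration.integrable_bound)
    show "integrable lborel (\<lambda>\<xi>. cmod (?m \<xi>) * M)" using im by simp
    show "AE \<xi> in lborel. norm (?m \<xi> * \<phi> \<xi>) \<le> norm (cmod (?m \<xi>) * M)"
      unfolding real_norm_def norm_mult
      by (intro AE_I2 order_trans[OF mult_left_mono[OF M norm_ge_zero] abs_ge_self])
  qed measurable
  have "(LINT x|lborel. tensor_hilbert f x * fourier \<phi> x)
      = (LINT x|lborel. (LINT \<xi>|lborel. ?m \<xi> * cis (2 * pi * (x \<bullet> \<xi>)) * fourier \<phi> x))"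
    by (simp add: T)
  also have "\<dots> = (LINT \<xi>|lborel. (LINT x|lborel. ?m \<xi> * cis (2 * pi * (x \<bullet> \<xi>)) * fourier \<phi> x))"
    by (rule lborel_pair.Fubini_integral[OF pair])
  also have "\<dots> = (LINT \<xi>|lborel. ?m \<xi> * \<phi> \<xi>)"
  proof (intro Bochner_Integration.integral_cong refl)
    fix \<xi> :: "real ^ 'n"
    have "(LINT x|lborel. ?m \<xi> * cis (2 * pi * (x \<bullet> \<xi>)) * fourier \<phi> x) = (LINT x|lborel. ?m \<xi> * (fourier \<phi> x * cis (2 * pi * (\<xi> \<bullet> x))))"
      by (intro Bochner_Integration.integral_cong refl) (simp only: inner_commute mult_ac)
    also have "\<dots> = ?m \<xi> * (LINT x|lborel. fourier \<phi> x * cis (2 * pi * (\<xi> \<bullet> x)))"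
      by (rule integral_mult_right_zero)
    also have "(LINT x|lborel. fourier \<phi> x * cis (2 * pi * (\<xi> \<bullet> x))) = \<phi> \<xi>"
      by (rule fourier_inversion[OF schwartz_integrable[OF \<phi>] M schwartz_continuous[OF \<phi>] i\<phi>])
    finally show "(LINT x|lborel. ?m \<xi> * cis (2 * pi * (x \<bullet> \<xi>)) * fourier \<phi> x) = ?m \<xi> * \<phi> \<xi>" .
  qed
  finally show "integrable lborel (\<lambda>x. tensor_hilbert f x * fourier \<phi> x) \<and>
        integrable lborel (\<lambda>\<xi>. ?m \<xi> * \<phi> \<xi>) \<and>
        (LINT x|lborel. tensor_hilbert f x * fourier \<phi> x) = (LINT \<xi>|lborel. ?m \<xi> * \<phi> \<xi>)"
    using 1 2 by blast
qed

text \<open>\<open>G\<close> and \<open>H\<close> are only known to be integrable against Schwartz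
  functions, so their difference is multiplied by a fixed positive Gaussian. The Gaussian averages
  of the product are pairings with Schwartz functions and therefore vanish.\<close>

lemma is_fourier_transform_unique:
  fixes G H :: "real ^ 'n \<Rightarrow> complex"
  assumes G: "is_fourier_transform g G" and H: "is_fourier_transform g H"
  shows "AE \<xi> in lborel. G \<xi> = H \<xi>"
proof -
  let ?g = "\<lambda>y :: real ^ 'n. complex_of_real (gauss y)"
  define u where "u y = (G y - H y) * ?g y" for y
  have s0: "schwartz ?g"
  proof -
    have "gaussian_poly (1 / 2) 0 (\<lambda>y. complex_of_real ((1 / sqrt (2 * pi)) ^ CARD('n)) * complex_of_real (exp (- (1 / 2) * (norm y)\<^sup>2 + 0 \<bullet> y)))"
      by (intro gaussian_poly.scale gaussian_poly.base)
    moreover have "(\<lambda>y. complex_of_real ((1 / sqrt (2 * pi)) ^ CARD('n)) * complex_of_real (exp (- (1 / 2) * (norm y)\<^sup>2 + 0 \<bullet> y))) = ?g"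
      unfolding gauss_eq of_real_mult[symmetric] by simp
    ultimately have "gaussian_poly (1 / 2) 0 ?g" by (rule back_subst[of "gaussian_poly (1 / 2) 0"])
    then show ?thesis by (rule schwartz_gaussian_poly) simp
  qed
  have "integrable lborel (\<lambda>y. G y * ?g y - H y * ?g y)"
    using G[unfolded is_fourier_transform_def, rule_format, OF s0] H[unfolded is_fourier_transform_def, rule_format, OF s0]
    by (intro Bochner_Integration.integrable_diff) simp_all
  then have u: "integrable lborel u" by (simp add: u_def[abs_def] left_diff_distrib)
  have "AE y in lborel. u y = 0"
  proof (rule AE_zero_if_gauss_averages_zero[OF u])
    fix c :: real and b :: "real ^ 'n" assume c: "0 < c"
    let ?p = "\<lambda>y :: real ^ 'n. complex_of_real (gauss y * gauss (c *\<^sub>R (b - y)))"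
    have s: "schwartz ?p" by (rule schwartz_gauss[OF c])
    have "integrable lborel (\<lambda>y. G y * ?p y)" "integrable lborel (\<lambda>y. H y * ?p y)"
      and "(LINT y|lborel. G y * ?p y) = (LINT y|lborel. H y * ?p y)"
      using G[unfolded is_fourier_transform_def, rule_format, OF s] H[unfolded is_fourier_transform_def, rule_format, OF s] by simp_all
    then have "(LINT y|lborel. G y * ?p y - H y * ?p y) = 0" by simp
    then show "(LINT y|lborel. u y * complex_of_real (gauss (c *\<^sub>R (b - y)))) = 0"
      by (simp add: u_def left_diff_distrib mult.assoc)
  qed
  then show ?thesis
  proof eventually_elim
    case (elim y)
    then show ?case using gauss_pos[of y] by (simp add: u_def)
  qed
qed

text \<open>The explicit multiplier shows that the choice in \<open>fourier_dist\<close> has a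
  witness, and uniqueness identifies the chosen function with it up to a null set.\<close>

lemma fourier_dist_tensor_hilbert:
  assumes f: "schwartz f"
  shows "AE \<xi> in lborel. fourier_dist (tensor_hilbert f) \<xi> = hilbert_multiplier f \<xi>"
proof (rule is_fourier_transform_unique)
  show "is_fourier_transform (tensor_hilbert f) (hilbert_multiplier f)"
    by (rule is_fourier_transform_tensor_hilbert[OF f])
  then show "is_fourier_transform (tensor_hilbert f) (fourier_dist (tensor_hilbert f))"
    unfolding fourier_dist_def by (rule someI[of "is_fourier_transform (tensor_hilbert f)"])
qed

subsection \<open>The size of the Gamma function on vertical lines\<close>

text \<open>
  By Euler's product \<open>gamma_decay \<mu> a = \<Sum>k. ln (1 + \<mu>\<^sup>2 / (a + k)\<^sup>2)\<close>, which is convex in \<open>a\<close>. As the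
  increments over unit steps are known from the functional equation, convexity determines
  the order of the increments over all other steps.
\<close>

definition gamma_decay :: "real \<Rightarrow> real \<Rightarrow> real" where
  "gamma_decay \<mu> a = - 2 * ln (cmod (Gamma (Complex a \<mu>)) / Gamma a)"

lemma cmod_Gamma_pos: "0 < a \<Longrightarrow> 0 < cmod (Gamma (Complex a \<mu>))"
proof -
  assume "0 < a"
  then have "Complex a \<mu> \<notin> \<int>\<^sub>\<le>\<^sub>0" by (auto elim!: nonpos_Ints_cases simp: complex_eq_iff)
  then show ?thesis by (simp add: Gamma_eq_zero_iff)
qed

lemma cmod_Gamma_eq: "0 < a \<Longrightarrow> cmod (Gamma (Complex a \<mu>)) = Gamma a * exp (- gamma_decay \<mu> a / 2)"
  using cmod_Gamma_pos[of a \<mu>] Gamma_real_pos[of a] by (simp add: gamma_decay_def less_imp_neq[symmetric])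

text \<open>Take moduli in Euler's limit formula and divide by its value at \<open>a\<close>: the
  factorials and the powers of n cancel, since |n^z| depends on Re z alone, and only a quotient of
  Pochhammer products is left.\<close>

lemma gamma_decay_LIMSEQ:
  assumes a: "0 < a"
  shows "(\<lambda>n. \<Sum>k\<le>n. ln (1 + \<mu>\<^sup>2 / (a + real k)\<^sup>2)) \<longlonglongrightarrow> gamma_decay \<mu> a"
proof -
  have r: "cmod (Gamma_series (Complex a \<mu>) n) / Gamma_series a n = exp (- (\<Sum>k\<le>n. ln (1 + \<mu>\<^sup>2 / (a + real k)\<^sup>2)) / 2)" for n
  proof -
    have t: "(a + real k) / cmod (Complex a \<mu> + of_nat k) = exp (- ln (1 + \<mu>\<^sup>2 / (a + real k)\<^sup>2) / 2)" for k
    proof -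
      have p: "0 < a + real k" using a by simp
      have "cmod (Complex a \<mu> + of_nat k) = sqrt ((a + real k)\<^sup>2 + \<mu>\<^sup>2)" by (simp add: cmod_def)
      also have "(a + real k)\<^sup>2 + \<mu>\<^sup>2 = (a + real k)\<^sup>2 * (1 + \<mu>\<^sup>2 / (a + real k)\<^sup>2)" using p by (simp add: field_simps)
      also have "sqrt \<dots> = (a + real k) * sqrt (1 + \<mu>\<^sup>2 / (a + real k)\<^sup>2)" using p by (simp add: real_sqrt_mult)
      also have "sqrt (1 + \<mu>\<^sup>2 / (a + real k)\<^sup>2) = exp (ln (1 + \<mu>\<^sup>2 / (a + real k)\<^sup>2) / 2)"
        by (subst ln_sqrt[symmetric]) (auto simp: add_pos_nonneg)
      finally have "cmod (Complex a \<mu> + of_nat k) = (a + real k) * exp (ln (1 + \<mu>\<^sup>2 / (a + real k)\<^sup>2) / 2)" .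
      moreover have "x / (x * exp y) = exp (- y)" if "x \<noteq> 0" for x y :: real
        using that by (simp add: exp_minus inverse_eq_divide)
      ultimately show ?thesis using p by (metis less_irrefl minus_divide_left)
    qed
    have pos: "0 < pochhammer a (Suc n)" using a by (rule pochhammer_pos)
    have "cmod (Gamma_series (Complex a \<mu>) n) / Gamma_series a n = pochhammer a (Suc n) / cmod (pochhammer (Complex a \<mu>) (Suc n))"
      using pos by (simp add: Gamma_series_def norm_divide norm_mult del: pochhammer_Suc)
    also have "\<dots> = (\<Prod>k\<le>n. (a + real k) / cmod (Complex a \<mu> + of_nat k))"
      by (simp add: pochhammer_Suc_prod prod_norm prod_dividef atLeast0AtMost)
    also have "\<dots> = exp (- (\<Sum>k\<le>n. ln (1 + \<mu>\<^sup>2 / (a + real k)\<^sup>2)) / 2)"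
      unfolding t by (simp add: exp_sum[symmetric] sum_negf sum_divide_distrib)
    finally show ?thesis .
  qed
  have "(\<lambda>n. cmod (Gamma_series (Complex a \<mu>) n) / Gamma_series a n) \<longlonglongrightarrow> cmod (Gamma (Complex a \<mu>)) / Gamma a"
    using Gamma_real_pos[OF a] by (intro tendsto_intros) auto
  then have "(\<lambda>n. exp (- (\<Sum>k\<le>n. ln (1 + \<mu>\<^sup>2 / (a + real k)\<^sup>2)) / 2)) \<longlonglongrightarrow> cmod (Gamma (Complex a \<mu>)) / Gamma a"
    unfolding r .
  then have "(\<lambda>n. - 2 * ln (exp (- (\<Sum>k\<le>n. ln (1 + \<mu>\<^sup>2 / (a + real k)\<^sup>2)) / 2))) \<longlonglongrightarrow> - 2 * ln (cmod (Gamma (Complex a \<mu>)) / Gamma a)"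
    using cmod_Gamma_pos[OF a, of \<mu>] Gamma_real_pos[OF a] by (intro tendsto_intros) auto
  then show ?thesis by (simp add: gamma_decay_def)
qed

text \<open>Written as ln(a^2 + \<mu>^2) - 2 ln a, the function has an explicit second
  derivative.\<close>

lemma convex_ln_one_plus_inverse_square: "convex_on {0<..} (\<lambda>a::real. ln (1 + \<mu>\<^sup>2 / a\<^sup>2))"
proof -
  have convex: "convex_on {0<..} (\<lambda>a::real. ln (a\<^sup>2 + \<mu>\<^sup>2) - 2 * ln a)"
  proof (rule f''_ge0_imp_convex)
    fix a :: real assume "a \<in> {0<..}"
    then have a: "0 < a" by simp
    have p: "0 < a\<^sup>2 + \<mu>\<^sup>2" using a by (simp add: add_pos_nonneg)
    show "((\<lambda>a. ln (a\<^sup>2 + \<mu>\<^sup>2) - 2 * ln a) has_real_derivative (2 * a / (a\<^sup>2 + \<mu>\<^sup>2) - 2 / a)) (at a)"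
      using a p by (auto intro!: derivative_eq_intros)
    show "((\<lambda>a. 2 * a / (a\<^sup>2 + \<mu>\<^sup>2) - 2 / a) has_real_derivative ((2 * (a\<^sup>2 + \<mu>\<^sup>2) - 2 * a * (2 * a)) / (a\<^sup>2 + \<mu>\<^sup>2)\<^sup>2 + 2 / a\<^sup>2)) (at a)"
      using a p by (auto intro!: derivative_eq_intros simp: power2_eq_square)
    \<comment> \<open>Over the common denominator the a^4 terms cancel and only nonnegative
      monomials remain.\<close>
    have "(2 * (a\<^sup>2 + \<mu>\<^sup>2) - 2 * a * (2 * a)) / (a\<^sup>2 + \<mu>\<^sup>2)\<^sup>2 + 2 / a\<^sup>2 = (6 * a\<^sup>2 * \<mu>\<^sup>2 + 2 * \<mu>\<^sup>2 * \<mu>\<^sup>2) / ((a\<^sup>2 + \<mu>\<^sup>2)\<^sup>2 * a\<^sup>2)"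
      using a p by (simp add: divide_simps) (simp add: power2_eq_square algebra_simps)
    also have "\<dots> \<ge> 0" by simp
    finally show "0 \<le> (2 * (a\<^sup>2 + \<mu>\<^sup>2) - 2 * a * (2 * a)) / (a\<^sup>2 + \<mu>\<^sup>2)\<^sup>2 + 2 / a\<^sup>2" .
  qed simp
  have "ln (a\<^sup>2 + \<mu>\<^sup>2) - 2 * ln a = ln (1 + \<mu>\<^sup>2 / a\<^sup>2)" if "a \<in> {0<..}" for a :: real
  proof -
    have "1 + \<mu>\<^sup>2 / a\<^sup>2 = (a\<^sup>2 + \<mu>\<^sup>2) / a\<^sup>2" using that by (simp add: field_simps)
    then show ?thesis using that by (simp add: ln_div ln_realpow add_pos_nonneg)
  qed
  note eq = this
  show ?thesis
  proof (rule convex_onI)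
    fix t x y :: real assume t: "0 < t" "t < 1" and xy: "x \<in> {0<..}" "y \<in> {0<..}"
    have z: "(1 - t) *\<^sub>R x + t *\<^sub>R y \<in> {0<..}" using t xy by (simp add: add_pos_pos)
    show "ln (1 + \<mu>\<^sup>2 / ((1 - t) *\<^sub>R x + t *\<^sub>R y)\<^sup>2) \<le> (1 - t) * ln (1 + \<mu>\<^sup>2 / x\<^sup>2) + t * ln (1 + \<mu>\<^sup>2 / y\<^sup>2)"
      unfolding eq[OF z, symmetric] eq[OF xy(1), symmetric] eq[OF xy(2), symmetric]
      using convex_onD[OF convex, of t x y] t xy by simp
  qed simp
qed

text \<open>Convexity holds for each shifted term of the series and survives finite sums and
  pointwise limits, so the series need not be differentiated.\<close>

lemma convex_gamma_decay: "convex_on {0<..} (gamma_decay \<mu>)"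
proof (rule convex_onI)
  fix t x y :: real assume t: "0 < t" "t < 1" and xy: "x \<in> {0<..}" "y \<in> {0<..}"
  have z: "0 < (1 - t) * x + t * y" using t xy by (simp add: add_pos_pos)
  have le: "ln (1 + \<mu>\<^sup>2 / ((1 - t) * x + t * y + real k)\<^sup>2) \<le> (1 - t) * ln (1 + \<mu>\<^sup>2 / (x + real k)\<^sup>2) + t * ln (1 + \<mu>\<^sup>2 / (y + real k)\<^sup>2)" for k
  proof -
    have "(1 - t) * x + t * y + real k = (1 - t) *\<^sub>R (x + real k) + t *\<^sub>R (y + real k)"
      by (simp add: algebra_simps)
    then show ?thesis
      using convex_onD[OF convex_ln_one_plus_inverse_square, of t "x + real k" "y + real k"] t xy by simp
  qed
  have "gamma_decay \<mu> ((1 - t) * x + t * y) \<le> (1 - t) * gamma_decay \<mu> x + t * gamma_decay \<mu> y"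
  proof (rule LIMSEQ_le)
    show "(\<lambda>n. \<Sum>k\<le>n. ln (1 + \<mu>\<^sup>2 / ((1 - t) * x + t * y + real k)\<^sup>2)) \<longlonglongrightarrow> gamma_decay \<mu> ((1 - t) * x + t * y)"
      by (rule gamma_decay_LIMSEQ[OF z])
    show "(\<lambda>n. (1 - t) * (\<Sum>k\<le>n. ln (1 + \<mu>\<^sup>2 / (x + real k)\<^sup>2)) + t * (\<Sum>k\<le>n. ln (1 + \<mu>\<^sup>2 / (y + real k)\<^sup>2)))
        \<longlonglongrightarrow> (1 - t) * gamma_decay \<mu> x + t * gamma_decay \<mu> y"
      using xy by (intro tendsto_intros gamma_decay_LIMSEQ) auto
    show "\<exists>N. \<forall>n\<ge>N. (\<Sum>k\<le>n. ln (1 + \<mu>\<^sup>2 / ((1 - t) * x + t * y + real k)\<^sup>2)) \<le> (1 - t) * (\<Sum>k\<le>n. ln (1 + \<mu>\<^sup>2 / (x + real k)\<^sup>2)) + t * (\<Sum>k\<le>n. ln (1 + \<mu>\<^sup>2 / (y + real k)\<^sup>2))"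
      unfolding sum_distrib_left sum.distrib[symmetric] by (intro exI allI impI sum_mono le)
  qed
  then show "gamma_decay \<mu> ((1 - t) *\<^sub>R x + t *\<^sub>R y) \<le> (1 - t) * gamma_decay \<mu> x + t * gamma_decay \<mu> y" by simp
qed simp

lemma cmod_Gamma_plus1: "0 < a \<Longrightarrow> cmod (Gamma (Complex (a + 1) \<mu>)) = cmod (Complex a \<mu>) * cmod (Gamma (Complex a \<mu>))"
proof -
  assume a: "0 < a"
  have "Complex a \<mu> \<notin> \<int>\<^sub>\<le>\<^sub>0" using a by (auto elim!: nonpos_Ints_cases simp: complex_eq_iff)
  from Gamma_plus1[OF this] show ?thesis
    by (simp add: norm_mult[symmetric] one_complex.code plus_complex.code)
qed

lemma gamma_decay_plus1:
  assumes a: "0 < a"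
  shows "gamma_decay \<mu> (a + 1) = gamma_decay \<mu> a - ln (1 + \<mu>\<^sup>2 / a\<^sup>2)"
proof -
  have "Gamma (a + 1) = a * Gamma a"
    using a by (intro Gamma_plus1) (auto elim!: nonpos_Ints_cases)
  then have "cmod (Gamma (Complex (a + 1) \<mu>)) / Gamma (a + 1) = (cmod (Complex a \<mu>) / a) * (cmod (Gamma (Complex a \<mu>)) / Gamma a)"
    using cmod_Gamma_plus1[OF a] by simp
  moreover have "cmod (Complex a \<mu>) / a = sqrt (1 + \<mu>\<^sup>2 / a\<^sup>2)"
  proof -
    have "cmod (Complex a \<mu>) = sqrt (a\<^sup>2 * (1 + \<mu>\<^sup>2 / a\<^sup>2))" using a by (simp add: cmod_def field_simps)
    then show ?thesis using a by (simp add: real_sqrt_mult)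
  qed
  moreover have "0 < 1 + \<mu>\<^sup>2 / a\<^sup>2" by (simp add: add_pos_nonneg)
  moreover have "0 < cmod (Gamma (Complex a \<mu>)) / Gamma a" using cmod_Gamma_pos[OF a] Gamma_real_pos[OF a] by simp
  ultimately have "ln (cmod (Gamma (Complex (a + 1) \<mu>)) / Gamma (a + 1)) = ln (sqrt (1 + \<mu>\<^sup>2 / a\<^sup>2)) + ln (cmod (Gamma (Complex a \<mu>)) / Gamma a)"
    by (simp only: ln_mult_pos real_sqrt_gt_0_iff)
  then show ?thesis using \<open>0 < 1 + \<mu>\<^sup>2 / a\<^sup>2\<close> by (simp only: gamma_decay_def ln_sqrt) simp
qed

text \<open>Chord slopes of a convex function increase. The slope over [a, a+t] therefore lies
  between those over [a-1, a] and [a, a+1], and unit chords are known from the functional equation.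
  The condition 1 < a keeps a-1 in the domain.\<close>

lemma gamma_decay_bounds:
  assumes a: "1 < a" and t: "0 \<le> t" "t \<le> 1"
  shows "t * ln (1 + \<mu>\<^sup>2 / a\<^sup>2) \<le> gamma_decay \<mu> a - gamma_decay \<mu> (a + t)"
    and "gamma_decay \<mu> a - gamma_decay \<mu> (a + t) \<le> t * ln (1 + \<mu>\<^sup>2 / (a - 1)\<^sup>2)"
proof -
  have "gamma_decay \<mu> ((1 - t) *\<^sub>R a + t *\<^sub>R (a + 1)) \<le> (1 - t) * gamma_decay \<mu> a + t * gamma_decay \<mu> (a + 1)"
    by (rule convex_onD[OF convex_gamma_decay]) (use a t in auto)
  then have "t * (gamma_decay \<mu> a - gamma_decay \<mu> (a + 1)) \<le> gamma_decay \<mu> a - gamma_decay \<mu> (a + t)"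
    by (simp add: algebra_simps)
  moreover have "gamma_decay \<mu> a - gamma_decay \<mu> (a + 1) = ln (1 + \<mu>\<^sup>2 / a\<^sup>2)"
    using gamma_decay_plus1[of a \<mu>] a by simp
  ultimately show "t * ln (1 + \<mu>\<^sup>2 / a\<^sup>2) \<le> gamma_decay \<mu> a - gamma_decay \<mu> (a + t)" by simp
  \<comment> \<open>The weight for which \<open>a\<close> is the convex combination of
    \<open>a - 1\<close> and \<open>a + t\<close>.\<close>
  define s where "s = 1 / (1 + t)"
  have s: "0 \<le> s" "s \<le> 1" "s * (1 + t) = 1" using t by (auto simp: s_def)
  have "(1 - s) * (a - 1) + s * (a + t) = a - 1 + s * (1 + t)" by (simp add: algebra_simps)
  then have "(1 - s) *\<^sub>R (a - 1) + s *\<^sub>R (a + t) = a" using s(3) by simp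
  moreover have "gamma_decay \<mu> ((1 - s) *\<^sub>R (a - 1) + s *\<^sub>R (a + t)) \<le> (1 - s) * gamma_decay \<mu> (a - 1) + s * gamma_decay \<mu> (a + t)"
    by (rule convex_onD[OF convex_gamma_decay]) (use a t s in auto)
  ultimately have "gamma_decay \<mu> a \<le> (1 - s) * gamma_decay \<mu> (a - 1) + s * gamma_decay \<mu> (a + t)" by simp
  then have "(1 + t) * gamma_decay \<mu> a \<le> (1 + t) * ((1 - s) * gamma_decay \<mu> (a - 1) + s * gamma_decay \<mu> (a + t))"
    using t by (intro mult_left_mono) auto
  also have "\<dots> = (1 + t - s * (1 + t)) * gamma_decay \<mu> (a - 1) + (s * (1 + t)) * gamma_decay \<mu> (a + t)"
    by (simp add: algebra_simps)
  also have "\<dots> = t * gamma_decay \<mu> (a - 1) + gamma_decay \<mu> (a + t)" unfolding s(3) by simp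
  finally have "gamma_decay \<mu> a - gamma_decay \<mu> (a + t) \<le> t * (gamma_decay \<mu> (a - 1) - gamma_decay \<mu> a)"
    by (simp add: algebra_simps)
  also have "gamma_decay \<mu> (a - 1) - gamma_decay \<mu> a = ln (1 + \<mu>\<^sup>2 / (a - 1)\<^sup>2)"
    using gamma_decay_plus1[of "a - 1" \<mu>] a by simp
  finally show "gamma_decay \<mu> a - gamma_decay \<mu> (a + t) \<le> t * ln (1 + \<mu>\<^sup>2 / (a - 1)\<^sup>2)" .
qed

section \<open>Two-sided power bounds for quotients of Gamma moduli\<close>

lemma one_plus_square_scale_bigtheta:
  assumes c: "0 < (c::real)"
  shows "(\<lambda>\<mu>::real. 1 + \<mu>\<^sup>2 / c) \<in> \<Theta>[top](\<lambda>\<mu>. 1 + \<mu>\<^sup>2)"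
proof (rule bigthetaI'[of "min 1 (1 / c)" "max 1 (1 / c)"])
  show "eventually (\<lambda>\<mu>::real. min 1 (1 / c) * norm (1 + \<mu>\<^sup>2) \<le> norm (1 + \<mu>\<^sup>2 / c) \<and> norm (1 + \<mu>\<^sup>2 / c) \<le> max 1 (1 / c) * norm (1 + \<mu>\<^sup>2)) top"
  proof (rule always_eventually, rule allI)
    fix \<mu> :: real
    have n: "norm (1 + \<mu>\<^sup>2) = 1 + \<mu>\<^sup>2" "norm (1 + \<mu>\<^sup>2 / c) = 1 + (1 / c) * \<mu>\<^sup>2"
      using c by (auto simp: add_nonneg_nonneg)
    have "min 1 (1 / c) * (1 + \<mu>\<^sup>2) = min 1 (1 / c) * 1 + min 1 (1 / c) * \<mu>\<^sup>2" by (simp add: distrib_left)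
    also have "\<dots> \<le> 1 + (1 / c) * \<mu>\<^sup>2" by (intro add_mono mult_right_mono) auto
    finally have 1: "min 1 (1 / c) * (1 + \<mu>\<^sup>2) \<le> 1 + (1 / c) * \<mu>\<^sup>2" .
    have "1 + (1 / c) * \<mu>\<^sup>2 \<le> max 1 (1 / c) * 1 + max 1 (1 / c) * \<mu>\<^sup>2" by (intro add_mono mult_right_mono) auto
    also have "\<dots> = max 1 (1 / c) * (1 + \<mu>\<^sup>2)" by (simp add: distrib_left)
    finally show "min 1 (1 / c) * norm (1 + \<mu>\<^sup>2) \<le> norm (1 + \<mu>\<^sup>2 / c) \<and> norm (1 + \<mu>\<^sup>2 / c) \<le> max 1 (1 / c) * norm (1 + \<mu>\<^sup>2)"
      unfolding n using 1 by simp
  qed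
qed (use c in auto)

lemma bigtheta_top_powr:
  fixes f g :: "'a \<Rightarrow> real"
  assumes "f \<in> \<Theta>[top](g)" "\<And>x. 0 < f x" "\<And>x. 0 < g x"
  shows "(\<lambda>x. f x powr p) \<in> \<Theta>[top](\<lambda>x. g x powr p)"
  using bigtheta_powr[OF assms(1), of p] assms(2,3) by (simp add: less_imp_le abs_of_pos)

text \<open>The growth |\<mu>|^(b-a) known from Stirling's formula, with 1 + \<mu>^2 in place of
  \<mu>^2 so that small \<mu> are included. Under the filter \<open>top\<close>, \<Theta> stands for
  two bounds valid at every real \<mu>, while products, inverses and transitivity still come from
  the Landau calculus.\<close>

definition gamma_ratio_order :: "real \<Rightarrow> real \<Rightarrow> bool" where
  "gamma_ratio_order a b \<longleftrightarrow>
     (\<lambda>\<mu>. cmod (Gamma (Complex b \<mu>)) / cmod (Gamma (Complex a \<mu>))) \<in> \<Theta>[top](\<lambda>\<mu>. (1 + \<mu>\<^sup>2) powr ((b - a) / 2))"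

lemma one_plus_square_pos': "0 < 1 + (t::real)\<^sup>2 / c\<^sup>2" "0 < 1 + (t::real)\<^sup>2"
  by (auto simp: add_pos_nonneg)

lemma gamma_ratio_order_trans:
  assumes "gamma_ratio_order a b" "gamma_ratio_order b c" "0 < b"
  shows "gamma_ratio_order a c"
  using landau_theta.mult[OF assms(1,2)[unfolded gamma_ratio_order_def]] cmod_Gamma_pos[OF assms(3)]
  by (simp add: gamma_ratio_order_def powr_add[symmetric] add_divide_distrib[symmetric] less_imp_neq[symmetric])

lemma gamma_ratio_order_sym:
  assumes "gamma_ratio_order a b" shows "gamma_ratio_order b a"
proof -
  have "(\<lambda>\<mu>. inverse (cmod (Gamma (Complex b \<mu>)) / cmod (Gamma (Complex a \<mu>)))) \<in> \<Theta>[top](\<lambda>\<mu>. inverse ((1 + \<mu>\<^sup>2) powr ((b - a) / 2)))"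
    using assms by (simp only: gamma_ratio_order_def bigtheta_inverse)
  then show ?thesis by (simp add: gamma_ratio_order_def powr_minus[symmetric] minus_divide_left)
qed

lemma gamma_ratio_order_plus1:
  assumes a: "0 < a" shows "gamma_ratio_order a (a + 1)"
proof -
  have "(\<lambda>\<mu>. a * (1 + \<mu>\<^sup>2 / a\<^sup>2) powr (1 / 2)) \<in> \<Theta>[top](\<lambda>\<mu>. (1 + \<mu>\<^sup>2) powr (1 / 2))"
    using bigtheta_top_powr[OF one_plus_square_scale_bigtheta[of "a\<^sup>2"], of "1 / 2"] a one_plus_square_pos' by simp
  moreover have "cmod (Gamma (Complex (a + 1) \<mu>)) / cmod (Gamma (Complex a \<mu>)) = a * (1 + \<mu>\<^sup>2 / a\<^sup>2) powr (1 / 2)" for \<mu>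
  proof -
    have "cmod (Complex a \<mu>) = sqrt (a\<^sup>2 * (1 + \<mu>\<^sup>2 / a\<^sup>2))" using a by (simp add: cmod_def field_simps)
    then show ?thesis using a cmod_Gamma_pos[OF a, of \<mu>] one_plus_square_pos'(1)[of \<mu> a] by (simp add: cmod_Gamma_plus1[OF a] real_sqrt_mult powr_half_sqrt)
  qed
  ultimately show ?thesis by (simp add: gamma_ratio_order_def)
qed

text \<open>The quotient is a constant times the exponential of half an increment of
  \<open>gamma_decay\<close>; the bounds on that increment become powers t/2 of 1 + \<mu>^2/a^2 and
  1 + \<mu>^2/(a-1)^2, which have the same order.\<close>

lemma gamma_ratio_order_small:
  assumes a: "1 < a" and t: "0 \<le> t" "t \<le> 1"
  shows "gamma_ratio_order a (a + t)"
proof -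
  define r where "r \<mu> = cmod (Gamma (Complex (a + t) \<mu>)) / cmod (Gamma (Complex a \<mu>))" for \<mu>
  define C where "C = Gamma (a + t) / Gamma a"
  have C: "0 < C" using a t by (auto simp: C_def intro!: divide_pos_pos Gamma_real_pos)
  have r: "r \<mu> = C * exp ((gamma_decay \<mu> a - gamma_decay \<mu> (a + t)) / 2)" for \<mu>
  proof -
    have "exp (- gamma_decay \<mu> (a + t) / 2) / exp (- gamma_decay \<mu> a / 2) = exp ((gamma_decay \<mu> a - gamma_decay \<mu> (a + t)) / 2)"
      unfolding exp_diff[symmetric] by (rule arg_cong[where f = exp]) (simp add: field_simps)
    moreover have "r \<mu> = C * (exp (- gamma_decay \<mu> (a + t) / 2) / exp (- gamma_decay \<mu> a / 2))"
      using a t by (simp add: r_def C_def cmod_Gamma_eq)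
    ultimately show ?thesis by simp
  qed
  have pw: "(1 + \<mu>\<^sup>2 / c\<^sup>2) powr (t / 2) = exp (t * ln (1 + \<mu>\<^sup>2 / c\<^sup>2) / 2)" for \<mu> c
    using one_plus_square_pos'(1)[of \<mu> c] by (simp add: powr_def)
  have lo: "C * (1 + \<mu>\<^sup>2 / a\<^sup>2) powr (t / 2) \<le> r \<mu>" and hi: "r \<mu> \<le> C * (1 + \<mu>\<^sup>2 / (a - 1)\<^sup>2) powr (t / 2)" for \<mu>
    unfolding r pw using gamma_decay_bounds[OF a t, of \<mu>] C by auto
  have 1: "(\<lambda>\<mu>. (1 + \<mu>\<^sup>2 / a\<^sup>2) powr (t / 2)) \<in> \<Theta>[top](\<lambda>\<mu>. (1 + \<mu>\<^sup>2) powr (t / 2))"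
    by (rule bigtheta_top_powr[OF one_plus_square_scale_bigtheta]) (use a in \<open>auto simp: one_plus_square_pos'\<close>)
  have 2: "(\<lambda>\<mu>. (1 + \<mu>\<^sup>2 / (a - 1)\<^sup>2) powr (t / 2)) \<in> \<Theta>[top](\<lambda>\<mu>. (1 + \<mu>\<^sup>2) powr (t / 2))"
    by (rule bigtheta_top_powr[OF one_plus_square_scale_bigtheta]) (use a in \<open>auto simp: one_plus_square_pos'\<close>)
  have "r \<in> O[top](\<lambda>\<mu>. (1 + \<mu>\<^sup>2 / (a - 1)\<^sup>2) powr (t / 2))"
    by (rule bigoI[of _ C]) (use hi C in \<open>auto simp: r\<close>)
  moreover have "r \<in> \<Omega>[top](\<lambda>\<mu>. (1 + \<mu>\<^sup>2 / a\<^sup>2) powr (t / 2))"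
    by (rule landau_omega.bigI[of C]) (use lo C in \<open>auto simp: r\<close>)
  ultimately have "r \<in> \<Theta>[top](\<lambda>\<mu>. (1 + \<mu>\<^sup>2) powr (t / 2))"
    using 1 2 by (intro bigthetaI) (auto intro: landau_o.big.bigtheta_trans1 landau_omega.big.bigtheta_trans1)
  then show ?thesis by (simp add: gamma_ratio_order_def r_def[abs_def])
qed

lemma gamma_ratio_order_add_nat:
  assumes "0 < a" shows "gamma_ratio_order a (a + real n)"
proof (induction n)
  case 0
  have "(\<lambda>\<mu>. cmod (Gamma (Complex a \<mu>)) / cmod (Gamma (Complex a \<mu>))) = (\<lambda>\<mu>. (1 + \<mu>\<^sup>2) powr 0)"
    using cmod_Gamma_pos[OF assms] by (auto simp: fun_eq_iff less_imp_neq[symmetric] add_nonneg_eq_0_iff)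
  then show ?case by (simp add: gamma_ratio_order_def)
next
  case (Suc n)
  have "gamma_ratio_order (a + real n) (a + real n + 1)"
    by (rule gamma_ratio_order_plus1) (use assms in auto)
  from gamma_ratio_order_trans[OF Suc this] show ?case using assms by (simp add: add_ac)
qed

theorem gamma_ratio_order:
  assumes "0 < a" "0 < b" shows "gamma_ratio_order a b"
proof -
  have le: "gamma_ratio_order a b" if "0 < a" "a \<le> b" for a b
  proof -
    \<comment> \<open>\<open>a + n\<close> lies in (b, b+1], so the fractional step \<open>t\<close>
      leads up to b+1 and one application of the functional equation leads back to b. Overshooting
      guarantees n \<ge> 1, hence a + n > 1 as the fractional step requires.\<close>
    define n where "n = Suc (nat \<lfloor>b - a\<rfloor>)"
    define t where "t = b + 1 - (a + real n)"
    have n: "real n = 1 + of_int \<lfloor>b - a\<rfloor>" using that by (simp add: n_def)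
    have t: "0 \<le> t" "t \<le> 1" unfolding t_def n by linarith+
    have "0 \<le> \<lfloor>b - a\<rfloor>" using that by simp
    then have fl: "0 \<le> real_of_int \<lfloor>b - a\<rfloor>" by simp
    have 1: "gamma_ratio_order a (a + real n)" by (rule gamma_ratio_order_add_nat[OF that(1)])
    have a1: "1 < a + real n" unfolding n using that fl by linarith
    have 2: "gamma_ratio_order (a + real n) (a + real n + t)"
      by (rule gamma_ratio_order_small[OF a1 t])
    have e: "a + real n + t = b + 1" by (simp add: t_def)
    have "gamma_ratio_order a (b + 1)"
      by (rule gamma_ratio_order_trans[OF 1 2[unfolded e]]) (use a1 in linarith)
    moreover have "gamma_ratio_order (b + 1) b"
      by (rule gamma_ratio_order_sym[OF gamma_ratio_order_plus1]) (use that in linarith)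
    ultimately show ?thesis
      by (rule gamma_ratio_order_trans) (use that in linarith)
  qed
  show ?thesis
  proof (cases "a \<le> b")
    case True
    then show ?thesis by (rule le[OF assms(1)])
  next
    case False
    then show ?thesis by (intro gamma_ratio_order_sym[OF le[OF assms(2)]]) simp
  qed
qed

subsection \<open>Mellin transforms of the two kernels\<close>

text \<open>In logarithmic coordinates the Mellin transform on the imaginary axis is a Fourier integral.\<close>

definition mellin :: "(real \<Rightarrow> real) \<Rightarrow> real \<Rightarrow> complex" where
  "mellin K l = (LINT y|lborel. complex_of_real (K y) * cis (l * y))"

text \<open>A convolution theorem for the correlation of \<open>K\<close> with \<open>P\<close>: the
  shift enters as \<open>y + \<eta>\<close>, whence the argument \<open>- l\<close> at
  \<open>P\<close>. With \<open>P\<close> and the correlation explicit, the transform of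
  \<open>K\<close> follows by division.\<close>

lemma mellin_correlation:
  assumes K: "integrable lborel K" and P: "integrable lborel P"
  shows "(LINT y|lborel. complex_of_real (LINT \<eta>|lborel. K (y + \<eta>) * P \<eta>) * cis (l * y)) = mellin K l * mellin P (- l)"
proof -
  have [measurable]: "K \<in> borel_measurable borel" "P \<in> borel_measurable borel" using K P by auto
  let ?h = "\<lambda>\<eta> y. complex_of_real (K (y + \<eta>) * P \<eta>) * cis (l * y)"
  have Kt: "integrable lborel (\<lambda>y. K (y + \<eta>))" for \<eta>
    using integrable_translate_lborel[OF K, of \<eta>] by (simp add: add.commute)
  have pair: "integrable (lborel \<Otimes>\<^sub>M lborel) (\<lambda>(\<eta>, y). ?h \<eta> y)"
  proof (rule lborel_pair.Fubini_integrable)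
    show "(\<lambda>(\<eta>, y). ?h \<eta> y) \<in> borel_measurable (lborel \<Otimes>\<^sub>M lborel)" by measurable
    have "(LINT y|lborel. norm (?h \<eta> y)) = \<bar>P \<eta>\<bar> * (LINT y|lborel. \<bar>K y\<bar>)" for \<eta>
      using integral_translate_lborel[of "\<lambda>y. \<bar>K y\<bar>" \<eta>] by (simp add: norm_mult abs_mult add.commute)
    then show "integrable lborel (\<lambda>\<eta>. LINT y|lborel. norm (case (\<eta>, y) of (\<eta>, y) \<Rightarrow> ?h \<eta> y))"
      using P by simp
    show "AE \<eta> in lborel. integrable lborel (\<lambda>y. case (\<eta>, y) of (\<eta>, y) \<Rightarrow> ?h \<eta> y)"
      using Kt by (auto intro!: AE_I2 integrable_mult_cis integrable_of_real)
  qed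
  have inner: "(LINT y|lborel. ?h \<eta> y) = mellin K l * (complex_of_real (P \<eta>) * cis (- l * \<eta>))" for \<eta>
  proof -
    have "(LINT y|lborel. ?h \<eta> y) = (LINT y|lborel. (complex_of_real (K (\<eta> + y)) * cis (l * (\<eta> + y))) * (complex_of_real (P \<eta>) * cis (- l * \<eta>)))"
    proof (intro Bochner_Integration.integral_cong refl)
      fix y
      have "cis (l * y) = cis (l * (\<eta> + y) + - l * \<eta>)"
        by (rule arg_cong[where f = cis]) (simp add: distrib_left)
      then have c: "cis (l * y) = cis (l * (\<eta> + y)) * cis (- l * \<eta>)" by (simp only: cis_mult)
      have 4: "(a * b) * (c * d) = (a * c) * (b * d)" for a b c d :: complex by (simp only: mult_ac)
      show "?h \<eta> y = (complex_of_real (K (\<eta> + y)) * cis (l * (\<eta> + y))) * (complex_of_real (P \<eta>) * cis (- l * \<eta>))"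
        unfolding of_real_mult add.commute[of y \<eta>] c by (rule 4)
    qed
    also have "\<dots> = (LINT y|lborel. complex_of_real (K (\<eta> + y)) * cis (l * (\<eta> + y))) * (complex_of_real (P \<eta>) * cis (- l * \<eta>))"
      by (rule integral_mult_left_zero)
    also have "(LINT y|lborel. complex_of_real (K (\<eta> + y)) * cis (l * (\<eta> + y))) = mellin K l"
      unfolding mellin_def by (rule integral_translate_lborel[where f = "\<lambda>y. complex_of_real (K y) * cis (l * y)"]) measurable
    finally show ?thesis .
  qed
  have "(LINT y|lborel. complex_of_real (LINT \<eta>|lborel. K (y + \<eta>) * P \<eta>) * cis (l * y)) = (LINT y|lborel. (LINT \<eta>|lborel. ?h \<eta> y))"
    unfolding integral_complex_of_real[symmetric] integral_mult_left_zero ..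
  also have "\<dots> = (LINT \<eta>|lborel. (LINT y|lborel. ?h \<eta> y))"
    by (rule lborel_pair.Fubini_integral[OF pair])
  also have "\<dots> = mellin K l * mellin P (- l)"
    unfolding inner mellin_def by (rule integral_mult_right_zero)
  finally show ?thesis .
qed

text \<open>Euler's integral under r = e^y: the measure dr/r becomes dy, so r^z turns into exp(zy)
  without a shift of z.\<close>

lemma
  assumes z: "0 < Re z"
  shows integrable_Gamma_log: "integrable lborel (\<lambda>y. exp (z * complex_of_real y) * complex_of_real (exp (- exp y)))" (is ?I)
    and integral_Gamma_log: "(LINT y|lborel. exp (z * complex_of_real y) * complex_of_real (exp (- exp y))) = Gamma z" (is ?E)
proof -
  define f where "f r = exp ((z - 1) * complex_of_real (ln r)) * complex_of_real (exp (- r))" for r :: real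
  have [measurable]: "f \<in> borel_measurable borel"
    unfolding f_def[abs_def] by measurable
  have fr: "f r = complex_of_real r powr (z - 1) / complex_of_real (exp r)" if "r \<in> {0<..}" for r
    using that by (simp add: f_def powr_def Ln_of_real exp_minus divide_inverse)
  have e: "exp y *\<^sub>R f (exp y) = exp (z * complex_of_real y) * complex_of_real (exp (- exp y))" for y
    by (simp add: f_def scaleR_conv_of_real left_diff_distrib exp_diff exp_of_real)
  have "(\<lambda>r. complex_of_real r powr (z - 1) / complex_of_real (exp r)) absolutely_integrable_on {0<..}"
    by (rule absolutely_integrable_Gamma_integral'[OF z])
  then have a: "f absolutely_integrable_on {0<..}"
    by (rule set_integrable_cong[THEN iffD1, rotated -1]) (auto simp: fr)
  \<comment> \<open>Absolute integrability refers to the completed measure; Borel measurability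
    brings the statement back to \<open>lborel\<close>.\<close>
  have m: "(\<lambda>x. indicator {0<..} x *\<^sub>R f x) \<in> borel_measurable lborel" by measurable
  have si: "set_integrable lborel {0<..} f"
    using a integrable_completion[OF m] unfolding set_integrable_def by simp
  show ?I using integrable_exp_subst[of f] si by (simp add: e)
  have "(LINT r:{0<..}|lborel. f r) = integral {0<..} f"
    by (rule set_borel_integral_eq_integral(2)[OF si])
  also have "\<dots> = integral {0<..} (\<lambda>r. complex_of_real r powr (z - 1) / complex_of_real (exp r))"
    by (rule integral_cong) (rule fr)
  also have "\<dots> = Gamma z"
    by (rule integral_unique[OF Gamma_integral_complex'[OF z]])
  finally show ?E using integral_exp_subst[of f] by (simp add: e)
qed

lemma
  assumes z: "0 < Re z" and c: "0 < c"
  shows integrable_Gamma_log_scaled: "integrable lborel (\<lambda>y. exp (z * complex_of_real y) * complex_of_real (exp (- c * exp (2 * y))))" (is ?I)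
    and integral_Gamma_log_scaled: "(LINT y|lborel. exp (z * complex_of_real y) * complex_of_real (exp (- c * exp (2 * y))))
      = exp (- z * complex_of_real (ln c / 2)) * Gamma (z / 2) / 2" (is ?E)
proof -
  define f where "f y = exp (z * complex_of_real y) * complex_of_real (exp (- c * exp (2 * y)))" for y
  \<comment> \<open>The affine substitution carries c exp(2y) to exp(y) and so halves the argument
    of Gamma.\<close>
  have e: "f (- ln c / 2 + 1 / 2 * y) = exp (- z * complex_of_real (ln c / 2)) * (exp (z / 2 * complex_of_real y) * complex_of_real (exp (- exp y)))" for y
  proof -
    have "c * exp (2 * (- ln c / 2 + 1 / 2 * y)) = exp y"
      using c by (simp add: exp_diff)
    moreover have "exp (z * complex_of_real (- ln c / 2 + 1 / 2 * y)) = exp (- z * complex_of_real (ln c / 2)) * exp (z / 2 * complex_of_real y)"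
      by (simp add: exp_add[symmetric] algebra_simps)
    ultimately show ?thesis by (simp add: f_def mult.assoc)
  qed
  have z2: "0 < Re (z / 2)" using z by simp
  have i: "integrable lborel (\<lambda>y. f (- ln c / 2 + 1 / 2 * y))"
    unfolding e by (intro integrable_mult_right integrable_Gamma_log[OF z2])
  then show ?I using lborel_integrable_real_affine_iff[of "1 / 2" f "- ln c / 2"] by (simp add: f_def[abs_def])
  have "(LINT y|lborel. f y) = \<bar>1 / 2\<bar> *\<^sub>R (LINT y|lborel. f (- ln c / 2 + 1 / 2 * y))"
    by (rule lborel_integral_real_affine) simp
  also have "\<dots> = exp (- z * complex_of_real (ln c / 2)) * Gamma (z / 2) / 2"
    unfolding e integral_mult_right_zero integral_Gamma_log[OF z2] by (simp add: scaleR_conv_of_real)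
  finally show ?E by (simp add: f_def)
qed

subsubsection \<open>The sine kernel\<close>

lemma std_normal_density_le: "std_normal_density x \<le> 1 / (1 + x\<^sup>2 / 2)"
proof -
  have "1 + x\<^sup>2 / 2 \<le> exp (x\<^sup>2 / 2)" by (rule exp_ge_add_one_self)
  then have "exp (- x\<^sup>2 / 2) \<le> 1 / (1 + x\<^sup>2 / 2)"
    by (simp add: exp_minus inverse_eq_divide divide_le_cancel frac_le add_pos_nonneg)
  moreover have "1 / sqrt (2 * pi) \<le> 1" using pi_gt3 by (simp add: divide_le_eq_1)
  then have "1 / sqrt (2 * pi) * exp (- x\<^sup>2 / 2) \<le> 1 * exp (- x\<^sup>2 / 2)" by (intro mult_right_mono) auto
  ultimately show ?thesis unfolding std_normal_density_def by linarith
qed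

lemma std_normal_density_sin_tendsto_0: "((\<lambda>x. std_normal_density x * sin (t * x)) \<longlongrightarrow> 0) at_infinity"
proof (rule Lim_null_comparison)
  show "((\<lambda>x::real. norm (inverse x)) \<longlongrightarrow> 0) at_infinity"
    by (intro tendsto_norm_zero tendsto_inverse_0)
  show "\<forall>\<^sub>F x in at_infinity. norm (std_normal_density x * sin (t * x)) \<le> norm (inverse x)"
    unfolding eventually_at_infinity
  proof (intro exI allI impI)
    fix x :: real assume "1 \<le> norm x"
    then have x: "1 \<le> \<bar>x\<bar>" by simp
    have "0 \<le> (\<bar>x\<bar> - 1)\<^sup>2" by simp
    then have "\<bar>x\<bar> \<le> 1 + x\<^sup>2 / 2" by (simp add: power2_diff)
    then have "1 / (1 + x\<^sup>2 / 2) \<le> 1 / \<bar>x\<bar>" using x by (intro divide_left_mono) (auto simp: add_pos_nonneg)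
    then have "std_normal_density x \<le> 1 / \<bar>x\<bar>" using std_normal_density_le[of x] by linarith
    moreover have "norm (std_normal_density x * sin (t * x)) \<le> std_normal_density x * 1"
      unfolding norm_mult by (intro mult_mono) auto
    ultimately show "norm (std_normal_density x * sin (t * x)) \<le> norm (inverse x)"
      by (simp add: inverse_eq_divide)
  qed
qed

lemma integral_std_normal_cos: 
  "integrable lborel (\<lambda>x. std_normal_density x * cos (t * x))"
  "(LINT x|lborel. std_normal_density x * cos (t * x)) = exp (- t\<^sup>2 / 2)"
proof -
  have i: "integrable lborel (\<lambda>x. complex_of_real (std_normal_density x) * cis (t * x))"
    by (intro integrable_mult_cis) auto
  have e: "std_normal_density x * cos (t * x) = Re (complex_of_real (std_normal_density x) * cis (t * x))" for x
    by simp
  show "integrable lborel (\<lambda>x. std_normal_density x * cos (t * x))"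
    unfolding e by (rule integrable_Re[OF i])
  show "(LINT x|lborel. std_normal_density x * cos (t * x)) = exp (- t\<^sup>2 / 2)"
    unfolding e integral_Re[OF i] fourier_std_normal by simp
qed

text \<open>Integrate the derivative of \<open>std_normal_density x * sin (t * x)\<close> over the
  line. The boundary terms vanish, which expresses the sine moment through the cosine transform, the
  real part of the characteristic function.\<close>

lemma
  shows integrable_std_normal_sin: "integrable lborel (\<lambda>x. x * std_normal_density x * sin (t * x))"
    and integral_std_normal_sin: "(LINT x|lborel. x * std_normal_density x * sin (t * x)) = t * exp (- t\<^sup>2 / 2)"
proof -
  have m: "integrable lborel (\<lambda>x. std_normal_density x * \<bar>x\<bar> ^ 1)"
    by (rule integrable_std_normal_moment_abs)
  show i: "integrable lborel (\<lambda>x. x * std_normal_density x * sin (t * x))"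
  proof (rule Bochner_Integration.integrable_bound[OF m], simp, rule AE_I2)
    fix x :: real
    have "norm (x * std_normal_density x * sin (t * x)) = (std_normal_density x * \<bar>x\<bar>) * \<bar>sin (t * x)\<bar>"
      by (simp add: abs_mult)
    also have "\<dots> \<le> (std_normal_density x * \<bar>x\<bar>) * 1" by (intro mult_left_mono) auto
    finally show "norm (x * std_normal_density x * sin (t * x)) \<le> norm (std_normal_density x * \<bar>x\<bar> ^ 1)" by simp
  qed
  define K where "K = 1 / sqrt (2 * pi)"
  have K: "std_normal_density = (\<lambda>x. K * exp (- x\<^sup>2 / 2))" by (simp add: fun_eq_iff std_normal_density_def K_def)
  define F where "F x = std_normal_density x * sin (t * x)" for x
  define f where "f x = t * (std_normal_density x * cos (t * x)) - x * std_normal_density x * sin (t * x)" for x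
  have fi: "integrable lborel f"
    unfolding f_def[abs_def] using i integral_std_normal_cos(1)[of t] by simp
  have "(LBINT x=-\<infinity>..\<infinity>. f x) = 0 - 0"
  proof (rule interval_integral_FTC_integrable)
    fix x :: real
    show "(F has_vector_derivative f x) (at x)"
      unfolding has_real_derivative_iff_has_vector_derivative[symmetric] F_def[abs_def] f_def K
      by (auto intro!: derivative_eq_intros simp: field_simps)
    show "isCont f x"
      unfolding f_def[abs_def] K by (intro continuous_intros) auto
  next
    show "set_integrable lborel (einterval (-\<infinity>) \<infinity>) f"
      using fi by (simp add: set_integrable_def einterval_def)
    show "((F \<circ> real_of_ereal) \<longlongrightarrow> 0) (at_right (-\<infinity>))" "((F \<circ> real_of_ereal) \<longlongrightarrow> 0) (at_left \<infinity>)"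
      unfolding ereal_tendsto_simps F_def[abs_def]
      by (rule tendsto_mono[OF _ std_normal_density_sin_tendsto_0], simp add: at_top_le_at_infinity at_bot_le_at_infinity)+
  qed auto
  then have "(LINT x|lborel. f x) = 0"
    by (simp add: interval_lebesgue_integral_def set_lebesgue_integral_def einterval_def)
  then show "(LINT x|lborel. x * std_normal_density x * sin (t * x)) = t * exp (- t\<^sup>2 / 2)"
    using i integral_std_normal_cos[of t] unfolding f_def[abs_def] by simp
qed

text \<open>After u = e^y this is the preceding moment over a half-line. The integrand is even,
  which gives the factor 1/2; sqrt(2\<pi>) removes the normalisation of the density.\<close>

lemma integral_sin_gaussian_log:
  "(LINT y|lborel. sin (t * exp y) * exp (2 * y) * exp (- (1 / 2) * exp (2 * y))) = sqrt (2 * pi) / 2 * t * exp (- t\<^sup>2 / 2)"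
proof -
  define f where "f u = u * std_normal_density u * sin (t * u)" for u
  have [measurable]: "f \<in> borel_measurable borel" unfolding f_def[abs_def] by measurable
  have ev: "f (- u) = f u" for u by (simp add: f_def std_normal_density_def)
  have i: "integrable lborel f" unfolding f_def[abs_def] by (rule integrable_std_normal_sin)
  have si: "set_integrable lborel A f" if "A \<in> sets borel" for A
    unfolding set_integrable_def by (rule integrable_mult_indicator) (use i that in auto)
  have half: "(LINT u:{0<..}|lborel. f u) = (LINT u|lborel. f u) / 2"
  proof -
    have neg: "(LINT u:{..<0}|lborel. f u) = (LINT u:{0<..}|lborel. f u)"
    proof -
      have "(LINT u:{..<0}|lborel. f u) = (LINT u|lborel. indicator {..<0} (0 + (- 1) * u) *\<^sub>R f (0 + (- 1) * u))"
        unfolding set_lebesgue_integral_def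
        using lborel_integral_real_affine[of "-1" "\<lambda>u. indicator {..<0} u *\<^sub>R f u" 0] by simp
      also have "\<dots> = (LINT u:{0<..}|lborel. f u)"
        unfolding set_lebesgue_integral_def by (intro Bochner_Integration.integral_cong refl) (auto simp: ev indicator_def)
      finally show ?thesis .
    qed
    have "(LINT u|lborel. f u) = (LINT u:({..<0} \<union> {0<..})|lborel. f u)"
      unfolding set_lebesgue_integral_def
    proof (rule integral_cong_AE)
      have "AE u in lborel. u \<noteq> (0::real)" by (rule AE_lborel_singleton)
      then show "AE u in lborel. f u = indicator ({..<0} \<union> {0<..}) u *\<^sub>R f u"
        by eventually_elim (auto simp: indicator_def)
    qed auto
    also have "\<dots> = (LINT u:{..<0}|lborel. f u) + (LINT u:{0<..}|lborel. f u)"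
      by (rule set_integral_Un) (auto intro!: si)
    finally show ?thesis using neg by simp
  qed
  have e: "exp y *\<^sub>R f (exp y) = (1 / sqrt (2 * pi)) * (sin (t * exp y) * exp (2 * y) * exp (- (1 / 2) * exp (2 * y)))" for y
    by (simp add: f_def std_normal_density_def exp_double power2_eq_square)
  have "(1 / sqrt (2 * pi)) * (LINT y|lborel. sin (t * exp y) * exp (2 * y) * exp (- (1 / 2) * exp (2 * y))) = (LINT u|lborel. f u) / 2"
    using integral_exp_subst[of f] half unfolding e by simp
  also have "(LINT u|lborel. f u) = t * exp (- t\<^sup>2 / 2)"
    unfolding f_def by (rule integral_std_normal_sin)
  finally show ?thesis by (simp add: field_simps)
qed

text \<open>
  The transform of each kernel is found by correlating it with a test function \<open>P\<close> for which both the
  correlation and the transform of \<open>P\<close> are explicit: a Gaussian for the sine kernel, since the sine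
  transform of \<open>u e^{-u\<^sup>2/2}\<close> is a multiple of itself, and an exponential for the Riesz kernel.
\<close>

definition sine_kernel :: "real \<Rightarrow> real \<Rightarrow> real" where
  "sine_kernel \<alpha> y = sin (2 * pi * exp y) * exp (- \<alpha> * y)"

lemma borel_measurable_sine_kernel [measurable]: "sine_kernel \<alpha> \<in> borel_measurable borel"
  unfolding sine_kernel_def[abs_def] by measurable

lemma integrable_exp_neg_abs:
  assumes c: "0 < (c::real)"
  shows "integrable lborel (\<lambda>y::real. exp (- c * \<bar>y\<bar>))"
proof (rule Bochner_Integration.integrable_bound)
  \<comment> \<open>Taken so that m(1 + y^2) stays below 1 + c^2 y^2/2, part of the exponential
    series of c|y|.\<close>
  define m where "m = min 1 (c\<^sup>2 / 2)"
  have m: "0 < m" using c by (simp add: m_def)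
  show "integrable lborel (\<lambda>y::real. (1 / m) * inverse (1 + y\<^sup>2))"
    by (intro integrable_mult_right integrable_inverse_one_plus_square)
  show "AE y in lborel. norm (exp (- c * \<bar>y\<bar>)) \<le> norm ((1 / m) * inverse (1 + y\<^sup>2))"
  proof (rule AE_I2)
    fix y :: real
    have "m * (1 + y\<^sup>2) = m * 1 + m * y\<^sup>2" by (simp add: distrib_left)
    also have "\<dots> \<le> 1 + c\<^sup>2 / 2 * y\<^sup>2" by (intro add_mono mult_right_mono) (auto simp: m_def)
    also have "\<dots> \<le> 1 + c * \<bar>y\<bar> + (c * \<bar>y\<bar>)\<^sup>2 / 2" using c by (simp add: power_mult_distrib)
    also have "\<dots> \<le> exp (c * \<bar>y\<bar>)" using c by (intro exp_lower_Taylor_quadratic) auto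
    finally have "inverse (exp (c * \<bar>y\<bar>)) \<le> inverse (m * (1 + y\<^sup>2))"
      using m by (intro le_imp_inverse_le mult_pos_pos) auto
    then show "norm (exp (- c * \<bar>y\<bar>)) \<le> norm ((1 / m) * inverse (1 + y\<^sup>2))"
      using m by (simp add: exp_minus inverse_eq_divide abs_of_pos)
  qed
qed simp

text \<open>For y \<ge> 0 the sine is bounded and the decay is exp(-\<alpha>y); for y < 0, |sin u|
  \<le> |u| gains a factor e^y and the decay is exp((1-\<alpha>)y). Both ends of the range of
  \<alpha> enter here.\<close>

lemma integrable_sine_kernel:
  assumes "0 < \<alpha>" "\<alpha> < 1"
  shows "integrable lborel (sine_kernel \<alpha>)"
proof (rule Bochner_Integration.integrable_bound)
  define c where "c = min \<alpha> (1 - \<alpha>)"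
  have c: "0 < c" using assms by (simp add: c_def)
  show "integrable lborel (\<lambda>y. (2 * pi) * exp (- c * \<bar>y\<bar>))"
    by (intro integrable_mult_right integrable_exp_neg_abs c)
  show "AE y in lborel. norm (sine_kernel \<alpha> y) \<le> norm ((2 * pi) * exp (- c * \<bar>y\<bar>))"
  proof (rule AE_I2)
    fix y :: real
    show "norm (sine_kernel \<alpha> y) \<le> norm ((2 * pi) * exp (- c * \<bar>y\<bar>))"
    proof (cases "0 \<le> y")
      case True
      have "\<bar>sin (2 * pi * exp y)\<bar> * exp (- \<alpha> * y) \<le> (2 * pi) * exp (- c * \<bar>y\<bar>)"
      proof (intro mult_mono)
        show "\<bar>sin (2 * pi * exp y)\<bar> \<le> 2 * pi" using pi_gt3 abs_sin_le_one[of "2 * pi * exp y"] by linarith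
        have "c * \<bar>y\<bar> \<le> \<alpha> * y" using True by (auto simp: c_def intro: mult_right_mono)
        then show "exp (- \<alpha> * y) \<le> exp (- c * \<bar>y\<bar>)" by simp
      qed auto
      then show ?thesis by (simp add: sine_kernel_def abs_mult)
    next
      case False
      have "\<bar>sin (2 * pi * exp y)\<bar> * exp (- \<alpha> * y) \<le> (2 * pi * exp y) * exp (- \<alpha> * y)"
        by (intro mult_right_mono order_trans[OF abs_sin_x_le_abs_x]) auto
      also have "\<dots> = (2 * pi) * exp ((1 - \<alpha>) * y)"
        by (simp add: exp_add[symmetric] left_diff_distrib)
      also have "\<dots> \<le> (2 * pi) * exp (- c * \<bar>y\<bar>)"
      proof -
        have "(1 - \<alpha>) * y \<le> c * y" using False by (intro mult_right_mono_neg) (auto simp: c_def)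
        then show ?thesis using False by (simp add: abs_if)
      qed
      finally show ?thesis by (simp add: sine_kernel_def abs_mult)
    qed
  qed
qed simp

lemma exp_mult_cis: "complex_of_real (exp (a * y)) * cis (l * y) = exp (Complex a l * complex_of_real y)"
proof -
  have "Complex a l * complex_of_real y = complex_of_real (a * y) + \<i> * complex_of_real (l * y)"
    by (simp add: complex_eq_iff)
  then show ?thesis by (simp only: exp_add cis_conv_exp exp_of_real)
qed

text \<open>The correlation with \<open>P\<close> is a multiple of exp((1-\<alpha>)y) exp(-2\<pi>^2
  exp(2y)), so its transform and that of \<open>P\<close> are Gamma values at half arguments, up to
  elementary factors.\<close>

lemma cmod_mellin_sine_kernel:
  assumes "0 < \<alpha>" "\<alpha> < 1"
  shows "\<exists>C>0. \<forall>l. cmod (mellin (sine_kernel \<alpha>) l) = C * (cmod (Gamma (Complex ((1 - \<alpha>) / 2) (l / 2))) / cmod (Gamma (Complex ((\<alpha> + 2) / 2) (- l / 2))))"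
proof -
  \<comment> \<open>The exponent \<alpha> + 2 cancels exp(-\<alpha>\<eta>) from the kernel and
    leaves the exp(2\<eta>) that occurs in \<open>integral_sin_gaussian_log\<close>.\<close>
  define P where "P y = exp ((\<alpha> + 2) * y) * exp (- (1 / 2) * exp (2 * y))" for y :: real
  have Pe: "complex_of_real (P y) * cis (l * y) = exp (Complex (\<alpha> + 2) l * complex_of_real y) * complex_of_real (exp (- (1 / 2) * exp (2 * y)))" for l y
    unfolding P_def exp_mult_cis[symmetric] by (simp add: mult_ac)
  have "integrable lborel (\<lambda>y. complex_of_real (P y) * cis (0 * y))"
    unfolding Pe by (rule integrable_Gamma_log_scaled) (use assms in auto)
  then have P: "integrable lborel P" by (simp add: complex_of_real_integrable_eq)
  have mP: "mellin P l = exp (- Complex (\<alpha> + 2) l * complex_of_real (ln (1 / 2) / 2)) * Gamma (Complex (\<alpha> + 2) l / 2) / 2" for l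
    unfolding mellin_def Pe by (rule integral_Gamma_log_scaled) (use assms in auto)
  have conv: "(LINT \<eta>|lborel. sine_kernel \<alpha> (y + \<eta>) * P \<eta>) = sqrt (2 * pi) * pi * (exp ((1 - \<alpha>) * y) * exp (- (2 * pi\<^sup>2) * exp (2 * y)))" for y
  proof -
    have "(LINT \<eta>|lborel. sine_kernel \<alpha> (y + \<eta>) * P \<eta>) = (LINT \<eta>|lborel. exp (- \<alpha> * y) * (sin ((2 * pi * exp y) * exp \<eta>) * exp (2 * \<eta>) * exp (- (1 / 2) * exp (2 * \<eta>))))"
    proof (intro Bochner_Integration.integral_cong refl)
      fix \<eta> :: real
      have "exp (- \<alpha> * (y + \<eta>)) * exp ((\<alpha> + 2) * \<eta>) = exp (- \<alpha> * y) * exp (2 * \<eta>)"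
        by (simp add: exp_add[symmetric] algebra_simps)
      note E = this
      have "sine_kernel \<alpha> (y + \<eta>) * P \<eta> = sin (2 * pi * exp (y + \<eta>)) * (exp (- \<alpha> * (y + \<eta>)) * exp ((\<alpha> + 2) * \<eta>)) * exp (- (1 / 2) * exp (2 * \<eta>))"
        by (simp only: sine_kernel_def P_def mult.assoc)
      then show "sine_kernel \<alpha> (y + \<eta>) * P \<eta> = exp (- \<alpha> * y) * (sin ((2 * pi * exp y) * exp \<eta>) * exp (2 * \<eta>) * exp (- (1 / 2) * exp (2 * \<eta>)))"
        unfolding E exp_add by (simp only: mult_ac)
    qed
    also have "\<dots> = exp (- \<alpha> * y) * (sqrt (2 * pi) / 2 * (2 * pi * exp y) * exp (- (2 * pi * exp y)\<^sup>2 / 2))"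
      unfolding integral_mult_right_zero integral_sin_gaussian_log ..
    also have "\<dots> = sqrt (2 * pi) * pi * (exp ((1 - \<alpha>) * y) * exp (- (2 * pi\<^sup>2) * exp (2 * y)))"
    proof -
      have "- (2 * pi * exp y)\<^sup>2 / 2 = - (2 * pi\<^sup>2) * exp (2 * y)"
        by (simp add: power_mult_distrib exp_double)
      moreover have "exp (- \<alpha> * y) * exp y = exp ((1 - \<alpha>) * y)"
        by (simp add: exp_add[symmetric] algebra_simps)
      ultimately show ?thesis by (simp add: mult_ac)
    qed
    finally show ?thesis .
  qed
  have K: "integrable lborel (sine_kernel \<alpha>)" by (rule integrable_sine_kernel[OF assms])
  \<comment> \<open>\<open>A\<close> and \<open>B\<close> collect the moduli of the elementary
    factors; the modulus of exp(-zc) with c real depends on Re z alone, so neither depends on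
    \<open>l\<close>.\<close>
  define A where "A = sqrt (2 * pi) * pi * exp (- (1 - \<alpha>) * (ln (2 * pi\<^sup>2) / 2)) / 2"
  define B where "B = exp (- (\<alpha> + 2) * (ln (1 / 2) / 2)) / 2"
  have AB: "0 < A" "0 < B" by (simp_all add: A_def B_def)
  have re: "Re (- Complex a l * complex_of_real c) = - a * c" for a l c by simp
  have half: "Complex a l / 2 = Complex (a / 2) (l / 2)" for a l by (simp add: complex_eq_iff)
  have "cmod (mellin (sine_kernel \<alpha>) l) = A / B * (cmod (Gamma (Complex ((1 - \<alpha>) / 2) (l / 2))) / cmod (Gamma (Complex ((\<alpha> + 2) / 2) (- l / 2))))" for l
  proof -
    have "mellin (sine_kernel \<alpha>) l * mellin P (- l) = (LINT y|lborel. complex_of_real (sqrt (2 * pi) * pi) * (exp (Complex (1 - \<alpha>) l * complex_of_real y) * complex_of_real (exp (- (2 * pi\<^sup>2) * exp (2 * y)))))"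
      unfolding mellin_correlation[OF K P, symmetric] conv exp_mult_cis[symmetric]
      by (intro Bochner_Integration.integral_cong refl) (simp only: of_real_mult mult_ac)
    also have "\<dots> = complex_of_real (sqrt (2 * pi) * pi) * (exp (- Complex (1 - \<alpha>) l * complex_of_real (ln (2 * pi\<^sup>2) / 2)) * Gamma (Complex (1 - \<alpha>) l / 2) / 2)"
      unfolding integral_mult_right_zero by (subst integral_Gamma_log_scaled) (use assms in auto)
    finally have "cmod (mellin (sine_kernel \<alpha>) l) * cmod (mellin P (- l)) = cmod (complex_of_real (sqrt (2 * pi) * pi) * (exp (- Complex (1 - \<alpha>) l * complex_of_real (ln (2 * pi\<^sup>2) / 2)) * Gamma (Complex (1 - \<alpha>) l / 2) / 2))"
      by (simp only: norm_mult[symmetric])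
    also have "\<dots> = A * cmod (Gamma (Complex ((1 - \<alpha>) / 2) (l / 2)))"
      unfolding half norm_mult norm_divide norm_exp_eq_Re norm_of_real A_def re by simp
    finally have "cmod (mellin (sine_kernel \<alpha>) l) * cmod (mellin P (- l)) = A * cmod (Gamma (Complex ((1 - \<alpha>) / 2) (l / 2)))" .
    moreover have "cmod (mellin P (- l)) = B * cmod (Gamma (Complex ((\<alpha> + 2) / 2) (- l / 2)))"
      unfolding mP half norm_mult norm_divide norm_exp_eq_Re norm_of_real B_def re by simp
    moreover have "0 < cmod (Gamma (Complex ((\<alpha> + 2) / 2) (- l / 2)))"
      using assms by (intro cmod_Gamma_pos) auto
    ultimately show ?thesis using AB by (simp add: field_simps)
  qed
  then show ?thesis using AB by (intro exI[of _ "A / B"]) auto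
qed

subsubsection \<open>The kernel of the Riesz means\<close>

text \<open>The Riesz weight as a function of y = ln(|\<xi>|/R). The truncation |\<xi>| \<le> R has
  become y < 0.\<close>

definition beta_kernel :: "real \<Rightarrow> real \<Rightarrow> real" where
  "beta_kernel \<beta> y = (if y < 0 then \<beta> * exp y * (1 - exp y) powr (\<beta> - 1) else 0)"

lemma borel_measurable_beta_kernel [measurable]: "beta_kernel \<beta> \<in> borel_measurable borel"
  unfolding beta_kernel_def[abs_def] by measurable

text \<open>In u = e^y the integral is \<beta> times the Beta integral with parameters 1 and
  \<beta>; the singularity at u = 1 is integrable because \<beta> > 0.\<close>

lemma integrable_beta_kernel:
  assumes b: "0 < \<beta>"
  shows "integrable lborel (beta_kernel \<beta>)"
proof -
  define f where "f u = (if u < 1 then \<beta> * (1 - u) powr (\<beta> - 1) else 0)" for u :: real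
  have [measurable]: "f \<in> borel_measurable borel" unfolding f_def[abs_def] by measurable
  have e: "exp y *\<^sub>R f (exp y) = beta_kernel \<beta> y" for y by (simp add: f_def beta_kernel_def)
  have "set_integrable lborel {0..1} (\<lambda>t. t powr (1 - 1) * (1 - t) powr (\<beta> - 1))"
    by (rule integrable_Beta) (use b in auto)
  then have "integrable lborel (\<lambda>t. \<beta> * (indicator {0..1} t *\<^sub>R (t powr (1 - 1) * (1 - t) powr (\<beta> - 1))))"
    unfolding set_integrable_def by (rule integrable_mult_right)
  then have "set_integrable lborel {0<..} f"
    unfolding set_integrable_def
  proof (rule Bochner_Integration.integrable_bound)
    show "AE x in lborel. norm (indicator {0<..} x *\<^sub>R f x) \<le> norm (\<beta> * (indicator {0..1} x *\<^sub>R (x powr (1 - 1) * (1 - x) powr (\<beta> - 1))))"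
      by (intro AE_I2) (auto simp: f_def indicator_def)
  qed simp
  then show ?thesis using integrable_exp_subst[of f] unfolding e by simp
qed

text \<open>Correlating with \<open>P\<close> is a fractional integral of the exponential, and
  e^(-r) is reproduced by such integrals up to the factor Gamma(\<beta>).\<close>

lemma cmod_mellin_beta_kernel:
  assumes b: "0 < \<beta>"
  shows "\<exists>C>0. \<forall>l. cmod (mellin (beta_kernel \<beta>) l) = C * (cmod (Gamma (Complex 1 l)) / cmod (Gamma (Complex (\<beta> + 1) l)))"
proof -
  \<comment> \<open>In r = e^(-y) this is r^(\<beta>+1) e^(-r). The power is the one that cancels
    the powers of r produced by (e^y/r)(1 - e^y/r)^(\<beta>-1) and the measure dr/r.\<close>
  define P where "P y = exp (- ((\<beta> + 1) * y)) * exp (- exp (- y))" for y :: real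
  have Pe: "complex_of_real (P (- y)) * cis (l * y) = exp (Complex (\<beta> + 1) l * complex_of_real y) * complex_of_real (exp (- exp y))" for l y
    unfolding P_def exp_mult_cis[symmetric] by (simp add: mult_ac)
  have "integrable lborel (\<lambda>y. complex_of_real (P (- y)) * cis (0 * y))"
    unfolding Pe by (rule integrable_Gamma_log) (use assms in auto)
  then have "integrable lborel (\<lambda>y. P (0 + (- 1) * y))" by (simp add: complex_of_real_integrable_eq)
  then have P: "integrable lborel P" by (subst (asm) lborel_integrable_real_affine_iff) auto
  have mP: "mellin P (- l) = Gamma (Complex (\<beta> + 1) l)" for l
  proof -
    have "mellin P (- l) = (LINT y|lborel. complex_of_real (P (- y)) * cis (l * y))"
      unfolding mellin_def using lborel_integral_real_affine[of "-1" "\<lambda>y. complex_of_real (P y) * cis (- l * y)" 0] by simp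
    then show ?thesis unfolding Pe by (subst (asm) integral_Gamma_log) (use assms in auto)
  qed
  have conv: "(LINT \<eta>|lborel. beta_kernel \<beta> (y + \<eta>) * P \<eta>) = \<beta> * Gamma \<beta> * (exp (1 * y) * exp (- exp y))" for y
  proof -
    define f where "f r = beta_kernel \<beta> (y - ln r) * exp (\<beta> * ln r) * exp (- r)" for r
    have [measurable]: "f \<in> borel_measurable borel" unfolding f_def[abs_def] by measurable
    have "(LINT \<eta>|lborel. beta_kernel \<beta> (y + \<eta>) * P \<eta>) = (LINT \<eta>|lborel. beta_kernel \<beta> (y - \<eta>) * P (- \<eta>))"
      using lborel_integral_real_affine[of "-1" "\<lambda>\<eta>. beta_kernel \<beta> (y + \<eta>) * P \<eta>" 0] by simp
    also have "\<dots> = (LINT \<eta>|lborel. exp \<eta> *\<^sub>R f (exp \<eta>))"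
    proof (intro Bochner_Integration.integral_cong refl)
      fix \<eta> :: real
      have "exp ((\<beta> + 1) * \<eta>) = exp \<eta> * exp (\<beta> * \<eta>)" by (simp add: exp_add[symmetric] algebra_simps)
      then show "beta_kernel \<beta> (y - \<eta>) * P (- \<eta>) = exp \<eta> *\<^sub>R f (exp \<eta>)" by (simp add: f_def P_def)
    qed
    also have "\<dots> = (LINT r:{0<..}|lborel. f r)" by (rule integral_exp_subst) measurable
    \<comment> \<open>The shift r = e^y + v moves the threshold of the kernel to v = 0; what remains
      is v^(\<beta>-1) e^(-v), the integrand of Gamma(\<beta>). For v < 0 the kernel
      vanishes.\<close>
    also have "\<dots> = (LINT r|lborel. indicator {0<..} (exp y + 1 * r) *\<^sub>R f (exp y + 1 * r))"
      unfolding set_lebesgue_integral_def using lborel_integral_real_affine[of 1 "\<lambda>r. indicator {0<..} r *\<^sub>R f r" "exp y"] by simp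
    also have "\<dots> = (LINT v|lborel. (\<beta> * (exp y * exp (- exp y))) * (indicator {0..} v *\<^sub>R (v powr (\<beta> - 1) / exp v)))"
    proof (rule integral_cong_AE)
      have "AE v in lborel. v \<noteq> (0::real)" by (rule AE_lborel_singleton)
      then show "AE v in lborel. indicator {0<..} (exp y + 1 * v) *\<^sub>R f (exp y + 1 * v) = (\<beta> * (exp y * exp (- exp y))) * (indicator {0..} v *\<^sub>R (v powr (\<beta> - 1) / exp v))"
      proof eventually_elim
        case (elim v)
        show ?case
        proof (cases "0 < v")
          case True
          define r where "r = exp y + v"
          have r: "0 < r" "exp y < r" using True by (auto simp: r_def add_pos_pos)
          have "y < ln r" using r by (metis exp_less_cancel_iff exp_ln)
          have "exp (y - ln r) = exp y / r" using r by (simp add: exp_diff)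
          moreover have "1 - exp y / r = v / r" using r by (simp add: r_def field_simps)
          moreover have "exp (\<beta> * ln r) = r powr \<beta>" using r by (simp add: powr_def)
          moreover have "(v / r) powr (\<beta> - 1) = v powr (\<beta> - 1) / (r powr \<beta> / r)"
            using r True by (simp add: powr_divide powr_diff)
          ultimately have "f r = (\<beta> * (exp y * exp (- r))) * v powr (\<beta> - 1)"
            using \<open>y < ln r\<close> r by (simp add: f_def beta_kernel_def)
          moreover have "exp (- r) = exp (- exp y - v)" by (rule arg_cong[where f = exp]) (simp add: r_def)
          then have "exp (- r) = exp (- exp y) / exp v" by (simp only: exp_diff)
          ultimately show ?thesis using True r(1) by (simp add: r_def[symmetric] indicator_def)
        next
          case False
          then have v: "v < 0" using elim by simp
          show ?thesis
          proof (cases "0 < exp y + v")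
            case True
            have "ln (exp y + v) < ln (exp y)" using v True by (subst ln_less_cancel_iff) auto
            then show ?thesis using v by (simp add: f_def beta_kernel_def)
          qed (use v in simp)
        qed
      qed
    qed auto
    also have "\<dots> = (\<beta> * (exp y * exp (- exp y))) * (LINT v:{0..}|lborel. v powr (\<beta> - 1) / exp v)"
      unfolding set_lebesgue_integral_def by (rule integral_mult_right_zero)
    also have "(LINT v:{0..}|lborel. v powr (\<beta> - 1) / exp v) = Gamma \<beta>"
    proof -
      have "(\<integral>\<^sup>+v. ennreal (indicator {0..} v *\<^sub>R (v powr (\<beta> - 1) / exp v)) \<partial>lborel) = ennreal (Gamma \<beta>)"
        using Gamma_conv_nn_integral_real[OF b] by simp
      then show ?thesis
        unfolding set_lebesgue_integral_def using Gamma_real_pos[OF b]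
        by (subst integral_eq_nn_integral) auto
    qed
    finally show ?thesis by simp
  qed
  have K: "integrable lborel (beta_kernel \<beta>)" by (rule integrable_beta_kernel[OF assms])
  have "cmod (mellin (beta_kernel \<beta>) l) = \<beta> * Gamma \<beta> * (cmod (Gamma (Complex 1 l)) / cmod (Gamma (Complex (\<beta> + 1) l)))" for l
  proof -
    have "mellin (beta_kernel \<beta>) l * mellin P (- l) = (LINT y|lborel. complex_of_real (\<beta> * Gamma \<beta>) * (exp (Complex 1 l * complex_of_real y) * complex_of_real (exp (- exp y))))"
      unfolding mellin_correlation[OF K P, symmetric] conv exp_mult_cis[symmetric]
      by (intro Bochner_Integration.integral_cong refl) (simp only: of_real_mult mult_ac)
    also have "\<dots> = complex_of_real (\<beta> * Gamma \<beta>) * Gamma (Complex 1 l)"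
      unfolding integral_mult_right_zero by (subst integral_Gamma_log) auto
    finally have "cmod (mellin (beta_kernel \<beta>) l) * cmod (Gamma (Complex (\<beta> + 1) l)) = \<beta> * Gamma \<beta> * cmod (Gamma (Complex 1 l))"
      unfolding norm_mult[symmetric] mP using b Gamma_real_pos[OF b] by (simp add: norm_mult)
    moreover have "0 < cmod (Gamma (Complex (\<beta> + 1) l))"
      using assms by (intro cmod_Gamma_pos) auto
    ultimately show ?thesis by (simp add: field_simps)
  qed
  then show ?thesis using b Gamma_real_pos[OF b] by (intro exI[of _ "\<beta> * Gamma \<beta>"]) auto
qed

section \<open>The common order of the two transforms\<close>

lemma cmod_Gamma_uminus: "cmod (Gamma (Complex a (- m))) = cmod (Gamma (Complex a m))"
proof -
  have "Complex a (- m) = cnj (Complex a m)" by (simp add: complex_eq_iff)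
  then show ?thesis by (metis cnj_Gamma complex_mod_cnj)
qed

lemma mellin_sine_kernel_bigtheta:
  assumes "0 < \<alpha>" "\<alpha> < 1"
  shows "(\<lambda>l. cmod (mellin (sine_kernel \<alpha>) l)) \<in> \<Theta>[top](\<lambda>l. (1 + l\<^sup>2) powr (- (1 / 2 + \<alpha>) / 2))"
proof -
  obtain C where C: "0 < C" "\<And>l. cmod (mellin (sine_kernel \<alpha>) l) = C * (cmod (Gamma (Complex ((1 - \<alpha>) / 2) (l / 2))) / cmod (Gamma (Complex ((\<alpha> + 2) / 2) (- l / 2))))"
    using cmod_mellin_sine_kernel[OF assms] by blast
  have "gamma_ratio_order ((\<alpha> + 2) / 2) ((1 - \<alpha>) / 2)"
    by (rule gamma_ratio_order) (use assms in auto)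
  then have "(\<lambda>\<mu>. cmod (Gamma (Complex ((1 - \<alpha>) / 2) \<mu>)) / cmod (Gamma (Complex ((\<alpha> + 2) / 2) \<mu>))) \<in> \<Theta>[top](\<lambda>\<mu>. (1 + \<mu>\<^sup>2) powr (((1 - \<alpha>) / 2 - (\<alpha> + 2) / 2) / 2))"
    by (simp only: gamma_ratio_order_def)
  from landau_theta.compose[OF this, of "\<lambda>l. l / 2" top]
  have "(\<lambda>l. cmod (Gamma (Complex ((1 - \<alpha>) / 2) (l / 2))) / cmod (Gamma (Complex ((\<alpha> + 2) / 2) (l / 2)))) \<in> \<Theta>[top](\<lambda>l. (1 + (l / 2)\<^sup>2) powr (((1 - \<alpha>) / 2 - (\<alpha> + 2) / 2) / 2))"
    by (simp add: filterlim_top)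
  \<comment> \<open>The real parts of the two Gamma arguments differ by 1/2 + \<alpha>; this is
    where the value of \<beta> originates.\<close>
  also have "((1 - \<alpha>) / 2 - (\<alpha> + 2) / 2) / 2 = - (1 / 2 + \<alpha>) / 2" by (simp add: field_simps)
  also have "(\<lambda>l::real. (1 + (l / 2)\<^sup>2) powr (- (1 / 2 + \<alpha>) / 2)) \<in> \<Theta>[top](\<lambda>l. (1 + l\<^sup>2) powr (- (1 / 2 + \<alpha>) / 2))"
    by (rule bigtheta_top_powr) (use one_plus_square_scale_bigtheta[of 4] one_plus_square_pos'(1)[of _ 2] one_plus_square_pos'(2) in \<open>auto simp: power_divide\<close>)
  finally show ?thesis
    using C(1) unfolding C(2) minus_divide_left[symmetric] cmod_Gamma_uminus by (subst landau_theta.cmult_in_iff) simp_all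
qed

lemma mellin_beta_kernel_bigtheta:
  assumes "0 < \<beta>"
  shows "(\<lambda>l. cmod (mellin (beta_kernel \<beta>) l)) \<in> \<Theta>[top](\<lambda>l. (1 + l\<^sup>2) powr (- \<beta> / 2))"
proof -
  obtain C where C: "0 < C" "\<And>l. cmod (mellin (beta_kernel \<beta>) l) = C * (cmod (Gamma (Complex 1 l)) / cmod (Gamma (Complex (\<beta> + 1) l)))"
    using cmod_mellin_beta_kernel[OF assms] by blast
  have "gamma_ratio_order (\<beta> + 1) 1"
    by (rule gamma_ratio_order) (use assms in auto)
  then show ?thesis
    using C(1) unfolding C(2) by (subst landau_theta.cmult_in_iff) (simp_all add: gamma_ratio_order_def)
qed

text \<open>For \<beta> = 1/2 + \<alpha> the orders coincide, and since \<Theta> under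
  \<open>top\<close> has no exceptional frequencies, its two halves are the two
  inequalities.\<close>

lemma mellin_kernels_comparable:
  assumes "0 < \<alpha>" "\<alpha> < 1"
  shows "\<exists>c>0. \<exists>C>0. \<forall>l. c * cmod (mellin (sine_kernel \<alpha>) l) \<le> cmod (mellin (beta_kernel (1 / 2 + \<alpha>)) l)
     \<and> cmod (mellin (beta_kernel (1 / 2 + \<alpha>)) l) \<le> C * cmod (mellin (sine_kernel \<alpha>) l)"
proof -
  have "(\<lambda>l. cmod (mellin (beta_kernel (1 / 2 + \<alpha>)) l)) \<in> \<Theta>[top](\<lambda>l. (1 + l\<^sup>2) powr (- (1 / 2 + \<alpha>) / 2))"
    by (rule mellin_beta_kernel_bigtheta) (use assms in auto)
  from landau_theta.bigtheta_trans1'[OF this mellin_sine_kernel_bigtheta[OF assms]]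
  have T: "(\<lambda>l. cmod (mellin (beta_kernel (1 / 2 + \<alpha>)) l)) \<in> \<Theta>[top](\<lambda>l. cmod (mellin (sine_kernel \<alpha>) l))" .
  from landau_o.bigE[OF bigthetaD1[OF T]] obtain C where C: "0 < C" "\<And>l. cmod (mellin (beta_kernel (1 / 2 + \<alpha>)) l) \<le> C * cmod (mellin (sine_kernel \<alpha>) l)"
    by auto
  from landau_omega.bigE[OF bigthetaD2[OF T]] obtain c where c: "0 < c" "\<And>l. c * cmod (mellin (sine_kernel \<alpha>) l) \<le> cmod (mellin (beta_kernel (1 / 2 + \<alpha>)) l)"
    by auto
  show ?thesis using C c by blast
qed

subsection \<open>The square function of a product kernel\<close>

lemma
  fixes f :: "real \<Rightarrow> real"
  assumes [measurable]: "f \<in> borel_measurable borel" and i: "integrable lborel (\<lambda>y. exp y * f (exp y))"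
  shows integrable_even_exp_subst: "integrable lborel (\<lambda>u. f \<bar>u\<bar>)" (is ?I)
    and integral_even_exp_subst: "(LINT u|lborel. f \<bar>u\<bar>) = 2 * (LINT y|lborel. exp y * f (exp y))" (is ?E)
proof -
  have p: "set_integrable lborel {0<..} f"
    using i integrable_exp_subst[of f] by simp
  have pi: "integrable lborel (\<lambda>u. indicator {0<..} u *\<^sub>R f u)"
    using p by (simp add: set_integrable_def)
  from lborel_integrable_real_affine[OF pi, of "-1" 0]
  have ni: "integrable lborel (\<lambda>u. indicator {0<..} (- u) *\<^sub>R f (- u))" by simp
  have ae: "AE u in lborel. indicator {0<..} u *\<^sub>R f u + indicator {0<..} (- u) *\<^sub>R f (- u) = f \<bar>u\<bar>"
  proof -
    have "AE u in lborel. u \<noteq> (0::real)" by (rule AE_lborel_singleton)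
    then show ?thesis by eventually_elim (auto simp: indicator_def abs_if)
  qed
  have s: "integrable lborel (\<lambda>u. indicator {0<..} u *\<^sub>R f u + indicator {0<..} (- u) *\<^sub>R f (- u))"
    by (rule Bochner_Integration.integrable_add[OF pi ni])
  show ?I by (rule integrable_cong_AE_imp[OF s _ ae]) measurable
  have "(LINT u|lborel. f \<bar>u\<bar>) = (LINT u|lborel. indicator {0<..} u *\<^sub>R f u + indicator {0<..} (- u) *\<^sub>R f (- u))"
    by (rule integral_cong_AE[OF _ _ AE_symmetric[OF ae]]) measurable
  also have "\<dots> = (LINT u|lborel. indicator {0<..} u *\<^sub>R f u) + (LINT u|lborel. indicator {0<..} (- u) *\<^sub>R f (- u))"
    by (rule Bochner_Integration.integral_add[OF pi ni])
  also have "(LINT u|lborel. indicator {0<..} (- u) *\<^sub>R f (- u)) = (LINT u|lborel. indicator {0<..} u *\<^sub>R f u)"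
    using lborel_integral_real_affine[of "-1" "\<lambda>u. indicator {0<..} u *\<^sub>R f u" 0] by simp
  also have "(LINT u|lborel. indicator {0<..} u *\<^sub>R f u) = (LINT y|lborel. exp y * f (exp y))"
    using integral_exp_subst[of f] by (simp add: set_lebesgue_integral_def)
  finally show ?E by simp
qed

text \<open>The bound does not involve the shift \<open>t\<close>. In logarithmic coordinates the
  Cauchy weight and the Jacobian together are bounded, and translation invariance removes
  \<open>t\<close>; this makes \<open>product_operator\<close> a bounded function.\<close>

lemma
  fixes K :: "real \<Rightarrow> real"
  assumes K: "integrable lborel K"
  shows integrable_kernel_weight: "integrable lborel (\<lambda>u. \<bar>K (t + ln \<bar>u\<bar>)\<bar> * inverse (1 + u\<^sup>2))" (is ?I)
    and integral_kernel_weight_le: "(LINT u|lborel. \<bar>K (t + ln \<bar>u\<bar>)\<bar> * inverse (1 + u\<^sup>2)) \<le> (LINT y|lborel. \<bar>K y\<bar>)" (is ?E)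
proof -
  have [measurable]: "K \<in> borel_measurable borel" using K by auto
  define f where "f u = \<bar>K (t + ln u)\<bar> * inverse (1 + u\<^sup>2)" for u
  have [measurable]: "f \<in> borel_measurable borel" unfolding f_def[abs_def] by measurable
  have fe: "f \<bar>u\<bar> = \<bar>K (t + ln \<bar>u\<bar>)\<bar> * inverse (1 + u\<^sup>2)" for u by (simp add: f_def)
  have Kt: "integrable lborel (\<lambda>y. \<bar>K (t + y)\<bar>)"
    using integrable_translate_lborel[OF K, of t] by simp
  have le: "exp y * f (exp y) \<le> \<bar>K (t + y)\<bar> * (1 / 2)" and nn: "0 \<le> exp y * f (exp y)" for y
  proof -
    \<comment> \<open>The square gives 2e^y \<le> 1 + e^(2y). The resulting 1/2 compensates the
      factor 2 from the two half-lines.\<close>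
    have "0 \<le> (exp y - 1)\<^sup>2" by simp
    then have "exp y * inverse (1 + (exp y)\<^sup>2) \<le> 1 / 2"
      by (simp add: power2_eq_square field_simps add_pos_nonneg)
    from mult_left_mono[OF this abs_ge_zero[of "K (t + y)"]]
    show "exp y * f (exp y) \<le> \<bar>K (t + y)\<bar> * (1 / 2)" by (simp add: f_def mult_ac)
    show "0 \<le> exp y * f (exp y)" by (simp add: f_def)
  qed
  have i: "integrable lborel (\<lambda>y. exp y * f (exp y))"
  proof (rule Bochner_Integration.integrable_bound)
    show "integrable lborel (\<lambda>y. \<bar>K (t + y)\<bar> * (1 / 2))" using Kt by (rule integrable_mult_left)
    show "AE y in lborel. norm (exp y * f (exp y)) \<le> norm (\<bar>K (t + y)\<bar> * (1 / 2))"
    proof (rule AE_I2)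
      fix y
      show "norm (exp y * f (exp y)) \<le> norm (\<bar>K (t + y)\<bar> * (1 / 2))"
        unfolding real_norm_def abs_of_nonneg[OF nn] by (rule order_trans[OF le abs_ge_self])
    qed
  qed measurable
  show ?I using integrable_even_exp_subst[OF _ i] by (simp add: fe)
  have "(LINT u|lborel. \<bar>K (t + ln \<bar>u\<bar>)\<bar> * inverse (1 + u\<^sup>2)) = 2 * (LINT y|lborel. exp y * f (exp y))"
    using integral_even_exp_subst[OF _ i] by (simp add: fe)
  also have "\<dots> \<le> 2 * (LINT y|lborel. \<bar>K (t + y)\<bar> * (1 / 2))"
    using i Kt le by (intro mult_left_mono integral_mono integrable_mult_left) auto
  also have "\<dots> = (LINT y|lborel. \<bar>K y\<bar>)"
    using integral_translate_lborel[of "\<lambda>y. \<bar>K y\<bar>" t] by simp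
  finally show ?E .
qed

lemma integral_diagonal_scale:
  fixes f :: "real ^ 'n \<Rightarrow> 'b::{banach,second_countable_topology}" and c :: "'n \<Rightarrow> real"
  assumes [measurable]: "f \<in> borel_measurable borel" and c: "\<And>i. 0 < c i"
  shows "(LINT x|lborel. f x) = (LINT v|lborel. (\<Prod>i\<in>UNIV. c i) *\<^sub>R f (\<chi> i. c i * v $ i))"
proof -
  define g where "g b = c (inv (\<lambda>i. axis i (1::real)) b)" for b :: "real ^ 'n"
  have inj: "inj (\<lambda>i::'n. axis i (1::real))"
    using bij_axis_Basis by (auto simp: bij_betw_def)
  have g: "g (axis i 1) = c i" for i
    by (simp add: g_def inv_f_f[OF inj])
  have T: "0 + (\<Sum>j\<in>Basis. (g j * (v \<bullet> j)) *\<^sub>R j) = (\<chi> i. c i * v $ i)" for v :: "real ^ 'n"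
  proof -
    have "(\<Sum>j\<in>Basis. (g j * (v \<bullet> j)) *\<^sub>R j) = (\<Sum>i\<in>UNIV. (c i * v $ i) *\<^sub>R axis i 1)"
      using sum.reindex_bij_betw[OF bij_axis_Basis, of "\<lambda>j. (g j * (v \<bullet> j)) *\<^sub>R j"] by (simp add: g cart_eq_inner_axis)
    also have "\<dots> = (\<chi> i. c i * v $ i)"
      by (simp add: vec_eq_iff axis_def if_distrib cong: if_cong)
    finally show ?thesis by simp
  qed
  have P: "(\<Prod>j\<in>Basis. \<bar>g j\<bar>) = (\<Prod>i\<in>UNIV. c i)"
    using prod.reindex_bij_betw[OF bij_axis_Basis, of "\<lambda>j. \<bar>g j\<bar>"] c by (simp add: g abs_of_pos)
  have "lborel = density (distr lborel borel (\<lambda>v. 0 + (\<Sum>j\<in>Basis. (g j * (v \<bullet> j)) *\<^sub>R j))) (\<lambda>_. \<Prod>j\<in>Basis. \<bar>g j\<bar>)"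
    by (rule lborel_affine_euclidean) (auto simp: Basis_vec_def g c less_imp_neq[symmetric])
  then have lb: "lborel = density (distr lborel borel (\<lambda>v::real^'n. \<chi> i. c i * v $ i)) (\<lambda>_. \<Prod>i\<in>UNIV. c i)"
    unfolding T P .
  have [measurable]: "(\<lambda>v::real^'n. \<chi> i. c i * v $ i) \<in> borel_measurable borel" by measurable
  show ?thesis
    by (subst lb, subst integral_density) (auto simp: integral_distr intro!: prod_nonneg less_imp_le[OF c])
qed

lemma borel_measurable_vec_nth [measurable (raw)]:
  fixes f :: "'a \<Rightarrow> real ^ 'n"
  assumes "f \<in> borel_measurable M"
  shows "(\<lambda>x. f x $ i) \<in> borel_measurable M"
  by (rule borel_measurable_continuous_on[OF _ assms]) (intro continuous_intros)

text \<open>Odd in each \<xi>_i and a function of e^(y_i)|\<xi>_i| otherwise. Since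
  \<open>sgn 0 = 0\<close>, the value of \<open>ln 0\<close> on the coordinate hyperplanes does not
  matter.\<close>

definition product_kernel :: "('n::finite \<Rightarrow> real \<Rightarrow> real) \<Rightarrow> real ^ 'n \<Rightarrow> real ^ 'n \<Rightarrow> real" where
  "product_kernel K y \<xi> = (\<Prod>i\<in>UNIV. sgn (\<xi> $ i) * K i (y $ i + ln \<bar>\<xi> $ i\<bar>))"

definition product_operator :: "('n::finite \<Rightarrow> real \<Rightarrow> real) \<Rightarrow> (real ^ 'n \<Rightarrow> complex) \<Rightarrow> real ^ 'n \<Rightarrow> complex" where
  "product_operator K \<Phi> y = (LINT \<xi>|lborel. complex_of_real (product_kernel K y \<xi>) * \<Phi> \<xi>)"

context
  fixes K :: "'n::finite \<Rightarrow> real \<Rightarrow> real" and \<Phi> :: "real ^ 'n \<Rightarrow> complex" and C :: real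
  assumes K: "\<And>i. integrable lborel (K i)"
    and \<Phi>c: "continuous_on UNIV \<Phi>"
    and \<Phi>: "\<And>\<xi>. cmod (\<Phi> \<xi>) \<le> C * cauchy_weight \<xi>"
begin

private lemma Km: "K i \<in> borel_measurable borel"
  using K[of i] by auto

private lemma \<Phi>m: "\<Phi> \<in> borel_measurable borel"
  using \<Phi>c by (rule borel_measurable_continuous_onI)

private lemma C_nonneg: "0 \<le> C"
  using order_trans[OF norm_ge_zero \<Phi>[of 0]] cauchy_weight_pos[of "0 :: real ^ 'n"] by (simp add: zero_le_mult_iff)

private lemma \<Phi>i: "integrable lborel \<Phi>"
  by (rule integrable_cauchy_weight_bound[OF \<Phi>m \<Phi>])

private lemma Kt: "integrable lborel (\<lambda>y. K i (y + c))"
  using integrable_translate_lborel[OF K[of i], of c] by (simp add: add.commute)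

text \<open>Integrating the modulus over \<open>y\<close> first, translation invariance removes
  ln|\<xi>_i| from every kernel and leaves at most a multiple of |\<Phi>|. The phase
  \<open>h\<close> is included so that one statement serves both integrability and the Fourier
  transform.\<close>

lemma product_operator_pair:
  assumes [measurable]: "h \<in> borel_measurable borel"
  shows "integrable (lborel \<Otimes>\<^sub>M lborel) (\<lambda>(\<xi>, y). complex_of_real (product_kernel K y \<xi>) * \<Phi> \<xi> * cis (h y))"
proof (rule lborel_pair.Fubini_integrable)
  note [measurable] = Km \<Phi>m
  have "(\<lambda>(\<xi>, y). complex_of_real (product_kernel K y \<xi>) * \<Phi> \<xi> * cis (h y)) \<in> borel_measurable (borel \<Otimes>\<^sub>M borel)"
    unfolding product_kernel_def by measurable
  then show "(\<lambda>(\<xi>, y). complex_of_real (product_kernel K y \<xi>) * \<Phi> \<xi> * cis (h y)) \<in> borel_measurable (lborel \<Otimes>\<^sub>M lborel)"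
    by (simp cong: measurable_cong_sets)
  define k where "k = (\<Prod>i\<in>UNIV. LINT y|lborel. \<bar>K i y\<bar>)"
  have pk: "integrable lborel (\<lambda>y. product_kernel K y \<xi>)" for \<xi>
    unfolding product_kernel_def
    by (rule integrable_prod_vec[where f = "\<lambda>i y. sgn (\<xi> $ i) * K i (y + ln \<bar>\<xi> $ i\<bar>)"]) (intro integrable_mult_right Kt)
  have n: "(LINT y|lborel. norm (complex_of_real (product_kernel K y \<xi>) * \<Phi> \<xi> * cis (h y))) = (\<Prod>i\<in>UNIV. \<bar>sgn (\<xi> $ i)\<bar>) * k * norm (\<Phi> \<xi>)" for \<xi>
  proof -
    have "(LINT y|lborel. norm (complex_of_real (product_kernel K y \<xi>) * \<Phi> \<xi> * cis (h y))) = (LINT y|lborel. (\<Prod>i\<in>UNIV. \<bar>sgn (\<xi> $ i)\<bar> * \<bar>K i (y $ i + ln \<bar>\<xi> $ i\<bar>)\<bar>)) * norm (\<Phi> \<xi>)"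
      by (simp only: norm_mult norm_of_real norm_cis mult_1_right product_kernel_def abs_prod abs_mult integral_mult_left_zero)
    also have "(LINT y|lborel. (\<Prod>i\<in>UNIV. \<bar>sgn (\<xi> $ i)\<bar> * \<bar>K i (y $ i + ln \<bar>\<xi> $ i\<bar>)\<bar>)) = (\<Prod>i\<in>UNIV. LINT y|lborel. \<bar>sgn (\<xi> $ i)\<bar> * \<bar>K i (y + ln \<bar>\<xi> $ i\<bar>)\<bar>)"
      by (rule integral_prod_vec[where f = "\<lambda>i y. \<bar>sgn (\<xi> $ i)\<bar> * \<bar>K i (y + ln \<bar>\<xi> $ i\<bar>)\<bar>"]) (intro integrable_mult_right integrable_abs Kt)
    also have "\<dots> = (\<Prod>i\<in>UNIV. \<bar>sgn (\<xi> $ i)\<bar> * (LINT y|lborel. \<bar>K i y\<bar>))"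
    proof (intro prod.cong refl)
      fix i
      show "(LINT y|lborel. \<bar>sgn (\<xi> $ i)\<bar> * \<bar>K i (y + ln \<bar>\<xi> $ i\<bar>)\<bar>) = \<bar>sgn (\<xi> $ i)\<bar> * (LINT y|lborel. \<bar>K i y\<bar>)"
        using integral_translate_lborel[of "\<lambda>y. \<bar>K i y\<bar>" "ln \<bar>\<xi> $ i\<bar>"] by (simp add: add.commute)
    qed
    finally show ?thesis by (simp add: prod.distrib k_def)
  qed
  have k0: "0 \<le> k" by (auto simp: k_def intro!: prod_nonneg)
  have "integrable lborel (\<lambda>\<xi>. (\<Prod>i\<in>UNIV. \<bar>sgn (\<xi> $ i)\<bar>) * k * norm (\<Phi> \<xi>))"
  proof (rule Bochner_Integration.integrable_bound)
    show "integrable lborel (\<lambda>\<xi>. k * norm (\<Phi> \<xi>))" using \<Phi>i by simp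
    have "(\<Prod>i\<in>UNIV. \<bar>sgn (\<xi> $ i)\<bar>) \<le> 1" for \<xi> :: "real ^ 'n" by (rule prod_le_1) (auto simp: abs_sgn_eq)
    then have "(\<Prod>i\<in>UNIV. \<bar>sgn (\<xi> $ i)\<bar>) * (k * norm (\<Phi> \<xi>)) \<le> 1 * (k * norm (\<Phi> \<xi>))" for \<xi> :: "real ^ 'n"
      using k0 by (intro mult_right_mono) auto
    then show "AE \<xi> in lborel. norm ((\<Prod>i\<in>UNIV. \<bar>sgn (\<xi> $ i)\<bar>) * k * norm (\<Phi> \<xi>)) \<le> norm (k * norm (\<Phi> \<xi>))"
      using k0 by (intro AE_I2) (simp add: abs_mult abs_prod mult.assoc)
  qed measurable
  then show "integrable lborel (\<lambda>\<xi>. LINT y|lborel. norm (case (\<xi>, y) of (\<xi>, y) \<Rightarrow> complex_of_real (product_kernel K y \<xi>) * \<Phi> \<xi> * cis (h y)))"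
    unfolding prod.case n .
  show "AE \<xi> in lborel. integrable lborel (\<lambda>y. case (\<xi>, y) of (\<xi>, y) \<Rightarrow> complex_of_real (product_kernel K y \<xi>) * \<Phi> \<xi> * cis (h y))"
    unfolding prod.case by (intro AE_I2 integrable_mult_cis integrable_mult_left integrable_of_real pk) measurable
qed

lemma integrable_product_operator: "integrable lborel (product_operator K \<Phi>)"
  using lborel_pair.integrable_snd[OF product_operator_pair[of "\<lambda>_. 0"]] by (simp add: product_operator_def[abs_def])

text \<open>With \<open>y\<close> integrated first, shifting y_i by ln|\<xi>_i| trades the
  dependence on \<xi> for a character in ln|\<xi>_i|, so the transforms of the kernels leave the
  integral over \<xi>.\<close>

lemma fourier_product_operator:
  "fourier (product_operator K \<Phi>) l = (\<Prod>i\<in>UNIV. mellin (K i) (- 2 * pi * l $ i))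
     * (LINT \<xi>|lborel. (\<Prod>i\<in>UNIV. complex_of_real (sgn (\<xi> $ i)) * cis (2 * pi * l $ i * ln \<bar>\<xi> $ i\<bar>)) * \<Phi> \<xi>)"
proof -
  note [measurable] = Km \<Phi>m
  have inner: "(LINT y|lborel. complex_of_real (product_kernel K y \<xi>) * \<Phi> \<xi> * cis (- 2 * pi * (y \<bullet> l)))
     = (\<Prod>i\<in>UNIV. mellin (K i) (- 2 * pi * l $ i)) * ((\<Prod>i\<in>UNIV. complex_of_real (sgn (\<xi> $ i)) * cis (2 * pi * l $ i * ln \<bar>\<xi> $ i\<bar>)) * \<Phi> \<xi>)" for \<xi>
  proof -
    let ?f = "\<lambda>i y. complex_of_real (sgn (\<xi> $ i)) * (complex_of_real (K i (y + ln \<bar>\<xi> $ i\<bar>)) * cis (- 2 * pi * l $ i * y))"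
    have c: "cis (- 2 * pi * (y \<bullet> l)) = (\<Prod>i\<in>UNIV. cis (- 2 * pi * l $ i * y $ i))" for y
      unfolding inner_vec_def sum_distrib_left by (subst cis_sum[symmetric]) (auto intro!: arg_cong[where f = cis] sum.cong)
    have e: "complex_of_real (product_kernel K y \<xi>) * \<Phi> \<xi> * cis (- 2 * pi * (y \<bullet> l)) = (\<Prod>i\<in>UNIV. ?f i (y $ i)) * \<Phi> \<xi>" for y
      unfolding c product_kernel_def of_real_prod of_real_mult prod.distrib by (simp only: mult_ac)
    have "(LINT y|lborel. complex_of_real (product_kernel K y \<xi>) * \<Phi> \<xi> * cis (- 2 * pi * (y \<bullet> l))) = (LINT y|lborel. (\<Prod>i\<in>UNIV. ?f i (y $ i))) * \<Phi> \<xi>"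
      unfolding e by (rule integral_mult_left_zero)
    also have "(LINT y|lborel. (\<Prod>i\<in>UNIV. ?f i (y $ i))) = (\<Prod>i\<in>UNIV. LINT y|lborel. ?f i y)"
      by (rule integral_prod_vec[where f = ?f]) (intro integrable_mult_right integrable_mult_cis integrable_of_real Kt, measurable)
    also have "\<dots> = (\<Prod>i\<in>UNIV. mellin (K i) (- 2 * pi * l $ i) * (complex_of_real (sgn (\<xi> $ i)) * cis (2 * pi * l $ i * ln \<bar>\<xi> $ i\<bar>)))"
    proof (intro prod.cong refl)
      fix i
      let ?l = "ln \<bar>\<xi> $ i\<bar>" and ?m = "- 2 * pi * l $ i"
      have "(LINT y|lborel. ?f i y) = complex_of_real (sgn (\<xi> $ i)) * (LINT y|lborel. complex_of_real (K i (y + ?l)) * cis (?m * y))"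
        by (rule integral_mult_right_zero)
      also have "(LINT y|lborel. complex_of_real (K i (y + ?l)) * cis (?m * y)) = (LINT y|lborel. complex_of_real (K i (?l + y)) * cis (?m * (?l + y)) * cis (- ?m * ?l))"
      proof (intro Bochner_Integration.integral_cong refl)
        fix y
        have "cis (?m * y) = cis (?m * (?l + y) + - ?m * ?l)"
          by (rule arg_cong[where f = cis]) (simp add: distrib_left)
        then show "complex_of_real (K i (y + ?l)) * cis (?m * y) = complex_of_real (K i (?l + y)) * cis (?m * (?l + y)) * cis (- ?m * ?l)"
          unfolding cis_mult[symmetric] by (simp only: add.commute mult.assoc)
      qed
      also have "\<dots> = (LINT y|lborel. complex_of_real (K i (?l + y)) * cis (?m * (?l + y))) * cis (- ?m * ?l)"
        by (rule integral_mult_left_zero)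
      also have "(LINT y|lborel. complex_of_real (K i (?l + y)) * cis (?m * (?l + y))) = mellin (K i) ?m"
        unfolding mellin_def by (rule integral_translate_lborel[where f = "\<lambda>y. complex_of_real (K i y) * cis (?m * y)"]) measurable
      also have "- ?m * ?l = 2 * pi * l $ i * ?l" by simp
      finally show "(LINT y|lborel. ?f i y) = mellin (K i) ?m * (complex_of_real (sgn (\<xi> $ i)) * cis (2 * pi * l $ i * ?l))"
        by (simp only: mult.left_commute)
    qed
    finally show ?thesis by (simp only: prod.distrib mult.assoc)
  qed
  have "fourier (product_operator K \<Phi>) l = (LINT y|lborel. (LINT \<xi>|lborel. complex_of_real (product_kernel K y \<xi>) * \<Phi> \<xi> * cis (- 2 * pi * (y \<bullet> l))))"
    unfolding fourier_def product_operator_def integral_mult_left_zero ..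
  also have "\<dots> = (LINT \<xi>|lborel. (LINT y|lborel. complex_of_real (product_kernel K y \<xi>) * \<Phi> \<xi> * cis (- 2 * pi * (y \<bullet> l))))"
    by (rule lborel_pair.Fubini_integral[OF product_operator_pair]) measurable
  finally show ?thesis unfolding inner integral_mult_right_zero .
qed

text \<open>The weight dominating \<Phi> is distributed over the coordinates, and each factor is
  bounded uniformly in \<open>y\<close> by \<open>integral_kernel_weight_le\<close>.\<close>

lemma bounded_product_operator: "cmod (product_operator K \<Phi> y) \<le> C * (\<Prod>i\<in>UNIV. LINT y|lborel. \<bar>K i y\<bar>)"
proof -
  let ?g = "\<lambda>i u. \<bar>K i (y $ i + ln \<bar>u\<bar>)\<bar> * inverse (1 + u\<^sup>2)"
  have gi: "integrable lborel (?g i)" for i by (rule integrable_kernel_weight[OF K])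
  have "cmod (product_operator K \<Phi> y) \<le> (LINT \<xi>|lborel. norm (complex_of_real (product_kernel K y \<xi>) * \<Phi> \<xi>))"
    unfolding product_operator_def by (rule integral_norm_bound)
  also have "\<dots> \<le> (LINT \<xi>|lborel. C * (\<Prod>i\<in>UNIV. ?g i (\<xi> $ i)))"
  proof (rule Bochner_Integration.integral_mono')
    show "integrable lborel (\<lambda>\<xi>::real^'n. C * (\<Prod>i\<in>UNIV. ?g i (\<xi> $ i)))"
      by (intro integrable_mult_right integrable_prod_vec[where f = ?g] gi)
    fix \<xi> :: "real ^ 'n"
    have "\<bar>product_kernel K y \<xi>\<bar> \<le> (\<Prod>i\<in>UNIV. \<bar>K i (y $ i + ln \<bar>\<xi> $ i\<bar>)\<bar>)"
      unfolding product_kernel_def abs_prod by (intro prod_mono) (auto simp: abs_mult abs_sgn_eq)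
    then have "\<bar>product_kernel K y \<xi>\<bar> * cmod (\<Phi> \<xi>) \<le> (\<Prod>i\<in>UNIV. \<bar>K i (y $ i + ln \<bar>\<xi> $ i\<bar>)\<bar>) * (C * cauchy_weight \<xi>)"
      by (intro mult_mono \<Phi>) (auto intro: prod_nonneg)
    then show "norm (complex_of_real (product_kernel K y \<xi>) * \<Phi> \<xi>) \<le> C * (\<Prod>i\<in>UNIV. ?g i (\<xi> $ i))"
      by (simp add: norm_mult cauchy_weight_def prod.distrib mult_ac)
    show "0 \<le> C * (\<Prod>i\<in>UNIV. ?g i (\<xi> $ i))"
      using C_nonneg by (intro mult_nonneg_nonneg prod_nonneg) auto
  qed
  also have "\<dots> = C * (\<Prod>i\<in>UNIV. LINT u|lborel. ?g i u)"
    unfolding integral_mult_right_zero by (subst integral_prod_vec[where f = ?g, OF gi]) (rule refl)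
  also have "\<dots> \<le> C * (\<Prod>i\<in>UNIV. LINT y|lborel. \<bar>K i y\<bar>)"
    by (intro mult_left_mono prod_mono conjI integral_kernel_weight_le K C_nonneg) auto
  finally show ?thesis .
qed

text \<open>Moves \<open>y\<close> from the kernels, which may be unbounded, to the continuous function \<open>\<Phi>\<close>.\<close>

lemma product_operator_rescaled:
  "product_operator K \<Phi> y = (LINT v|lborel. (\<Prod>i\<in>UNIV. exp (- y $ i)) *\<^sub>R (complex_of_real (product_kernel K 0 v) * \<Phi> (\<chi> i. exp (- y $ i) * v $ i)))"
proof -
  note [measurable] = Km \<Phi>m
  have pk: "product_kernel K y (\<chi> i. exp (- y $ i) * v $ i) = product_kernel K 0 v" for v :: "real ^ 'n"
    unfolding product_kernel_def
  proof (rule prod.cong[OF refl])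
    fix i
    show "sgn ((\<chi> i. exp (- y $ i) * v $ i) $ i) * K i (y $ i + ln \<bar>(\<chi> i. exp (- y $ i) * v $ i) $ i\<bar>) = sgn (v $ i) * K i (0 $ i + ln \<bar>v $ i\<bar>)"
      by (cases "v $ i = 0") (simp_all add: sgn_mult abs_mult ln_mult)
  qed
  have "product_operator K \<Phi> y = (LINT v|lborel. (\<Prod>i\<in>UNIV. exp (- y $ i)) *\<^sub>R (complex_of_real (product_kernel K y (\<chi> i. exp (- y $ i) * v $ i)) * \<Phi> (\<chi> i. exp (- y $ i) * v $ i)))"
    unfolding product_operator_def
    by (rule integral_diagonal_scale[where f = "\<lambda>\<xi>. complex_of_real (product_kernel K y \<xi>) * \<Phi> \<xi>"])
       (auto simp: product_kernel_def)
  then show ?thesis unfolding pk .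
qed

text \<open>The kernels may be discontinuous, so dominated convergence is applied to the rescaled
  form, in which only \<Phi> and the Jacobian depend on \<open>y\<close>. Along a convergent
  sequence the dilations stay in a bounded range, where dilated Cauchy weights are
  comparable.\<close>

lemma continuous_product_operator: "continuous_on UNIV (product_operator K \<Phi>)"
proof (rule continuous_at_imp_continuous_on, rule ballI, unfold continuous_at_sequentially comp_def, intro allI impI)
  note [measurable] = Km \<Phi>m
  fix y and Y :: "nat \<Rightarrow> real ^ 'n" assume Y: "Y \<longlonglongrightarrow> y"
  have "bounded (range Y)" using Y by (intro convergent_imp_bounded) (auto simp: convergent_def)
  then obtain M where M: "\<And>m. norm (Y m) \<le> M" unfolding bounded_iff by auto
  have Mi: "\<bar>Y m $ i\<bar> \<le> M" for m i using component_le_norm_cart[of "Y m" i] M[of m] by linarith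
  have M0: "0 \<le> M" using Mi[of 0] by (meson abs_ge_zero order_trans)
  let ?g = "\<lambda>i u. \<bar>K i (0 + ln \<bar>u\<bar>)\<bar> * inverse (1 + u\<^sup>2)"
  have gi: "integrable lborel (?g i)" for i by (rule integrable_kernel_weight[OF K])
  \<comment> \<open>The Jacobian contributes at most exp(M), and the change of scale in the weight
    at most exp(2M).\<close>
  have dom: "exp (- Y m $ i) * inverse (1 + (exp (- Y m $ i) * u)\<^sup>2) \<le> exp (3 * M) * inverse (1 + u\<^sup>2)" for m i u
  proof -
    define e where "e = exp (- Y m $ i)"
    have e: "exp (- M) \<le> e" "e \<le> exp M" using Mi[of m i] by (auto simp: e_def)
    have "exp (- 2 * M) * (1 + u\<^sup>2) = exp (- 2 * M) + (exp (- M))\<^sup>2 * u\<^sup>2"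
      by (simp add: distrib_left power2_eq_square exp_add[symmetric])
    also have "\<dots> \<le> 1 + e\<^sup>2 * u\<^sup>2"
      using M0 e(1) by (intro add_mono mult_right_mono power_mono) auto
    finally have "inverse (1 + (e * u)\<^sup>2) \<le> inverse (exp (- 2 * M) * (1 + u\<^sup>2))"
      by (intro le_imp_inverse_le) (auto simp: power_mult_distrib)
    also have "\<dots> = exp (2 * M) * inverse (1 + u\<^sup>2)" by (simp add: exp_minus)
    finally have "e * inverse (1 + (e * u)\<^sup>2) \<le> exp M * (exp (2 * M) * inverse (1 + u\<^sup>2))"
      using e(2) by (intro mult_mono) (auto simp: less_imp_le)
    also have "\<dots> = exp (3 * M) * inverse (1 + u\<^sup>2)"
      unfolding mult.assoc[symmetric] exp_add[symmetric] by simp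
    finally show ?thesis by (simp add: e_def)
  qed
  show "(\<lambda>m. product_operator K \<Phi> (Y m)) \<longlonglongrightarrow> product_operator K \<Phi> y"
    unfolding product_operator_rescaled
  proof (rule integral_dominated_convergence)
    show "integrable lborel (\<lambda>v::real^'n. C * (exp (3 * M) ^ CARD('n) * (\<Prod>i\<in>UNIV. ?g i (v $ i))))"
      by (intro integrable_mult_right integrable_prod_vec[where f = ?g] gi)
    show "AE v in lborel. (\<lambda>m. (\<Prod>i\<in>UNIV. exp (- Y m $ i)) *\<^sub>R (complex_of_real (product_kernel K 0 v) * \<Phi> (\<chi> i. exp (- Y m $ i) * v $ i)))
       \<longlonglongrightarrow> (\<Prod>i\<in>UNIV. exp (- y $ i)) *\<^sub>R (complex_of_real (product_kernel K 0 v) * \<Phi> (\<chi> i. exp (- y $ i) * v $ i))"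
    proof (intro AE_I2 tendsto_intros)
      fix v :: "real ^ 'n"
      have "isCont \<Phi> z" for z using \<Phi>c continuous_on_eq_continuous_at[OF open_UNIV] by blast
      then show "(\<lambda>m. \<Phi> (\<chi> i. exp (- Y m $ i) * v $ i)) \<longlonglongrightarrow> \<Phi> (\<chi> i. exp (- y $ i) * v $ i)"
        by (rule isCont_tendsto_compose) (intro tendsto_intros tendsto_vec_lambda Y)
    qed (rule Y)
    show "AE v in lborel. norm ((\<Prod>i\<in>UNIV. exp (- Y m $ i)) *\<^sub>R (complex_of_real (product_kernel K 0 v) * \<Phi> (\<chi> i. exp (- Y m $ i) * v $ i)))
        \<le> C * (exp (3 * M) ^ CARD('n) * (\<Prod>i\<in>UNIV. ?g i (v $ i)))" for m
    proof (rule AE_I2)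
      fix v :: "real ^ 'n"
      have e0: "0 \<le> (\<Prod>i\<in>UNIV. exp (- Y m $ i))" by (intro prod_nonneg) simp
      have pk: "\<bar>product_kernel K 0 v\<bar> \<le> (\<Prod>i\<in>UNIV. \<bar>K i (0 + ln \<bar>v $ i\<bar>)\<bar>)"
        unfolding product_kernel_def abs_prod by (intro prod_mono) (auto simp: abs_mult abs_sgn_eq)
      have "norm ((\<Prod>i\<in>UNIV. exp (- Y m $ i)) *\<^sub>R (complex_of_real (product_kernel K 0 v) * \<Phi> (\<chi> i. exp (- Y m $ i) * v $ i)))
        = (\<Prod>i\<in>UNIV. exp (- Y m $ i)) * (\<bar>product_kernel K 0 v\<bar> * cmod (\<Phi> (\<chi> i. exp (- Y m $ i) * v $ i)))"
        using e0 by (simp add: norm_mult)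
      also have "\<dots> \<le> (\<Prod>i\<in>UNIV. exp (- Y m $ i)) * ((\<Prod>i\<in>UNIV. \<bar>K i (0 + ln \<bar>v $ i\<bar>)\<bar>) * (C * cauchy_weight (\<chi> i. exp (- Y m $ i) * v $ i)))"
        by (intro mult_left_mono mult_mono \<Phi> pk e0) (auto intro: prod_nonneg)
      also have "\<dots> = C * ((\<Prod>i\<in>UNIV. \<bar>K i (0 + ln \<bar>v $ i\<bar>)\<bar>) * (\<Prod>i\<in>UNIV. exp (- Y m $ i) * inverse (1 + (exp (- Y m $ i) * v $ i)\<^sup>2)))"
        by (simp add: cauchy_weight_def prod.distrib mult_ac)
      also have "\<dots> \<le> C * ((\<Prod>i\<in>UNIV. \<bar>K i (0 + ln \<bar>v $ i\<bar>)\<bar>) * (\<Prod>i\<in>UNIV. exp (3 * M) * inverse (1 + (v $ i)\<^sup>2)))"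
        by (intro mult_left_mono prod_mono conjI dom C_nonneg prod_nonneg) (auto intro!: mult_nonneg_nonneg)
      also have "\<dots> = C * (exp (3 * M) ^ CARD('n) * (\<Prod>i\<in>UNIV. ?g i (v $ i)))"
        unfolding prod.distrib prod_constant by (simp only: mult_ac)
      finally show "norm ((\<Prod>i\<in>UNIV. exp (- Y m $ i)) *\<^sub>R (complex_of_real (product_kernel K 0 v) * \<Phi> (\<chi> i. exp (- Y m $ i) * v $ i)))
        \<le> C * (exp (3 * M) ^ CARD('n) * (\<Prod>i\<in>UNIV. ?g i (v $ i)))" .
    qed
  qed (auto simp: product_kernel_def)
qed

lemma product_operator_plancherel:
  "(\<integral>\<^sup>+y. ennreal ((cmod (product_operator K \<Phi> y))\<^sup>2) \<partial>lborel) =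
   (\<integral>\<^sup>+l. ennreal ((\<Prod>i\<in>UNIV. cmod (mellin (K i) (- 2 * pi * l $ i)))\<^sup>2 *
     (cmod (LINT \<xi>|lborel. (\<Prod>i\<in>UNIV. complex_of_real (sgn (\<xi> $ i)) * cis (2 * pi * l $ i * ln \<bar>\<xi> $ i\<bar>)) * \<Phi> \<xi>))\<^sup>2) \<partial>lborel)"
  unfolding plancherel[OF integrable_product_operator bounded_product_operator continuous_product_operator]
  unfolding fourier_product_operator norm_mult prod_norm[symmetric] power_mult_distrib ..

end

text \<open>After Plancherel both sides carry the same factor \<open>Q\<close>, so the pointwise
  bounds on the transforms can be inserted. The statement is one-sided; exchanging the two families
  of kernels yields the reverse estimate.\<close>

lemma product_operator_le:
  fixes K L :: "'n::finite \<Rightarrow> real \<Rightarrow> real" and \<Phi> :: "real ^ 'n \<Rightarrow> complex"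
  assumes K: "\<And>i. integrable lborel (K i)" and L: "\<And>i. integrable lborel (L i)"
    and \<Phi>: "continuous_on UNIV \<Phi>" "\<And>\<xi>. cmod (\<Phi> \<xi>) \<le> C * cauchy_weight \<xi>"
    and B: "\<And>i. 0 < B i" and le: "\<And>i l. cmod (mellin (K i) l) \<le> B i * cmod (mellin (L i) l)"
  shows "(\<integral>\<^sup>+y. ennreal ((cmod (product_operator K \<Phi> y))\<^sup>2) \<partial>lborel)
     \<le> ennreal ((\<Prod>i\<in>UNIV. B i)\<^sup>2) * (\<integral>\<^sup>+y. ennreal ((cmod (product_operator L \<Phi> y))\<^sup>2) \<partial>lborel)"
proof -
  have [measurable]: "\<Phi> \<in> borel_measurable borel" using \<Phi>(1) by (rule borel_measurable_continuous_onI)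
  have [measurable]: "L i \<in> borel_measurable borel" for i using L[of i] by auto
  define Q where "Q l = (cmod (LINT \<xi>|lborel. (\<Prod>i\<in>UNIV. complex_of_real (sgn (\<xi> $ i)) * cis (2 * pi * l $ i * ln \<bar>\<xi> $ i\<bar>)) * \<Phi> \<xi>))\<^sup>2" for l :: "real ^ 'n"
  have [measurable]: "Q \<in> borel_measurable borel"
    unfolding Q_def[abs_def] by measurable
  have [measurable]: "mellin (L i) \<in> borel_measurable borel" for i
    unfolding mellin_def[abs_def] by measurable
  have "(\<integral>\<^sup>+l. ennreal ((\<Prod>i\<in>UNIV. cmod (mellin (K i) (- 2 * pi * l $ i)))\<^sup>2 * Q l) \<partial>lborel)
     \<le> (\<integral>\<^sup>+l. ennreal ((\<Prod>i\<in>UNIV. B i)\<^sup>2) * ennreal ((\<Prod>i\<in>UNIV. cmod (mellin (L i) (- 2 * pi * l $ i)))\<^sup>2 * Q l) \<partial>lborel)"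
  proof (rule nn_integral_mono)
    fix l :: "real ^ 'n"
    have "(\<Prod>i\<in>UNIV. cmod (mellin (K i) (- 2 * pi * l $ i))) \<le> (\<Prod>i\<in>UNIV. B i * cmod (mellin (L i) (- 2 * pi * l $ i)))"
      by (intro prod_mono conjI le) auto
    then have "(\<Prod>i\<in>UNIV. cmod (mellin (K i) (- 2 * pi * l $ i)))\<^sup>2 * Q l \<le> (\<Prod>i\<in>UNIV. B i * cmod (mellin (L i) (- 2 * pi * l $ i)))\<^sup>2 * Q l"
      by (intro mult_right_mono power_mono prod_nonneg) (auto simp: Q_def)
    also have "\<dots> = (\<Prod>i\<in>UNIV. B i)\<^sup>2 * ((\<Prod>i\<in>UNIV. cmod (mellin (L i) (- 2 * pi * l $ i)))\<^sup>2 * Q l)"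
      by (simp only: prod.distrib power_mult_distrib mult.assoc)
    finally show "ennreal ((\<Prod>i\<in>UNIV. cmod (mellin (K i) (- 2 * pi * l $ i)))\<^sup>2 * Q l) \<le> ennreal ((\<Prod>i\<in>UNIV. B i)\<^sup>2) * ennreal ((\<Prod>i\<in>UNIV. cmod (mellin (L i) (- 2 * pi * l $ i)))\<^sup>2 * Q l)"
      unfolding ennreal_mult'[OF zero_le_power2, symmetric] by (rule ennreal_leI)
  qed
  also have "\<dots> = ennreal ((\<Prod>i\<in>UNIV. B i)\<^sup>2) * (\<integral>\<^sup>+l. ennreal ((\<Prod>i\<in>UNIV. cmod (mellin (L i) (- 2 * pi * l $ i)))\<^sup>2 * Q l) \<partial>lborel)"
    by (rule nn_integral_cmult) measurable
  finally show ?thesis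
    unfolding product_operator_plancherel[OF K \<Phi>] product_operator_plancherel[OF L \<Phi>] Q_def .
qed

subsection \<open>The two square functions in logarithmic coordinates\<close>


lemma continuous_on_cis [continuous_intros]:
  "continuous_on S g \<Longrightarrow> continuous_on S (\<lambda>x. cis (g x))"
  unfolding cis_conv_exp by (intro continuous_intros)

lemma continuous_fourier:
  assumes f: "integrable lborel f"
  shows "continuous_on UNIV (fourier f)"
proof (rule continuous_at_imp_continuous_on, rule ballI, unfold continuous_at_sequentially comp_def, intro allI impI)
  have [measurable]: "f \<in> borel_measurable borel" using f by auto
  fix \<xi> and X :: "nat \<Rightarrow> real ^ 'a" assume X: "X \<longlonglongrightarrow> \<xi>"
  show "(\<lambda>m. fourier f (X m)) \<longlonglongrightarrow> fourier f \<xi>"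
    unfolding fourier_def
  proof (rule integral_dominated_convergence)
    show "integrable lborel (\<lambda>x. norm (f x))" using f by simp
    show "AE x in lborel. (\<lambda>m. f x * cis (- 2 * pi * (x \<bullet> X m))) \<longlonglongrightarrow> f x * cis (- 2 * pi * (x \<bullet> \<xi>))"
      unfolding cis_conv_exp by (intro AE_I2 tendsto_intros X)
  qed (auto simp: norm_mult)
qed

lemma modulated_fourier:
  fixes f :: "real ^ 'n \<Rightarrow> complex"
  assumes f: "schwartz f"
  shows "continuous_on UNIV (\<lambda>\<xi>. fourier f \<xi> * cis (2 * pi * (x \<bullet> \<xi>)))"
    and "\<exists>C. \<forall>\<xi>. cmod (fourier f \<xi> * cis (2 * pi * (x \<bullet> \<xi>))) \<le> C * cauchy_weight \<xi>"
  using schwartz_fourier_decay[OF f]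
  by (auto intro!: continuous_intros continuous_fourier schwartz_integrable[OF f] simp: norm_mult)

text \<open>In y = ln u the integrand is exp((1-a)y)/(1 + exp(2y)), decaying at rate 1-a to the left
  and 1+a to the right; the smaller rate serves for both sides.\<close>

lemma integrable_riesz_weight:
  assumes a: "0 < a" "a < 1"
  shows "integrable lborel (\<lambda>u::real. \<bar>u\<bar> powr (- a) * inverse (1 + u\<^sup>2))"
proof -
  define g where "g u = u powr (- a) * inverse (1 + u\<^sup>2)" for u :: real
  have [measurable]: "g \<in> borel_measurable borel" unfolding g_def[abs_def] by measurable
  have "integrable lborel (\<lambda>y. exp y * g (exp y))"
  proof (rule Bochner_Integration.integrable_bound)
    show "integrable lborel (\<lambda>y::real. exp (- (1 - a) * \<bar>y\<bar>))"
      by (rule integrable_exp_neg_abs) (use a in simp)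
    show "AE y in lborel. norm (exp y * g (exp y)) \<le> norm (exp (- (1 - a) * \<bar>y\<bar>))"
    proof (rule AE_I2)
      fix y :: real
      have e: "exp y * g (exp y) = exp ((1 - a) * y) * inverse (1 + exp (2 * y))"
        by (simp add: g_def powr_def exp_double[symmetric] left_diff_distrib exp_diff exp_minus divide_inverse)
      have "exp ((1 - a) * y) * inverse (1 + exp (2 * y)) \<le> exp (- (1 - a) * \<bar>y\<bar>)"
      proof (cases "0 \<le> y")
        case True
        have "inverse (1 + exp (2 * y)) \<le> inverse (exp (2 * y))" by (intro le_imp_inverse_le) auto
        then have "exp ((1 - a) * y) * inverse (1 + exp (2 * y)) \<le> exp ((1 - a) * y) * inverse (exp (2 * y))"
          by (intro mult_left_mono) auto
        also have "\<dots> = exp ((1 - a) * y - 2 * y)" by (simp add: exp_diff divide_inverse)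
        also have "\<dots> \<le> exp (- (1 - a) * \<bar>y\<bar>)"
        proof -
          have "0 \<le> a * y" using True a by simp
          then show ?thesis using True by (simp add: algebra_simps)
        qed
        finally show ?thesis .
      next
        case False
        have "inverse (1 + exp (2 * y)) \<le> 1" by (simp add: inverse_le_1_iff)
        then have "exp ((1 - a) * y) * inverse (1 + exp (2 * y)) \<le> exp ((1 - a) * y) * 1"
          by (intro mult_left_mono) auto
        moreover have "- (1 - a) * \<bar>y\<bar> = (1 - a) * y" using False by (simp add: abs_if algebra_simps)
        ultimately show ?thesis by (simp only: mult_1_right)
      qed
      moreover have "0 \<le> exp ((1 - a) * y) * inverse (1 + exp (2 * y))" by simp
      ultimately show "norm (exp y * g (exp y)) \<le> norm (exp (- (1 - a) * \<bar>y\<bar>))"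
        unfolding e real_norm_def by simp
    qed
  qed measurable
  then show ?thesis using integrable_even_exp_subst[of g] by (simp add: g_def)
qed

text \<open>Ensures that \<open>riesz_potential\<close> is an absolutely convergent integral and not
  the default value of the Bochner integral, and that differences may be taken under the integral
  sign.\<close>

lemma integrable_riesz_multiplier:
  fixes f :: "real ^ 'n \<Rightarrow> complex"
  assumes f: "schwartz f" and a: "\<And>i. 0 < \<alpha> $ i \<and> \<alpha> $ i < 1"
  shows "integrable lborel (\<lambda>\<xi>. complex_of_real (\<Prod>i\<in>UNIV. \<bar>\<xi> $ i\<bar> powr (- \<alpha> $ i)) * fourier f \<xi>)"
proof -
  have [measurable]: "f \<in> borel_measurable borel" by (rule schwartz_measurable[OF f])
  obtain C where C: "0 \<le> C" "\<And>\<xi>. cmod (fourier f \<xi>) \<le> C * cauchy_weight \<xi>"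
    using schwartz_fourier_decay[OF f] by blast
  let ?g = "\<lambda>i u. \<bar>u\<bar> powr (- \<alpha> $ i) * inverse (1 + u\<^sup>2)"
  show ?thesis
  proof (rule Bochner_Integration.integrable_bound)
    show "integrable lborel (\<lambda>\<xi>::real^'n. C * (\<Prod>i\<in>UNIV. ?g i (\<xi> $ i)))"
      by (intro integrable_mult_right integrable_prod_vec[where f = ?g] integrable_riesz_weight) (use a in auto)
    show "AE \<xi> in lborel. norm (complex_of_real (\<Prod>i\<in>UNIV. \<bar>\<xi> $ i\<bar> powr (- \<alpha> $ i)) * fourier f \<xi>) \<le> norm (C * (\<Prod>i\<in>UNIV. ?g i (\<xi> $ i)))"
    proof (rule AE_I2)
      fix \<xi> :: "real ^ 'n"
      have p: "0 \<le> (\<Prod>i\<in>UNIV. \<bar>\<xi> $ i\<bar> powr (- \<alpha> $ i))" by (intro prod_nonneg) simp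
      have "norm (complex_of_real (\<Prod>i\<in>UNIV. \<bar>\<xi> $ i\<bar> powr (- \<alpha> $ i)) * fourier f \<xi>) = (\<Prod>i\<in>UNIV. \<bar>\<xi> $ i\<bar> powr (- \<alpha> $ i)) * cmod (fourier f \<xi>)"
        unfolding norm_mult norm_of_real abs_of_nonneg[OF p] ..
      also have "\<dots> \<le> (\<Prod>i\<in>UNIV. \<bar>\<xi> $ i\<bar> powr (- \<alpha> $ i)) * (C * cauchy_weight \<xi>)"
        by (intro mult_left_mono C(2) p)
      also have "\<dots> = C * (\<Prod>i\<in>UNIV. ?g i (\<xi> $ i))"
        unfolding cauchy_weight_def prod.distrib by (simp only: mult_ac)
      finally show "norm (complex_of_real (\<Prod>i\<in>UNIV. \<bar>\<xi> $ i\<bar> powr (- \<alpha> $ i)) * fourier f \<xi>) \<le> norm (C * (\<Prod>i\<in>UNIV. ?g i (\<xi> $ i)))"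
        unfolding real_norm_def by (rule order_trans[OF _ abs_ge_self])
    qed
  qed measurable
qed

section \<open>Differences of the Riesz potential\<close>

lemma cis_diff_sin: "cis (- a) - cis a = - 2 * \<i> * complex_of_real (sin a)"
  by (simp add: complex_eq_iff)

text \<open>Each difference multiplies the integrand by cis(-s) - cis(s) = -2i sin(s) with s =
  2\<pi> t_i \<xi>_i. The index set is a general finite \<open>S\<close> to allow induction, and
  boundedness of the sines keeps the integrand integrable at every stage.\<close>

lemma fold_delta_coord_fourier_integral:
  fixes w :: "real ^ 'n \<Rightarrow> complex" and t :: "real ^ 'n"
  assumes w: "integrable lborel w" and "finite S"
  shows "Finite_Set.fold (\<lambda>i. delta_coord i (t $ i)) (\<lambda>x. LINT \<xi>|lborel. w \<xi> * cis (2 * pi * (x \<bullet> \<xi>))) S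
    = (\<lambda>x. LINT \<xi>|lborel. w \<xi> * (\<Prod>i\<in>S. - 2 * \<i> * complex_of_real (sin (2 * pi * t $ i * \<xi> $ i))) * cis (2 * pi * (x \<bullet> \<xi>)))"
  using \<open>finite S\<close>
proof (induction S rule: finite_induct)
  case empty
  then show ?case by simp
next
  case (insert i S)
  interpret comp_fun_commute "\<lambda>i. delta_coord i (t $ i)" by (rule comp_fun_commute_delta_coord)
  have [measurable]: "w \<in> borel_measurable borel" using w by auto
  define v where "v \<xi> = w \<xi> * (\<Prod>i\<in>S. - 2 * \<i> * complex_of_real (sin (2 * pi * t $ i * \<xi> $ i)))" for \<xi>
  have v: "integrable lborel v"
  proof (rule Bochner_Integration.integrable_bound)
    show "integrable lborel (\<lambda>\<xi>. norm (w \<xi>) * 2 ^ card S)" using w by simp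
    show "AE \<xi> in lborel. norm (v \<xi>) \<le> norm (norm (w \<xi>) * 2 ^ card S)"
    proof (rule AE_I2)
      fix \<xi> :: "real ^ 'n"
      have "(\<Prod>i\<in>S. norm (- 2 * \<i> * complex_of_real (sin (2 * pi * t $ i * \<xi> $ i)))) \<le> (\<Prod>i\<in>S. 2)"
        by (intro prod_mono) (auto simp: norm_mult)
      then have "norm (w \<xi>) * (\<Prod>i\<in>S. norm (- 2 * \<i> * complex_of_real (sin (2 * pi * t $ i * \<xi> $ i)))) \<le> norm (w \<xi>) * 2 ^ card S"
        by (intro mult_left_mono) simp_all
      then show "norm (v \<xi>) \<le> norm (norm (w \<xi>) * 2 ^ card S)"
        unfolding v_def norm_mult[of "w \<xi>"] prod_norm[symmetric] real_norm_def by (rule order_trans[OF _ abs_ge_self])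
    qed
    show "v \<in> borel_measurable lborel" unfolding v_def[abs_def] by measurable
  qed
  have I: "integrable lborel (\<lambda>\<xi>. v \<xi> * cis (2 * pi * (z \<bullet> \<xi>)))" for z
    by (rule integrable_mult_cis[OF v]) measurable
  have "delta_coord i (t $ i) (\<lambda>x. LINT \<xi>|lborel. v \<xi> * cis (2 * pi * (x \<bullet> \<xi>))) x
     = (LINT \<xi>|lborel. w \<xi> * (\<Prod>i\<in>insert i S. - 2 * \<i> * complex_of_real (sin (2 * pi * t $ i * \<xi> $ i))) * cis (2 * pi * (x \<bullet> \<xi>)))" for x
  proof -
    have "delta_coord i (t $ i) (\<lambda>x. LINT \<xi>|lborel. v \<xi> * cis (2 * pi * (x \<bullet> \<xi>))) x
      = (LINT \<xi>|lborel. v \<xi> * cis (2 * pi * ((x - t $ i *\<^sub>R axis i 1) \<bullet> \<xi>)) - v \<xi> * cis (2 * pi * ((x + t $ i *\<^sub>R axis i 1) \<bullet> \<xi>)))"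
      unfolding delta_coord_def by (rule Bochner_Integration.integral_diff[OF I I, symmetric])
    also have "\<dots> = (LINT \<xi>|lborel. w \<xi> * (\<Prod>i\<in>insert i S. - 2 * \<i> * complex_of_real (sin (2 * pi * t $ i * \<xi> $ i))) * cis (2 * pi * (x \<bullet> \<xi>)))"
    proof (intro Bochner_Integration.integral_cong refl)
      fix \<xi> :: "real ^ 'n"
      let ?s = "2 * pi * t $ i * \<xi> $ i"
      have "cis (2 * pi * ((x - t $ i *\<^sub>R axis i 1) \<bullet> \<xi>)) = cis (- ?s) * cis (2 * pi * (x \<bullet> \<xi>))"
           "cis (2 * pi * ((x + t $ i *\<^sub>R axis i 1) \<bullet> \<xi>)) = cis ?s * cis (2 * pi * (x \<bullet> \<xi>))"
        unfolding cis_mult by (rule arg_cong[where f = cis], simp add: inner_diff_left inner_add_left inner_axis' algebra_simps)+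
      then have "v \<xi> * cis (2 * pi * ((x - t $ i *\<^sub>R axis i 1) \<bullet> \<xi>)) - v \<xi> * cis (2 * pi * ((x + t $ i *\<^sub>R axis i 1) \<bullet> \<xi>))
        = v \<xi> * (cis (- ?s) - cis ?s) * cis (2 * pi * (x \<bullet> \<xi>))"
        by (simp only: left_diff_distrib right_diff_distrib mult.assoc)
      also have "\<dots> = w \<xi> * (\<Prod>i\<in>insert i S. - 2 * \<i> * complex_of_real (sin (2 * pi * t $ i * \<xi> $ i))) * cis (2 * pi * (x \<bullet> \<xi>))"
        unfolding cis_diff_sin v_def prod.insert[OF insert.hyps] by (simp only: mult_ac)
      finally show "v \<xi> * cis (2 * pi * ((x - t $ i *\<^sub>R axis i 1) \<bullet> \<xi>)) - v \<xi> * cis (2 * pi * ((x + t $ i *\<^sub>R axis i 1) \<bullet> \<xi>))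
        = w \<xi> * (\<Prod>i\<in>insert i S. - 2 * \<i> * complex_of_real (sin (2 * pi * t $ i * \<xi> $ i))) * cis (2 * pi * (x \<bullet> \<xi>))" .
    qed
    finally show ?thesis .
  qed
  then show ?case
    unfolding fold_insert[OF insert.hyps] insert.IH v_def by (rule ext)
qed

lemma tensor_delta_riesz_potential:
  fixes f :: "real ^ 'n \<Rightarrow> complex"
  assumes f: "schwartz f" and a: "\<And>i. 0 < \<alpha> $ i \<and> \<alpha> $ i < 1"
  shows "tensor_delta t (riesz_potential \<alpha> f) x =
    (LINT \<xi>|lborel. (\<Prod>i\<in>UNIV. - 2 * \<i> * complex_of_real (sin (2 * pi * t $ i * \<xi> $ i) * \<bar>\<xi> $ i\<bar> powr (- \<alpha> $ i)))
       * (fourier f \<xi> * cis (2 * pi * (x \<bullet> \<xi>))))"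
proof -
  have "riesz_potential \<alpha> f = (\<lambda>x. LINT \<xi>|lborel. (complex_of_real (\<Prod>i\<in>UNIV. \<bar>\<xi> $ i\<bar> powr (- \<alpha> $ i)) * fourier f \<xi>) * cis (2 * pi * (x \<bullet> \<xi>)))"
    by (simp add: fun_eq_iff riesz_potential_def)
  then have "tensor_delta t (riesz_potential \<alpha> f) x = (LINT \<xi>|lborel. (complex_of_real (\<Prod>i\<in>UNIV. \<bar>\<xi> $ i\<bar> powr (- \<alpha> $ i)) * fourier f \<xi>) * (\<Prod>i\<in>UNIV. - 2 * \<i> * complex_of_real (sin (2 * pi * t $ i * \<xi> $ i))) * cis (2 * pi * (x \<bullet> \<xi>)))"
    unfolding tensor_delta_def
    using fold_delta_coord_fourier_integral[OF integrable_riesz_multiplier[OF f a] finite, of t] by simp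
  also have "\<dots> = (LINT \<xi>|lborel. (\<Prod>i\<in>UNIV. - 2 * \<i> * complex_of_real (sin (2 * pi * t $ i * \<xi> $ i) * \<bar>\<xi> $ i\<bar> powr (- \<alpha> $ i)))
       * (fourier f \<xi> * cis (2 * pi * (x \<bullet> \<xi>))))"
    by (intro Bochner_Integration.integral_cong refl) (simp only: prod.distrib of_real_mult of_real_prod mult_ac)
  finally show ?thesis .
qed

text \<open>Oddness of the sine produces the signs sgn(\<xi>_i). The extra factor exp(-\<alpha>_i
  y_i) is the square root of the weight t_i^(-2\<alpha>_i) in \<open>D_square\<close>; it combines
  with |\<xi>_i|^(-\<alpha>_i) into the exponential of the sine kernel.\<close>

lemma tensor_delta_exp:
  fixes f :: "real ^ 'n \<Rightarrow> complex"
  assumes f: "schwartz f" and a: "\<And>i. 0 < \<alpha> $ i \<and> \<alpha> $ i < 1"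
  shows "tensor_delta (\<chi> i. exp (y $ i)) (riesz_potential \<alpha> f) x * complex_of_real (\<Prod>i\<in>UNIV. exp (- \<alpha> $ i * y $ i)) =
    (- 2 * \<i>) ^ CARD('n) * product_operator (\<lambda>i. sine_kernel (\<alpha> $ i)) (\<lambda>\<xi>. fourier f \<xi> * cis (2 * pi * (x \<bullet> \<xi>))) y"
proof -
  let ?p = "complex_of_real (\<Prod>i\<in>UNIV. exp (- \<alpha> $ i * y $ i))"
  have k: "(\<Prod>i\<in>UNIV. - 2 * \<i> * complex_of_real (sin (2 * pi * exp (y $ i) * \<xi> $ i) * \<bar>\<xi> $ i\<bar> powr (- \<alpha> $ i))) * ?p
      = (- 2 * \<i>) ^ CARD('n) * complex_of_real (product_kernel (\<lambda>i. sine_kernel (\<alpha> $ i)) y \<xi>)" for \<xi> :: "real ^ 'n"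
  proof -
    have "sin (2 * pi * exp (y $ i) * \<xi> $ i) * \<bar>\<xi> $ i\<bar> powr (- \<alpha> $ i) * exp (- \<alpha> $ i * y $ i) = sgn (\<xi> $ i) * sine_kernel (\<alpha> $ i) (y $ i + ln \<bar>\<xi> $ i\<bar>)" for i
    proof (cases "\<xi> $ i = 0")
      case False
      have "exp (- \<alpha> $ i * (y $ i + ln \<bar>\<xi> $ i\<bar>)) = \<bar>\<xi> $ i\<bar> powr (- \<alpha> $ i) * exp (- \<alpha> $ i * y $ i)"
        using False by (simp add: powr_def exp_add[symmetric] algebra_simps)
      moreover have "exp (y $ i + ln \<bar>\<xi> $ i\<bar>) = exp (y $ i) * \<bar>\<xi> $ i\<bar>" using False by (simp add: exp_add)
      moreover have "sin (2 * pi * exp (y $ i) * \<xi> $ i) = sgn (\<xi> $ i) * sin (2 * pi * (exp (y $ i) * \<bar>\<xi> $ i\<bar>))"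
        using False by (cases "0 < \<xi> $ i") (auto simp: sgn_if abs_if mult.assoc)
      ultimately show ?thesis by (simp add: sine_kernel_def mult.assoc)
    qed simp
    then have e: "complex_of_real (sin (2 * pi * exp (y $ i) * \<xi> $ i) * \<bar>\<xi> $ i\<bar> powr (- \<alpha> $ i)) * complex_of_real (exp (- \<alpha> $ i * y $ i)) = complex_of_real (sgn (\<xi> $ i) * sine_kernel (\<alpha> $ i) (y $ i + ln \<bar>\<xi> $ i\<bar>))" for i
      by (simp only: of_real_mult[symmetric])
    have "(\<Prod>i\<in>UNIV. - 2 * \<i> * complex_of_real (sin (2 * pi * exp (y $ i) * \<xi> $ i) * \<bar>\<xi> $ i\<bar> powr (- \<alpha> $ i))) * ?p
      = (\<Prod>i\<in>UNIV. (- 2 * \<i>) * complex_of_real (sgn (\<xi> $ i) * sine_kernel (\<alpha> $ i) (y $ i + ln \<bar>\<xi> $ i\<bar>)))"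
      unfolding of_real_prod prod.distrib[symmetric] mult.assoc[of "- 2 * \<i>"] e ..
    then show ?thesis
      unfolding product_kernel_def of_real_prod by (subst (asm) (2) prod.distrib) (simp only: prod_constant)
  qed
  have "tensor_delta (\<chi> i. exp (y $ i)) (riesz_potential \<alpha> f) x * ?p
    = (LINT \<xi>|lborel. (\<Prod>i\<in>UNIV. - 2 * \<i> * complex_of_real (sin (2 * pi * exp (y $ i) * \<xi> $ i) * \<bar>\<xi> $ i\<bar> powr (- \<alpha> $ i)))
       * (fourier f \<xi> * cis (2 * pi * (x \<bullet> \<xi>)))) * ?p"
    unfolding tensor_delta_riesz_potential[OF f a] vec_lambda_beta ..
  also have "\<dots> = (LINT \<xi>|lborel. ((\<Prod>i\<in>UNIV. - 2 * \<i> * complex_of_real (sin (2 * pi * exp (y $ i) * \<xi> $ i) * \<bar>\<xi> $ i\<bar> powr (- \<alpha> $ i))) * ?p)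
       * (fourier f \<xi> * cis (2 * pi * (x \<bullet> \<xi>))))"
    unfolding integral_mult_left_zero[symmetric] by (intro Bochner_Integration.integral_cong refl) (simp only: mult_ac)
  also have "\<dots> = (- 2 * \<i>) ^ CARD('n) * product_operator (\<lambda>i. sine_kernel (\<alpha> $ i)) (\<lambda>\<xi>. fourier f \<xi> * cis (2 * pi * (x \<bullet> \<xi>))) y"
    unfolding k mult.assoc[of "(- 2 * \<i>) ^ CARD('n)"] product_operator_def by (rule integral_mult_right_zero)
  finally show ?thesis .
qed

lemma D_square_eq:
  fixes f :: "real ^ 'n \<Rightarrow> complex"
  assumes f: "schwartz f" and a: "\<And>i. 0 < \<alpha> $ i \<and> \<alpha> $ i < 1"
  shows "D_square \<alpha> f x = ennsqrt (ennreal ((2 ^ CARD('n))\<^sup>2) *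
    (\<integral>\<^sup>+y. ennreal ((cmod (product_operator (\<lambda>i. sine_kernel (\<alpha> $ i)) (\<lambda>\<xi>. fourier f \<xi> * cis (2 * pi * (x \<bullet> \<xi>))) y))\<^sup>2) \<partial>lborel))"
proof -
  have [measurable]: "f \<in> borel_measurable borel" by (rule schwartz_measurable[OF f])
  define T where "T t = tensor_delta t (riesz_potential \<alpha> f) x" for t
  define S where "S = product_operator (\<lambda>i. sine_kernel (\<alpha> $ i)) (\<lambda>\<xi>. fourier f \<xi> * cis (2 * pi * (x \<bullet> \<xi>)))"
  have Tm [measurable]: "T \<in> borel_measurable borel"
    unfolding T_def[abs_def] tensor_delta_riesz_potential[OF f a] by measurable
  have [measurable]: "S \<in> borel_measurable borel"
    unfolding S_def product_operator_def[abs_def] product_kernel_def by measurable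
  define \<phi> where "\<phi> t = ennreal ((cmod (T t))\<^sup>2 * (\<Prod>i\<in>UNIV. (t $ i) powr (- 2 * \<alpha> $ i)))" for t
  have [measurable]: "\<phi> \<in> borel_measurable borel" unfolding \<phi>_def[abs_def] by measurable
  have "(\<integral>\<^sup>+ t\<in>{t. \<forall>i. 0 < t $ i}. ennreal ((cmod (T t))\<^sup>2 * (\<Prod>i\<in>UNIV. (t $ i) powr (- 2 * \<alpha> $ i)) * (\<Prod>i\<in>UNIV. 1 / t $ i)) \<partial>lborel)
     = (\<integral>\<^sup>+ t\<in>{t. \<forall>i. 0 < t $ i}. \<phi> t * ennreal (\<Prod>i\<in>UNIV. 1 / t $ i) \<partial>lborel)"
  proof (intro nn_integral_cong arg_cong2[where f = "(*)"] refl)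
    fix t :: "real ^ 'n"
    have "0 \<le> (cmod (T t))\<^sup>2 * (\<Prod>i\<in>UNIV. (t $ i) powr (- 2 * \<alpha> $ i))"
      by (intro mult_nonneg_nonneg prod_nonneg) auto
    then show "ennreal ((cmod (T t))\<^sup>2 * (\<Prod>i\<in>UNIV. (t $ i) powr (- 2 * \<alpha> $ i)) * (\<Prod>i\<in>UNIV. 1 / t $ i)) = \<phi> t * ennreal (\<Prod>i\<in>UNIV. 1 / t $ i)"
      unfolding \<phi>_def by (rule ennreal_mult')
  qed
  also have "\<dots> = (\<integral>\<^sup>+ y. \<phi> (\<chi> i. exp (y $ i)) \<partial>lborel)"
    by (rule nn_integral_exp_subst) measurable
  also have "\<dots> = (\<integral>\<^sup>+ y. ennreal ((2 ^ CARD('n))\<^sup>2) * ennreal ((cmod (S y))\<^sup>2) \<partial>lborel)"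
  proof (intro nn_integral_cong)
    fix y :: "real ^ 'n"
    have "(\<Prod>i\<in>UNIV. exp (y $ i) powr (- 2 * \<alpha> $ i)) = (\<Prod>i\<in>UNIV. (exp (- \<alpha> $ i * y $ i))\<^sup>2)"
      by (intro prod.cong refl) (simp add: powr_def exp_double[symmetric])
    also have "\<dots> = (cmod (complex_of_real (\<Prod>i\<in>UNIV. exp (- \<alpha> $ i * y $ i))))\<^sup>2"
      unfolding norm_of_real power2_abs by (simp only: prod_power_distrib)
    finally have "(cmod (T (\<chi> i. exp (y $ i))))\<^sup>2 * (\<Prod>i\<in>UNIV. ((\<chi> i. exp (y $ i)) $ i) powr (- 2 * \<alpha> $ i)) = (cmod (T (\<chi> i. exp (y $ i)) * complex_of_real (\<Prod>i\<in>UNIV. exp (- \<alpha> $ i * y $ i))))\<^sup>2"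
      by (simp only: norm_mult power_mult_distrib vec_lambda_beta)
    also have "\<dots> = (2 ^ CARD('n))\<^sup>2 * (cmod (S y))\<^sup>2"
      unfolding T_def tensor_delta_exp[OF f a] S_def[symmetric] norm_mult norm_power power_mult_distrib by simp
    finally show "\<phi> (\<chi> i. exp (y $ i)) = ennreal ((2 ^ CARD('n))\<^sup>2) * ennreal ((cmod (S y))\<^sup>2)"
      unfolding \<phi>_def by (simp only: ennreal_mult'[OF zero_le_power2])
  qed
  also have "\<dots> = ennreal ((2 ^ CARD('n))\<^sup>2) * (\<integral>\<^sup>+ y. ennreal ((cmod (S y))\<^sup>2) \<partial>lborel)"
    by (rule nn_integral_cmult) measurable
  finally show ?thesis unfolding D_square_def T_def S_def by (rule arg_cong)
qed

section \<open>The Riesz means of the tensor Hilbert transform\<close>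

lemma is_fourier_transform_measurable:
  fixes G :: "real ^ 'n \<Rightarrow> complex"
  assumes "is_fourier_transform g G"
  shows "G \<in> borel_measurable borel"
proof -
  let ?p = "\<lambda>y :: real ^ 'n. complex_of_real (gauss y * gauss (1 *\<^sub>R (0 - y)))"
  have "schwartz ?p" by (rule schwartz_gauss) simp
  then have "integrable lborel (\<lambda>y. G y * ?p y)"
    using assms unfolding is_fourier_transform_def by blast
  then have [measurable]: "(\<lambda>y. G y * ?p y) \<in> borel_measurable borel"
    using borel_measurable_integrable by fastforce
  \<comment> \<open>The test function is strictly positive, so dividing by it recovers
    \<open>G\<close> everywhere.\<close>
  have "(\<lambda>y. (G y * ?p y) / ?p y) \<in> borel_measurable borel" by measurable
  moreover have "(G y * ?p y) / ?p y = G y" for y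
    using gauss_pos[of y] gauss_pos[of "1 *\<^sub>R (0 - y)"] by simp
  ultimately show ?thesis by simp
qed

text \<open>The chosen representative stands under an integral, so its almost everywhere equality
  with the multiplier suffices; being a choice, it has its measurability only from the defining
  property. The indicator of the box is absorbed into the coordinate factors.\<close>

lemma tau_eq:
  fixes f :: "real ^ 'n \<Rightarrow> complex"
  assumes f: "schwartz f"
  shows "tau \<beta> R (tensor_hilbert f) x = (LINT \<xi>|lborel.
     complex_of_real (\<Prod>i\<in>UNIV. if \<bar>\<xi> $ i\<bar> \<le> R $ i then \<beta> $ i * (\<bar>\<xi> $ i\<bar> / R $ i) * (1 - \<bar>\<xi> $ i\<bar> / R $ i) powr (\<beta> $ i - 1) else 0)
        * hilbert_multiplier f \<xi> * cis (2 * pi * (x \<bullet> \<xi>)))"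
proof -
  let ?G = "fourier_dist (tensor_hilbert f)"
  let ?b = "\<lambda>\<xi> i. \<beta> $ i * (\<bar>\<xi> $ i\<bar> / R $ i) * (1 - \<bar>\<xi> $ i\<bar> / R $ i) powr (\<beta> $ i - 1)"
  have "is_fourier_transform (tensor_hilbert f) ?G"
    using is_fourier_transform_tensor_hilbert[OF f]
    unfolding fourier_dist_def by (rule someI[of "is_fourier_transform (tensor_hilbert f)"])
  then have [measurable]: "?G \<in> borel_measurable borel" by (rule is_fourier_transform_measurable)
  have [measurable]: "hilbert_multiplier f \<in> borel_measurable borel" by (rule borel_measurable_hilbert_multiplier[OF f])
  have ind: "indicator {\<xi>. \<forall>i. - R $ i \<le> \<xi> $ i \<and> \<xi> $ i \<le> R $ i} \<xi> *\<^sub>R (complex_of_real (\<Prod>i\<in>UNIV. ?b \<xi> i) * ?G \<xi> * cis (2 * pi * (x \<bullet> \<xi>)))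
     = complex_of_real (\<Prod>i\<in>UNIV. if \<bar>\<xi> $ i\<bar> \<le> R $ i then ?b \<xi> i else 0) * ?G \<xi> * cis (2 * pi * (x \<bullet> \<xi>))" for \<xi>
  proof (cases "\<forall>i. - R $ i \<le> \<xi> $ i \<and> \<xi> $ i \<le> R $ i")
    case True
    then have "\<bar>\<xi> $ i\<bar> \<le> R $ i" for i by (simp add: abs_le_iff minus_le_iff)
    then show ?thesis using True by simp
  next
    case False
    then obtain i where "\<not> \<bar>\<xi> $ i\<bar> \<le> R $ i" by (auto simp: abs_le_iff minus_le_iff)
    then have "(\<Prod>i\<in>UNIV. if \<bar>\<xi> $ i\<bar> \<le> R $ i then ?b \<xi> i else 0) = 0"
      by (intro prod_zero bexI[of _ i]) auto
    then show ?thesis using False by simp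
  qed
  have "tau \<beta> R (tensor_hilbert f) x = (LINT \<xi>|lborel. complex_of_real (\<Prod>i\<in>UNIV. if \<bar>\<xi> $ i\<bar> \<le> R $ i then ?b \<xi> i else 0) * ?G \<xi> * cis (2 * pi * (x \<bullet> \<xi>)))"
    unfolding tau_def set_lebesgue_integral_def ind ..
  also have "\<dots> = (LINT \<xi>|lborel. complex_of_real (\<Prod>i\<in>UNIV. if \<bar>\<xi> $ i\<bar> \<le> R $ i then ?b \<xi> i else 0) * hilbert_multiplier f \<xi> * cis (2 * pi * (x \<bullet> \<xi>)))"
  proof (rule integral_cong_AE)
    show "AE \<xi> in lborel. complex_of_real (\<Prod>i\<in>UNIV. if \<bar>\<xi> $ i\<bar> \<le> R $ i then ?b \<xi> i else 0) * ?G \<xi> * cis (2 * pi * (x \<bullet> \<xi>))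
       = complex_of_real (\<Prod>i\<in>UNIV. if \<bar>\<xi> $ i\<bar> \<le> R $ i then ?b \<xi> i else 0) * hilbert_multiplier f \<xi> * cis (2 * pi * (x \<bullet> \<xi>))"
      using fourier_dist_tensor_hilbert[OF f] by eventually_elim (simp only:)
  qed measurable
  finally show ?thesis .
qed

lemma tau_exp:
  fixes f :: "real ^ 'n \<Rightarrow> complex"
  assumes f: "schwartz f"
  shows "tau \<beta> (\<chi> i. exp (- y $ i)) (tensor_hilbert f) x =
    (- \<i>) ^ CARD('n) * product_operator (\<lambda>i. beta_kernel (\<beta> $ i)) (\<lambda>\<xi>. fourier f \<xi> * cis (2 * pi * (x \<bullet> \<xi>))) y"
proof -
  let ?c = "\<lambda>\<xi> i. if \<bar>\<xi> $ i\<bar> \<le> exp (- y $ i) then \<beta> $ i * (\<bar>\<xi> $ i\<bar> / exp (- y $ i)) * (1 - \<bar>\<xi> $ i\<bar> / exp (- y $ i)) powr (\<beta> $ i - 1) else 0"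
  have c: "?c \<xi> i * sgn (\<xi> $ i) = sgn (\<xi> $ i) * beta_kernel (\<beta> $ i) (y $ i + ln \<bar>\<xi> $ i\<bar>)" for \<xi> :: "real ^ 'n" and i
  proof (cases "\<xi> $ i = 0")
    case False
    define u where "u = \<bar>\<xi> $ i\<bar> / exp (- y $ i)"
    have u: "exp (y $ i + ln \<bar>\<xi> $ i\<bar>) = u" using False by (simp add: u_def exp_add exp_minus field_simps)
    have "(y $ i + ln \<bar>\<xi> $ i\<bar> < 0) = (u < 1)"
      unfolding u[symmetric] by simp
    moreover have "(\<bar>\<xi> $ i\<bar> \<le> exp (- y $ i)) = (u \<le> 1)"
      by (simp add: u_def divide_le_eq_1_pos)
    \<comment> \<open>At u = 1 the closed box contributes \<open>0 powr (\<beta> $ i - 1)\<close>,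
      which is 0 by convention, in agreement with the strict inequality in
      \<open>beta_kernel\<close>.\<close>
    ultimately have "?c \<xi> i = beta_kernel (\<beta> $ i) (y $ i + ln \<bar>\<xi> $ i\<bar>)"
      unfolding beta_kernel_def u u_def[symmetric] by (cases "u = 1") auto
    then show ?thesis by (simp only: mult.commute)
  qed simp
  have k: "complex_of_real (\<Prod>i\<in>UNIV. ?c \<xi> i) * hilbert_multiplier f \<xi> * cis (2 * pi * (x \<bullet> \<xi>))
     = (- \<i>) ^ CARD('n) * (complex_of_real (product_kernel (\<lambda>i. beta_kernel (\<beta> $ i)) y \<xi>) * (fourier f \<xi> * cis (2 * pi * (x \<bullet> \<xi>))))" for \<xi>
  proof -
    have "complex_of_real (\<Prod>i\<in>UNIV. ?c \<xi> i) * (\<Prod>j\<in>UNIV. - \<i> * complex_of_real (sgn (\<xi> $ j))) = (\<Prod>i\<in>UNIV. - \<i> * complex_of_real (?c \<xi> i * sgn (\<xi> $ i)))"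
      unfolding of_real_prod prod.distrib[symmetric] of_real_mult by (intro prod.cong refl) (simp only: mult_ac)
    also have "\<dots> = (- \<i>) ^ CARD('n) * complex_of_real (product_kernel (\<lambda>i. beta_kernel (\<beta> $ i)) y \<xi>)"
      unfolding c product_kernel_def of_real_prod by (subst prod.distrib) (simp only: prod_constant)
    finally have "complex_of_real (\<Prod>i\<in>UNIV. ?c \<xi> i) * (\<Prod>j\<in>UNIV. - \<i> * complex_of_real (sgn (\<xi> $ j))) = (- \<i>) ^ CARD('n) * complex_of_real (product_kernel (\<lambda>i. beta_kernel (\<beta> $ i)) y \<xi>)" .
    then show ?thesis unfolding hilbert_multiplier_def mult.assoc[symmetric] by (simp only:)
  qed
  show ?thesis
    unfolding tau_eq[OF f] vec_lambda_beta k product_operator_def by (rule integral_mult_right_zero)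
qed

lemma h_square_eq:
  fixes f :: "real ^ 'n \<Rightarrow> complex"
  assumes f: "schwartz f"
  shows "h_square \<beta> (tensor_hilbert f) x = ennsqrt
    (\<integral>\<^sup>+y. ennreal ((cmod (product_operator (\<lambda>i. beta_kernel (\<beta> $ i)) (\<lambda>\<xi>. fourier f \<xi> * cis (2 * pi * (x \<bullet> \<xi>))) y))\<^sup>2) \<partial>lborel)"
proof -
  have [measurable]: "hilbert_multiplier f \<in> borel_measurable borel" by (rule borel_measurable_hilbert_multiplier[OF f])
  define T where "T R = tau \<beta> R (tensor_hilbert f) x" for R
  have [measurable]: "T \<in> borel_measurable borel"
    unfolding T_def[abs_def] tau_eq[OF f] by measurable
  define \<phi> where "\<phi> R = ennreal ((cmod (T R))\<^sup>2)" for R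
  have [measurable]: "\<phi> \<in> borel_measurable borel" unfolding \<phi>_def[abs_def] by measurable
  have "(\<integral>\<^sup>+ R\<in>{R. \<forall>i. 0 < R $ i}. ennreal ((cmod (T R))\<^sup>2 * (\<Prod>i\<in>UNIV. 1 / R $ i)) \<partial>lborel)
     = (\<integral>\<^sup>+ R\<in>{R. \<forall>i. 0 < R $ i}. \<phi> R * ennreal (\<Prod>i\<in>UNIV. 1 / R $ i) \<partial>lborel)"
    unfolding \<phi>_def ennreal_mult'[OF zero_le_power2] ..
  also have "\<dots> = (\<integral>\<^sup>+ y. \<phi> (\<chi> i. exp (y $ i)) \<partial>lborel)"
    by (rule nn_integral_exp_subst) measurable
  \<comment> \<open>The reflection is needed because \<open>tau\<close> sees \<xi> through
    |\<xi>_i|/R_i, so R = e^(-y) gives the same sign of \<open>y\<close> as t = e^y does for the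
    differences.\<close>
  also have "\<dots> = (\<integral>\<^sup>+ y. \<phi> (\<chi> i. exp ((- y) $ i)) \<partial>lborel)"
    by (rule nn_integral_uminus_lborel[symmetric]) measurable
  finally show ?thesis
    unfolding h_square_def T_def[symmetric] \<phi>_def
    unfolding T_def vector_uminus_component tau_exp[OF f] norm_mult norm_power
    by simp
qed

section \<open>Square roots in [0, \<infinity>] and the comparison of the square functions\<close>

lemma ennsqrt_mono: "x \<le> y \<Longrightarrow> ennsqrt x \<le> ennsqrt y"
  by (cases x; cases y) (auto simp: ennsqrt_def top_unique ennreal_leI)

lemma ennsqrt_mult:
  assumes "0 < r" shows "ennsqrt (ennreal (r\<^sup>2) * x) = ennreal r * ennsqrt x"
proof (cases x)
  case (real t)
  then show ?thesis
    using assms by (simp add: ennsqrt_def ennreal_mult[symmetric] real_sqrt_mult)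
next
  case top
  then show ?thesis using assms by (simp add: ennsqrt_def ennreal_mult_top)
qed

theorem theorem3:
  fixes \<alpha> \<beta> :: "real ^ 'n"
  assumes "\<And>i. 0 < \<alpha> $ i \<and> \<alpha> $ i < 1"
    and "\<beta> = (\<chi> i. 1 / 2) + \<alpha>"
  shows "\<exists>A B :: real. 0 < A \<and> 0 < B \<and>
    (\<forall>f :: real ^ 'n \<Rightarrow> complex. schwartz f \<longrightarrow>
      (\<forall>x. ennreal A * D_square \<alpha> f x \<le> h_square \<beta> (tensor_hilbert f) x \<and>
           h_square \<beta> (tensor_hilbert f) x \<le> ennreal B * D_square \<alpha> f x))"
proof -
  let ?S = "\<lambda>i. sine_kernel (\<alpha> $ i)" and ?B = "\<lambda>i. beta_kernel (\<beta> $ i)"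
  have a: "0 < \<alpha> $ i" "\<alpha> $ i < 1" for i using assms(1) by auto
  have \<beta>: "\<beta> $ i = 1 / 2 + \<alpha> $ i" for i by (simp add: assms(2))
  have "\<forall>i. \<exists>c C. 0 < c \<and> 0 < C \<and> (\<forall>l. c * cmod (mellin (?S i) l) \<le> cmod (mellin (?B i) l) \<and> cmod (mellin (?B i) l) \<le> C * cmod (mellin (?S i) l))"
    using mellin_kernels_comparable[OF a] unfolding \<beta> by meson
  then obtain c C where c: "\<And>i. 0 < c i" and C: "\<And>i. 0 < C i"
    and lo: "\<And>i l. c i * cmod (mellin (?S i) l) \<le> cmod (mellin (?B i) l)"
    and hi: "\<And>i l. cmod (mellin (?B i) l) \<le> C i * cmod (mellin (?S i) l)"
    by metis
  have iS: "integrable lborel (?S i)" for i by (rule integrable_sine_kernel[OF a])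
  have iB: "integrable lborel (?B i)" for i by (rule integrable_beta_kernel) (use a[of i] in \<open>simp add: \<beta>\<close>)
  have lo': "cmod (mellin (?S i) l) \<le> inverse (c i) * cmod (mellin (?B i) l)" for i l
    using lo[of i l] c[of i] by (simp add: field_simps)
  \<comment> \<open>The power of 2 cancels the modulus of (-2i)^n that the differences contribute to
    \<open>D_square\<close>.\<close>
  define A where "A = (\<Prod>i\<in>UNIV. c i) / 2 ^ CARD('n)"
  define B where "B = (\<Prod>i\<in>UNIV. C i) / 2 ^ CARD('n)"
  have pos: "0 < (\<Prod>i\<in>UNIV. c i)" "0 < (\<Prod>i\<in>UNIV. C i)" using c C by (auto intro: prod_pos)
  have AB: "0 < A" "0 < B" using pos by (simp_all add: A_def B_def)
  have "ennreal A * D_square \<alpha> f x \<le> h_square \<beta> (tensor_hilbert f) x \<and>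
        h_square \<beta> (tensor_hilbert f) x \<le> ennreal B * D_square \<alpha> f x" if f: "schwartz f" for f x
  proof -
    let ?\<Phi> = "\<lambda>\<xi>. fourier f \<xi> * cis (2 * pi * (x \<bullet> \<xi>))"
    obtain M where M: "\<And>\<xi>. cmod (?\<Phi> \<xi>) \<le> M * cauchy_weight \<xi>" using modulated_fourier(2)[OF f, of x] by blast
    note \<Phi> = modulated_fourier(1)[OF f, of x] M
    let ?X = "\<integral>\<^sup>+y. ennreal ((cmod (product_operator ?S ?\<Phi> y))\<^sup>2) \<partial>lborel"
    let ?Y = "\<integral>\<^sup>+y. ennreal ((cmod (product_operator ?B ?\<Phi> y))\<^sup>2) \<partial>lborel"
    have D: "D_square \<alpha> f x = ennreal (2 ^ CARD('n)) * ennsqrt ?X"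
      unfolding D_square_eq[OF f assms(1)] by (rule ennsqrt_mult) simp
    have h: "h_square \<beta> (tensor_hilbert f) x = ennsqrt ?Y" by (rule h_square_eq[OF f])
    have "?Y \<le> ennreal ((\<Prod>i\<in>UNIV. C i)\<^sup>2) * ?X"
      by (rule product_operator_le[OF iB iS \<Phi> C hi])
    then have upper: "ennsqrt ?Y \<le> ennreal (\<Prod>i\<in>UNIV. C i) * ennsqrt ?X"
      unfolding ennsqrt_mult[OF pos(2), symmetric] by (rule ennsqrt_mono)
    have pos': "0 < (\<Prod>i\<in>UNIV. inverse (c i))" using c by (auto intro: prod_pos)
    have "?X \<le> ennreal ((\<Prod>i\<in>UNIV. inverse (c i))\<^sup>2) * ?Y"
      by (rule product_operator_le[OF iS iB \<Phi> _ lo']) (use c in auto)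
    then have "ennsqrt ?X \<le> ennreal (\<Prod>i\<in>UNIV. inverse (c i)) * ennsqrt ?Y"
      unfolding ennsqrt_mult[OF pos', symmetric] by (rule ennsqrt_mono)
    \<comment> \<open>The inverse constants are cleared by multiplication, which remains valid when
      the square functions are infinite.\<close>
    then have "ennreal (\<Prod>i\<in>UNIV. c i) * ennsqrt ?X \<le> ennreal (\<Prod>i\<in>UNIV. c i) * (ennreal (\<Prod>i\<in>UNIV. inverse (c i)) * ennsqrt ?Y)"
      by (rule mult_left_mono) simp
    also have "\<dots> = ennreal ((\<Prod>i\<in>UNIV. c i) * (\<Prod>i\<in>UNIV. inverse (c i))) * ennsqrt ?Y"
      unfolding mult.assoc[symmetric] ennreal_mult'[OF less_imp_le[OF pos(1)]] ..
    also have "(\<Prod>i\<in>UNIV. c i) * (\<Prod>i\<in>UNIV. inverse (c i)) = 1"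
      unfolding prod.distrib[symmetric] using c by (simp add: less_imp_neq[symmetric])
    finally have lower: "ennreal (\<Prod>i\<in>UNIV. c i) * ennsqrt ?X \<le> ennsqrt ?Y" by simp
    have "ennreal A * D_square \<alpha> f x = ennreal (\<Prod>i\<in>UNIV. c i) * ennsqrt ?X"
         "ennreal B * D_square \<alpha> f x = ennreal (\<Prod>i\<in>UNIV. C i) * ennsqrt ?X"
      unfolding D mult.assoc[symmetric] ennreal_mult'[OF less_imp_le[OF AB(1)], symmetric] ennreal_mult'[OF less_imp_le[OF AB(2)], symmetric]
      by (simp_all add: A_def B_def)
    then show ?thesis unfolding h using upper lower by simp
  qed
  then show ?thesis using AB by blast
qed

end
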